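(* Let $k\ge1$ be an integer. Then (1) $c^k_\beta\to c^k_\infty$ as $\beta\to+\infty$; (2) if $\beta_n\to+\infty$ and, for each $n$, $A_n\in\mathcal{F}_k$ is an optimal set for $c^k_{\beta_n}$, i.e. $\sup_{A_n}J_{\beta_n}=c^k_{\beta_n}$, then $A_\infty=\limsup_nA_n$ (in the $L^2$-sense) belongs to $\mathcal{F}_k$ and satisfies $\sup_{A_\infty}J_\infty=c^k_\infty$.
   Context: $\Omega\subset\mathbb{R}^N$ ($N=2,3$) is a smooth bounded domain; $\|u\|^2=\int_\Omega|\nabla u|^2$, $|u|_p$ is the $L^p(\Omega)$ norm. For $0<\beta<+\infty$, $J_\beta(u,v)=\frac12(\|u\|^2+\|v\|^2)+\frac14\int_\Omega(u^4+v^4)+\frac\beta2\int_\Omega u^2v^2$, and $J_\infty=\sup_{\beta>0}J_\beta$. $M=\{(u,v)\in H^1_0(\Omega)^2: u,v\ge0,\ |u|_2=|v|_2=1\}$ with the $L^2$-distance $\mathrm{dist}((u_1,v_1),(u_2,v_2))^2=|u_1-u_2|_2^2+|v_1-v_2|_2^2$. $\sigma(u,v)=(v,u)$. $\mathcal{F}_0$: subsets $A\subset M$ closed in the $L^2$-topology with $\sigma(A)=A$. $L^2$-genus $\gamma_2(A)$: least $m$ such that there is an $L^2$-continuous $f:A\to\mathbb{R}^m\setminus\{0\}$ with $f\circ\sigma=-f$ on $A$ ($+\infty$ if none, $\gamma_2(\emptyset)=0$). $\mathcal{F}_k=\{A\in\mathcal{F}_0:\gamma_2(A)\ge k\}$,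 $c^k_\beta=\inf_{A\in\mathcal{F}_k}\sup_AJ_\beta$ ($0<\beta\le\infty$). For sets $A_n\subset M$, $\limsup_nA_n$ is the set of $x\in M$ such that for some $n_j\to\infty$ there are $x_{n_j}\in A_{n_j}$ with $\mathrm{dist}(x_{n_j},x)\to0$. *)

theory Defs
  imports "HOL-Analysis.Analysis"
begin

text \<open>C-infinity on an open set: differentiable, and every directional
  derivative is again C-infinity (greatest fixed point = all orders).\<close>
coinductive smooth_fun_on :: "(real^'n) set \<Rightarrow> (real^'n \<Rightarrow> real) \<Rightarrow> bool" where
  "f differentiable_on U \<Longrightarrow>
   (\<And>e. smooth_fun_on U (\<lambda>x. frechet_derivative f (at x) e)) \<Longrightarrow>
   smooth_fun_on U f"

definition smooth_boundary :: "(real^'n) set \<Rightarrow> bool" where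
  "smooth_boundary \<Omega> \<longleftrightarrow>
     (\<forall>p\<in>frontier \<Omega>. \<exists>U \<phi>. open U \<and> p \<in> U \<and> smooth_fun_on U \<phi> \<and>
        (\<forall>x\<in>U. frechet_derivative \<phi> (at x) \<noteq> (\<lambda>h. 0)) \<and>
        \<Omega> \<inter> U = {x\<in>U. \<phi> x < 0})"

definition smooth_bounded_domain :: "(real^'n) set \<Rightarrow> bool" where
  "smooth_bounded_domain \<Omega> \<longleftrightarrow>
     open \<Omega> \<and> connected \<Omega> \<and> \<Omega> \<noteq> {} \<and> bounded \<Omega> \<and> smooth_boundary \<Omega>"

definition C1c_grad :: "(real^'n) set \<Rightarrow> (real^'n \<Rightarrow> real) \<Rightarrow> (real^'n \<Rightarrow> real^'n) \<Rightarrow> bool" where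
  "C1c_grad \<Omega> \<phi> g \<longleftrightarrow> continuous_on UNIV g \<and>
     (\<forall>x. (\<phi> has_derivative (\<lambda>h. g x \<bullet> h)) (at x)) \<and>
     compact (closure {x. \<phi> x \<noteq> 0}) \<and> closure {x. \<phi> x \<noteq> 0} \<subseteq> \<Omega>"

text \<open>H^1_0(Omega) = closure of C^1_c(Omega) in the H^1 norm (Brezis' definition);
  functions are extended by zero outside Omega; g is the (weak) gradient.\<close>
definition H10_grad :: "(real^'n) set \<Rightarrow> (real^'n \<Rightarrow> real) \<Rightarrow> (real^'n \<Rightarrow> real^'n) \<Rightarrow> bool" where
  "H10_grad \<Omega> u g \<longleftrightarrow> u \<in> borel_measurable lebesgue \<and> g \<in> borel_measurable lebesgue \<and>
     (\<exists>\<phi> dg. (\<forall>n. C1c_grad \<Omega> (\<phi> n) (dg n)) \<and>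
        ((\<lambda>n. \<integral>\<^sup>+ x. ennreal ((\<phi> n x - u x)\<^sup>2) \<partial>lebesgue) \<longlongrightarrow> 0) sequentially \<and>
        ((\<lambda>n. \<integral>\<^sup>+ x. ennreal ((norm (dg n x - g x))\<^sup>2) \<partial>lebesgue) \<longlongrightarrow> 0) sequentially)"

definition H10 :: "(real^'n) set \<Rightarrow> (real^'n \<Rightarrow> real) set" where
  "H10 \<Omega> = {u. \<exists>g. H10_grad \<Omega> u g}"

definition H10_norm2 :: "(real^'n) set \<Rightarrow> (real^'n \<Rightarrow> real) \<Rightarrow> real" where
  "H10_norm2 \<Omega> u = (LINT x:\<Omega>|lebesgue. (norm ((SOME g. H10_grad \<Omega> u g) x))\<^sup>2)"

definition J :: "(real^'n) set \<Rightarrow> real \<Rightarrow> (real^'n \<Rightarrow> real) \<times> (real^'n \<Rightarrow> real) \<Rightarrow> real" where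
  "J \<Omega> \<beta> w = (case w of (u, v) \<Rightarrow>
     (H10_norm2 \<Omega> u + H10_norm2 \<Omega> v) / 2
     + (LINT x:\<Omega>|lebesgue. u x ^ 4 + v x ^ 4) / 4
     + \<beta> / 2 * (LINT x:\<Omega>|lebesgue. (u x)\<^sup>2 * (v x)\<^sup>2))"

definition J_inf :: "(real^'n) set \<Rightarrow> (real^'n \<Rightarrow> real) \<times> (real^'n \<Rightarrow> real) \<Rightarrow> ereal" where
  "J_inf \<Omega> w = (SUP \<beta>\<in>{0<..}. ereal (J \<Omega> \<beta> w))"

definition L2norm :: "(real^'n) set \<Rightarrow> (real^'n \<Rightarrow> real) \<Rightarrow> real" where
  "L2norm \<Omega> u = sqrt (LINT x:\<Omega>|lebesgue. (u x)\<^sup>2)"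

definition M :: "(real^'n) set \<Rightarrow> ((real^'n \<Rightarrow> real) \<times> (real^'n \<Rightarrow> real)) set" where
  "M \<Omega> = {(u, v). u \<in> H10 \<Omega> \<and> v \<in> H10 \<Omega> \<and>
      (AE x in lebesgue. x \<in> \<Omega> \<longrightarrow> u x \<ge> 0) \<and> (AE x in lebesgue. x \<in> \<Omega> \<longrightarrow> v x \<ge> 0) \<and>
      L2norm \<Omega> u = 1 \<and> L2norm \<Omega> v = 1}"

definition dist2 :: "(real^'n) set \<Rightarrow> (real^'n \<Rightarrow> real) \<times> (real^'n \<Rightarrow> real)
     \<Rightarrow> (real^'n \<Rightarrow> real) \<times> (real^'n \<Rightarrow> real) \<Rightarrow> real" where
  "dist2 \<Omega> w1 w2 = sqrt ((L2norm \<Omega> (\<lambda>x. fst w1 x - fst w2 x))\<^sup>2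
                        + (L2norm \<Omega> (\<lambda>x. snd w1 x - snd w2 x))\<^sup>2)"

definition swap_uv :: "'a \<times> 'a \<Rightarrow> 'a \<times> 'a" where
  "swap_uv w = (snd w, fst w)"

definition L2_closed_in_M :: "(real^'n) set \<Rightarrow> ((real^'n \<Rightarrow> real) \<times> (real^'n \<Rightarrow> real)) set \<Rightarrow> bool" where
  "L2_closed_in_M \<Omega> A \<longleftrightarrow> A \<subseteq> M \<Omega> \<and>
     (\<forall>x\<in>M \<Omega>. (\<forall>e>0. \<exists>y\<in>A. dist2 \<Omega> x y < e) \<longrightarrow> x \<in> A)"

definition F0 :: "(real^'n) set \<Rightarrow> ((real^'n \<Rightarrow> real) \<times> (real^'n \<Rightarrow> real)) set set" where
  "F0 \<Omega> = {A. L2_closed_in_M \<Omega> A \<and> swap_uv ` A = A}"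

text \<open>Maps into R^m are represented as functions \<open>nat \<Rightarrow> real\<close> vanishing at indices \<open>\<ge> m\<close>.\<close>
definition genus_map :: "(real^'n) set \<Rightarrow> ((real^'n \<Rightarrow> real) \<times> (real^'n \<Rightarrow> real)) set \<Rightarrow> nat
     \<Rightarrow> ((real^'n \<Rightarrow> real) \<times> (real^'n \<Rightarrow> real) \<Rightarrow> nat \<Rightarrow> real) \<Rightarrow> bool" where
  "genus_map \<Omega> A m f \<longleftrightarrow>
     (\<forall>x\<in>A. \<forall>i\<ge>m. f x i = 0) \<and>
     (\<forall>x\<in>A. \<exists>i<m. f x i \<noteq> 0) \<and>
     (\<forall>x\<in>A. \<forall>e>0. \<exists>d>0. \<forall>y\<in>A. dist2 \<Omega> x y < d \<longrightarrow>
         sqrt (\<Sum>i<m. (f x i - f y i)\<^sup>2) < e) \<and>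
     (\<forall>x\<in>A. \<forall>i. f (swap_uv x) i = - f x i)"

definition genus2 :: "(real^'n) set \<Rightarrow> ((real^'n \<Rightarrow> real) \<times> (real^'n \<Rightarrow> real)) set \<Rightarrow> enat" where
  "genus2 \<Omega> A = (if \<exists>m f. genus_map \<Omega> A m f
                   then enat (LEAST m. \<exists>f. genus_map \<Omega> A m f) else \<infinity>)"

definition Fk :: "(real^'n) set \<Rightarrow> nat \<Rightarrow> ((real^'n \<Rightarrow> real) \<times> (real^'n \<Rightarrow> real)) set set" where
  "Fk \<Omega> k = {A \<in> F0 \<Omega>. genus2 \<Omega> A \<ge> enat k}"

definition c_beta :: "(real^'n) set \<Rightarrow> nat \<Rightarrow> real \<Rightarrow> ereal" where
  "c_beta \<Omega> k \<beta> = (INF A\<in>Fk \<Omega> k. SUP w\<in>A. ereal (J \<Omega> \<beta> w))"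

definition c_inf :: "(real^'n) set \<Rightarrow> nat \<Rightarrow> ereal" where
  "c_inf \<Omega> k = (INF A\<in>Fk \<Omega> k. SUP w\<in>A. J_inf \<Omega> w)"

definition L2_limsup :: "(real^'n) set \<Rightarrow> (nat \<Rightarrow> ((real^'n \<Rightarrow> real) \<times> (real^'n \<Rightarrow> real)) set)
     \<Rightarrow> ((real^'n \<Rightarrow> real) \<times> (real^'n \<Rightarrow> real)) set" where
  "L2_limsup \<Omega> A = {x\<in>M \<Omega>. \<exists>r xs. strict_mono r \<and> (\<forall>j. xs j \<in> A (r j)) \<and>
                        ((\<lambda>j. dist2 \<Omega> (xs j) x) \<longlongrightarrow> 0) sequentially}"

end

theory Submission
  imports Defs "HOL-Homology.Simplices" "HOL-Library.Diagonal_Subsequence"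
begin

text \<open>
  The levels \<open>c_beta\<close> increase with \<open>\<beta>\<close> and are bounded by \<open>c_inf\<close>, so everything reduces to one
  statement: if \<open>\<beta>s n\<close> tends to infinity and the sets \<open>A n\<close> of genus at least \<open>k\<close> satisfy
  \<open>J (\<beta>s n) \<le> a n\<close> on \<open>A n\<close> with \<open>a n\<close> tending to \<open>L\<close>, then their upper limit has genus at least
  \<open>k\<close> and \<open>J_inf \<le> L\<close> on it. The energy bound is lower semicontinuity of \<open>J \<beta>\<close> for fixed \<open>\<beta>\<close>. For the
  genus, the upper limit is compact by Rellich's theorem, so an odd map on it yields an odd map
  on a neighbourhood, which contains some \<open>A n\<close>.

  The level \<open>c_inf\<close> has to be finite, as otherwise the upper limit might be empty: a sphere
  of pairs of functions with disjoint supports has large genus by the Borsuk--Ulam theorem.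

  The dimension enters only through Ladyzhenskaya's inequality: without \<open>H10 \<subseteq> L\<^sup>4\<close> the
  integrals in \<open>J\<close> could take the value 0 of a non-integrable function.
\<close>

section \<open>The Borsuk--Ulam theorem\<close>

text \<open>Sublevel sets of \<open>J\<close> in \<open>M\<close> are compact for
  \<open>dist2\<close>, so points of the \<open>A n\<close> with bounded energy always cluster at a
  point of the upper limit. As \<open>J\<close> increases with \<beta>, bounds for the growing
  couplings give a bound for each fixed coupling in the limit, and the supremum over these is
  \<open>J_inf\<close>. It can only be finite if the product of the two components vanishes almost
  everywhere.

  The elements of \<open>M\<close> are functions, not classes modulo null sets, so
  \<open>dist2\<close> is only a pseudometric. The extension of odd maps is therefore formulated for
  a symmetric function with the triangle inequality, and the sphere that bounds \<open>c_inf\<close>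
  has to be replaced by its closure.

  The Borsuk--Ulam theorem is proved by Ky Fan's count of alternating simplices. The symmetric
  triangulation of the sphere is an iterated subdivision of a singular chain: naturality of
  subdivision provides the symmetry, and its compatibility with the boundary operator replaces the
  bookkeeping of adjacent simplices.\<close>

fun alternating :: "bool \<Rightarrow> nat list \<Rightarrow> bool" where
  "alternating s [] = True"
| "alternating s (x # xs) = (even x = s \<and> alternating (\<not> s) xs)"

definition remove_nth :: "nat \<Rightarrow> 'a list \<Rightarrow> 'a list" where
  "remove_nth i xs = take i xs @ drop (Suc i) xs"

lemma remove_nth_0 [simp]: "remove_nth 0 (x # xs) = xs"
  by (simp add: remove_nth_def)

lemma remove_nth_Suc [simp]: "remove_nth (Suc i) (x # xs) = x # remove_nth i xs"
  by (simp add: remove_nth_def)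

text \<open>Ky Fan's parity count in a single simplex. An alternating list of at least two entries
  stays alternating only if an end is deleted, and the two end deletions start with opposite signs,
  so exactly one starts with \<open>s\<close>. In a list that does not alternate, the alternating
  deletions come in pairs, one for each of two adjacent entries of equal sign. The induction
  reproduces this by separating the deletion of the head.\<close>

lemma sum_alternating_remove_nth:
  "even ((\<Sum>i<length xs. of_bool (alternating s (remove_nth i xs)))
     + of_bool (alternating s xs) + of_bool (alternating (\<not> s) xs) :: int)"
proof (induction xs arbitrary: s)
  case Nil
  then show ?case by simp
next
  case (Cons x xs)
  have "(\<Sum>i<length (x # xs). of_bool (alternating s (remove_nth i (x # xs)))) =
      (of_bool (alternating s xs) +
       (\<Sum>i<length xs. of_bool (even x = s \<and> alternating (\<not> s) (remove_nth i xs))) :: int)"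
    by (simp only: length_Cons sum.lessThan_Suc_shift remove_nth_0 remove_nth_Suc alternating.simps)
  moreover have "(\<Sum>i<length xs. of_bool (even x = s \<and> alternating (\<not> s) (remove_nth i xs))) =
      (of_bool (even x = s) * (\<Sum>i<length xs. of_bool (alternating (\<not> s) (remove_nth i xs))) :: int)"
    by (simp add: sum_distrib_left)
  ultimately show ?case
    using Cons.IH[of "\<not> s"] by (cases "even x = s") auto
qed

lemma mset_remove_nth:
  assumes "i < length xs"
  shows "mset (remove_nth i xs) = mset xs - {#xs ! i#}"
proof -
  have "mset xs = mset (take i xs @ xs ! i # drop (Suc i) xs)"
    using assms by (simp add: id_take_nth_drop[symmetric])
  then show ?thesis
    by (simp add: remove_nth_def)
qed

lemma sum_mset_remove_nth:
  "(\<Sum>i<length xs. F (mset (remove_nth i xs))) = (\<Sum>x\<in>#mset xs. F (mset xs - {#x#}))"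
proof -
  have "(\<Sum>i<length xs. F (mset (remove_nth i xs))) = (\<Sum>i<length xs. F (mset xs - {#xs ! i#}))"
    by (rule sum.cong) (auto simp: mset_remove_nth)
  also have "\<dots> = (\<Sum>x\<leftarrow>xs. F (mset xs - {#x#}))"
    by (simp add: sum_list_sum_nth atLeast0LessThan)
  finally show ?thesis
    by (simp add: sum_mset_sum_list[symmetric] del: sum_mset_sum_list)
qed

lemma sort_remove_nth:
  assumes "sorted xs"
  shows "sort (remove_nth i xs) = remove_nth i xs"
proof (rule sorted_sort_id)
  have "remove_nth i xs = nths xs {j. j \<noteq> i}"
  proof (induction xs arbitrary: i)
    case Nil
    then show ?case by (simp add: remove_nth_def)
  next
    case (Cons x xs)
    show ?case
    proof (cases i)
      case 0
      have "nths xs UNIV = xs" by (rule nths_all) simp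
      with 0 show ?thesis by (simp add: nths_Cons)
    next
      case (Suc j)
      then show ?thesis using Cons[of j] by (simp add: nths_Cons)
    qed
  qed
  then show "sorted (remove_nth i xs)"
    using assms by (simp add: sorted_nths)
qed

text \<open>The faces of a simplex are numbered by its vertices, not by the order of their labels.
  The sum over all deletions depends only on the multiset of labels, so the list may be sorted
  beforehand.\<close>

lemma sum_alternating_sort_remove_nth:
  "even ((\<Sum>i<length xs. of_bool (alternating s (sort (remove_nth i xs))))
     + of_bool (alternating s (sort xs)) + of_bool (alternating (\<not> s) (sort xs)) :: int)"
proof -
  define F where "F M = (of_bool (alternating s (sorted_list_of_multiset M)) :: int)" for M
  have F: "of_bool (alternating s (sort ys)) = F (mset ys)" for ys
    by (simp add: F_def)
  have "(\<Sum>i<length xs. of_bool (alternating s (sort (remove_nth i xs)))) =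
      (\<Sum>x\<in>#mset xs. F (mset xs - {#x#}))"
    by (simp add: F sum_mset_remove_nth)
  also have "\<dots> = (\<Sum>x\<in>#mset (sort xs). F (mset (sort xs) - {#x#}))"
    by simp
  also have "\<dots> = (\<Sum>i<length (sort xs). of_bool (alternating s (sort (remove_nth i (sort xs)))))"
    by (simp only: F sum_mset_remove_nth)
  also have "\<dots> = (\<Sum>i<length (sort xs). of_bool (alternating s (remove_nth i (sort xs))))"
    by (simp add: sort_remove_nth)
  finally show ?thesis
    using sum_alternating_remove_nth[of s "sort xs"] by simp
qed

section \<open>Signed labels\<close>

definition flip :: "nat \<Rightarrow> nat" where
  "flip a = (if even a then Suc a else a - 1)"

lemma even_flip [simp]: "even (flip a) \<longleftrightarrow> odd a"
  by (auto simp: flip_def)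

lemma flip_div_2 [simp]: "flip a div 2 = a div 2"
  by (auto simp: flip_def elim!: oddE)

text \<open>A label stands for a signed index: \<open>2 * j\<close> and \<open>2 * j + 1\<close> are
  the two signs of the index \<open>j\<close>, and \<open>flip\<close> changes the sign. The
  condition is Tucker's: no two vertices of a simplex carry opposite labels.\<close>

definition complement_free :: "nat set \<Rightarrow> bool" where
  "complement_free L \<longleftrightarrow> (\<forall>a\<in>L. flip a \<notin> L)"

lemma complement_free_div_2:
  assumes "complement_free L" "a \<in> L" "b \<in> L" "a div 2 = b div 2"
  shows "a = b"
proof (rule ccontr)
  assume "a \<noteq> b"
  moreover have "b = flip a" if "a = 2 * m + i" "b = 2 * m + j" "i < 2" "j < 2" "a \<noteq> b" for m i j
    using that by (auto simp: flip_def less_2_cases_iff)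
  ultimately have "b = flip a"
    using assms(4) mult_div_mod_eq[of 2 a] mult_div_mod_eq[of 2 b] by (metis mod_less_divisor zero_less_numeral)
  with assms show False by (auto simp: complement_free_def)
qed

text \<open>\<open>flip\<close> reverses the order only inside a pair \<open>2 * j\<close>,
  \<open>2 * j + 1\<close>, and a complement-free set contains at most one label of each
  pair.\<close>

lemma flip_mono:
  assumes "complement_free L" "a \<in> L" "b \<in> L" "a \<le> b"
  shows "flip a \<le> flip b"
proof (cases "a div 2 = b div 2")
  case True
  then show ?thesis using complement_free_div_2[OF assms(1-3)] by simp
next
  case False
  then have "a div 2 < b div 2" using assms(4) by (simp add: div_le_mono le_neq_implies_less)
  then have "flip a div 2 < flip b div 2" by simp
  then show ?thesis using div_le_mono[of "flip b" "flip a" 2] by linarith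
qed

lemma alternating_map_flip: "alternating s (map flip xs) = alternating (\<not> s) xs"
  by (induction xs arbitrary: s) auto

lemma sort_map_flip:
  assumes "complement_free (set xs)"
  shows "sort (map flip xs) = map flip (sort xs)"
proof (rule properties_for_sort)
  show "sorted (map flip (sort xs))"
    unfolding sorted_map
    by (rule sorted_wrt_mono_rel[of _ "(\<le>)"]) (auto intro: flip_mono[OF assms])
qed auto

text \<open>Neighbours in the list differ in sign, so a sorted alternating list has no repeated
  labels; in a complement-free set distinct labels have distinct indices, and there are only
  \<open>m\<close> of these. This is the bound that finally yields the Borsuk--Ulam theorem.\<close>

lemma alternating_length:
  assumes "alternating s xs" "sorted xs" "complement_free (set xs)" "set xs \<subseteq> {..<2 * m}"
  shows "length xs \<le> m"
proof -
  have "distinct (map (\<lambda>a. a div 2) xs)"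
    using assms(1-3)
  proof (induction s xs rule: alternating.induct)
    case (2 s x xs)
    have "x div 2 \<noteq> y div 2" if "y \<in> set xs" for y
    proof
      assume eq: "x div 2 = y div 2"
      then have "x = y"
        using complement_free_div_2[OF 2(4), of x y] that by simp
      from that obtain z zs where z: "xs = z # zs" by (cases xs) auto
      have "x \<le> z" "z \<le> y" using 2(3) that z by auto
      then have "z = x" using \<open>x = y\<close> by simp
      then show False using 2(2) z by auto
    qed
    moreover have "distinct (map (\<lambda>a. a div 2) xs)"
      using 2 by (auto simp: complement_free_def)
    ultimately show ?case by auto
  qed simp
  then have "length xs = card ((\<lambda>a. a div 2) ` set xs)"
    using distinct_card by fastforce
  also have "\<dots> \<le> card {..<m}"
    using assms(4) by (intro card_mono) auto
  finally show ?thesis by simp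
qed

text \<open>The additive extension of a weight \<open>g\<close> on simplices to integer chains. The
  free abelian group over the one-point type serves as a copy of the integers, so that
  \<open>frag_extend\<close> applies.\<close>

definition chain_sum :: "('b \<Rightarrow> int) \<Rightarrow> ('b \<Rightarrow>\<^sub>0 int) \<Rightarrow> int" where
  "chain_sum g c = Poly_Mapping.lookup (frag_extend (\<lambda>f. frag_cmul (g f) (frag_of ())) c) ()"

lemma chain_sum_0 [simp]: "chain_sum g 0 = 0"
  by (simp add: chain_sum_def)

lemma chain_sum_of [simp]: "chain_sum g (frag_of f) = g f"
  by (simp add: chain_sum_def)

lemma chain_sum_diff: "chain_sum g (a - b) = chain_sum g a - chain_sum g b"
  by (simp add: chain_sum_def frag_extend_diff lookup_minus)

lemma chain_sum_add: "chain_sum g (a + b) = chain_sum g a + chain_sum g b"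
  by (simp add: chain_sum_def frag_extend_add lookup_add)

lemma chain_sum_cmul: "chain_sum g (frag_cmul k c) = k * chain_sum g c"
  by (simp add: chain_sum_def frag_extend_cmul)

lemma chain_sum_sum: "chain_sum g (sum F I) = (\<Sum>i\<in>I. chain_sum g (F i))"
  by (induction I rule: infinite_finite_induct) (auto simp: chain_sum_add)

lemma chain_sum_eq_0:
  assumes "\<And>f. f \<in> Poly_Mapping.keys c \<Longrightarrow> g f = 0"
  shows "chain_sum g c = 0"
proof -
  have "Poly_Mapping.keys c \<subseteq> {f. g f = 0}" using assms by auto
  then show ?thesis
    by (induction rule: frag_induction) (auto simp: chain_sum_diff)
qed

section \<open>Counting alternating simplices in singular chains\<close>

definition basis_point :: "nat \<Rightarrow> nat \<Rightarrow> real" where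
  "basis_point i = (\<lambda>j. if j = i then 1 else 0)"

definition labels :: "('a \<Rightarrow> nat) \<Rightarrow> nat \<Rightarrow> ((nat \<Rightarrow> real) \<Rightarrow> 'a) \<Rightarrow> nat list" where
  "labels l p f = map (\<lambda>i. l (f (basis_point i))) [0..<Suc p]"

lemma length_labels [simp]: "length (labels l p f) = Suc p"
  by (simp add: labels_def)

lemma labels_singular_face:
  assumes "1 \<le> p" "k \<le> p"
  shows "labels l (p - Suc 0) (singular_face p k f) = remove_nth k (labels l p f)"
proof (rule nth_equalityI)
  have *: "length (remove_nth k (labels l p f)) = p"
    using assms by (simp add: remove_nth_def)
  then show "length (labels l (p - Suc 0) (singular_face p k f)) = length (remove_nth k (labels l p f))"
    using assms by simp
  fix i assume "i < length (labels l (p - Suc 0) (singular_face p k f))"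
  then have i: "i < p" using assms by simp
  have "basis_point i \<in> standard_simplex (p - Suc 0)"
    using i unfolding basis_point_def by simp
  moreover have "simplical_face k (basis_point i) = basis_point (if i < k then i else Suc i)"
    by (auto simp: simplical_face_def basis_point_def fun_eq_iff)
  ultimately have "singular_face p k f (basis_point i) = f (basis_point (if i < k then i else Suc i))"
    by (simp add: singular_face_def)
  moreover have "remove_nth k (labels l p f) ! i = labels l p f ! (if i < k then i else Suc i)"
    using assms i by (auto simp: remove_nth_def nth_append min_def)
  ultimately show "labels l (p - Suc 0) (singular_face p k f) ! i = remove_nth k (labels l p f) ! i"
    using assms i by (auto simp: labels_def nth_append simp del: upt_Suc)
qed

definition alt_count :: "('a \<Rightarrow> nat) \<Rightarrow> bool \<Rightarrow> nat \<Rightarrow> 'a chain \<Rightarrow> int" where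
  "alt_count l s p = chain_sum (\<lambda>f. of_bool (alternating s (sort (labels l p f))))"

text \<open>The parity count, summed over the simplices of the chain: the signs
  \<open>(- 1) ^ k\<close> of the boundary operator disappear modulo 2.\<close>

lemma alt_count_boundary:
  assumes "1 \<le> p"
  shows "even (alt_count l s (p - Suc 0) (chain_boundary p c) + alt_count l s p c
           + alt_count l (\<not> s) p c)"
proof -
  have "Poly_Mapping.keys c \<subseteq> UNIV" by simp
  then show ?thesis
  proof (induction rule: frag_induction)
    case (one f)
    let ?g = "\<lambda>i. of_bool (alternating s (sort (remove_nth i (labels l p f)))) :: int"
    have "alt_count l s (p - Suc 0) (chain_boundary p (frag_of f)) = (\<Sum>k\<le>p. (- 1) ^ k * ?g k)"
      using assms
      by (simp add: alt_count_def chain_boundary_of chain_sum_sum chain_sum_cmul labels_singular_face)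
    moreover have "even ((\<Sum>k\<le>p. (- 1) ^ k * ?g k) - (\<Sum>k\<le>p. ?g k))"
      unfolding sum_subtractf[symmetric] by (rule dvd_sum) auto
    moreover have "{..p} = {..<length (labels l p f)}" by auto
    ultimately show ?case
      using sum_alternating_sort_remove_nth[of s "labels l p f"]
      by (simp add: alt_count_def)
  next
    case (diff a b)
    then show ?case by (auto simp: alt_count_def chain_boundary_diff chain_sum_diff)
  qed (simp add: alt_count_def)
qed

text \<open>\<open>T\<close> changes the sign of every label, and for complement-free labels the
  sign change commutes with sorting. Hence an alternating list stays alternating and only its
  initial sign is exchanged.\<close>

lemma alt_count_chain_map:
  assumes "\<And>f. f \<in> Poly_Mapping.keys c \<Longrightarrow> complement_free (set (labels l p f))"
    and "\<And>f. f \<in> Poly_Mapping.keys c \<Longrightarrow> f \<in> standard_simplex p \<rightarrow> X"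
    and "\<And>x. x \<in> X \<Longrightarrow> l (T x) = flip (l x)"
  shows "alt_count l s p (chain_map p T c) = alt_count l (\<not> s) p c"
proof -
  have "Poly_Mapping.keys c \<subseteq> {f. complement_free (set (labels l p f)) \<and> f \<in> standard_simplex p \<rightarrow> X}"
    using assms by blast
  then show ?thesis
  proof (induction rule: frag_induction)
    case (one f)
    have "labels l p (simplex_map p T f) = map flip (labels l p f)"
      unfolding labels_def simplex_map_def
      using one assms(3) by (auto simp: basis_point_def Pi_iff)
    then show ?case
      using one by (simp add: alt_count_def sort_map_flip alternating_map_flip)
  next
    case (diff a b)
    then show ?case by (simp add: alt_count_def chain_map_diff chain_sum_diff)
  qed (simp add: alt_count_def)
qed

section \<open>The octahedral sphere as a singular chain\<close>

abbreviation antipode :: "(nat \<Rightarrow> real) \<Rightarrow> nat \<Rightarrow> real" where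
  "antipode x \<equiv> (\<lambda>i. - x i)"

text \<open>A model of R^(n+1) without the origin. It takes the place of the n-sphere because the
  flat simplices of the octahedron lie in it as they are, without radial projection.\<close>

definition punctured :: "nat \<Rightarrow> (nat \<Rightarrow> real) set" where
  "punctured n = {x. (\<forall>i>n. x i = 0) \<and> (\<exists>i. x i \<noteq> 0)}"

text \<open>\<open>hemisphere n\<close> is the upper hemisphere of the octahedral \<open>n\<close>-sphere, the cone over the whole
  \<open>(n - 1)\<close>-sphere, which in turn is the signed sum of the two lower dimensional hemispheres.\<close>

fun hemisphere :: "nat \<Rightarrow> (nat \<Rightarrow> real) chain" where
  "hemisphere 0 = frag_of (oriented_simplex 0 (\<lambda>_. basis_point 0))"
| "hemisphere (Suc n) = simplicial_cone n (basis_point (Suc n))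
     (hemisphere n - frag_cmul ((-1) ^ n) (chain_map n antipode (hemisphere n)))"

declare hemisphere.simps(2) [simp del]

lemma simplex_map_antipode_oriented:
  "simplex_map p antipode (oriented_simplex p l) = oriented_simplex p (\<lambda>i. antipode (l i))"
  by (auto simp: simplex_map_def oriented_simplex_def fun_eq_iff sum_negf)

lemma simplicial_chain_antipode:
  assumes "simplicial_chain p (punctured n) c"
  shows "simplicial_chain p (punctured n) (chain_map p antipode c)"
  using assms unfolding simplicial_chain_def
proof (induction rule: frag_induction)
  case (one f)
  then obtain l where f: "f = oriented_simplex p l" "f ` standard_simplex p \<subseteq> punctured n"
    by (auto simp: simplicial_simplex)
  have "simplex_map p antipode f ` standard_simplex p \<subseteq> punctured n"
    using f(2) by (fastforce simp: simplex_map_def punctured_def image_subset_iff)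
  then show ?case
    using f simplex_map_antipode_oriented by (auto simp: simplicial_simplex)
next
  case (diff a b)
  then show ?case
    using simplicial_chain_diff unfolding simplicial_chain_def chain_map_diff by blast
qed simp

lemma simplicial_chain_hemisphere: "simplicial_chain n (punctured n) (hemisphere n)"
proof (induction n)
  case 0
  have "(\<lambda>x i. \<Sum>j\<le>0. basis_point 0 i * x j) ` standard_simplex 0 \<subseteq> punctured 0"
    by (auto simp: standard_simplex_0 punctured_def basis_point_def)
  then show ?case by (simp add: simplicial_simplex_oriented_simplex)
next
  case (Suc n)
  show ?case
    unfolding hemisphere.simps(2)
  proof (rule simplicial_chain_simplicial_cone)
    show "simplicial_chain n (punctured n)
       (hemisphere n - frag_cmul ((-1) ^ n) (chain_map n antipode (hemisphere n)))"
      by (intro simplicial_chain_diff simplicial_chain_cmul simplicial_chain_antipode Suc)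
    fix x and u :: real assume "0 \<le> u" "u \<le> 1" and x: "x \<in> punctured n"
    then obtain j where j: "j \<le> n" "x j \<noteq> 0"
      by (auto simp: punctured_def) (meson not_le)
    \<comment> \<open>The new coordinate of the segment is \<open>1 - u\<close>, which is nonzero
      unless \<open>u = 1\<close>; at \<open>u = 1\<close> the point is \<open>x\<close>
      itself.\<close>
    have "(1 - u) * basis_point (Suc n) (Suc n) + u * x (Suc n) \<noteq> 0 \<or>
        (1 - u) * basis_point (Suc n) j + u * x j \<noteq> 0"
      using x j by (auto simp: punctured_def basis_point_def)
    moreover have "(1 - u) * basis_point (Suc n) i + u * x i = 0" if "i > Suc n" for i
      using x that by (auto simp: punctured_def basis_point_def)
    ultimately show "(\<lambda>i. (1 - u) * basis_point (Suc n) i + u * x i) \<in> punctured (Suc n)"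
      unfolding punctured_def by blast
  qed
qed

text \<open>Simplex maps are restricted to the standard simplex, so the involution holds on chains
  of genuine simplices and not for arbitrary functions.\<close>

lemma antipode_antipode:
  assumes "simplicial_chain p S c"
  shows "chain_map p antipode (chain_map p antipode c) = c"
  using assms unfolding simplicial_chain_def
proof (induction rule: frag_induction)
  case (one f)
  then obtain l where "f = oriented_simplex p l" by (auto simp: simplicial_simplex)
  then show ?case by (simp add: simplex_map_antipode_oriented)
qed (auto simp: chain_map_diff)

text \<open>The boundary of a cone is its base minus the cone over the boundary of the base. The
  base is a whole sphere, whose two halves have cancelling boundaries by the induction hypothesis;
  the sign \<open>(-1) ^ n\<close> is chosen for this cancellation.\<close>

lemma chain_boundary_hemisphere:
  "chain_boundary (Suc n) (hemisphere (Suc n)) =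
     hemisphere n - frag_cmul ((-1) ^ n) (chain_map n antipode (hemisphere n))"
proof (induction n)
  case 0
  \<comment> \<open>In degree 0 the cone formula subtracts the apex multiplied by the sum of the
    coefficients of the base, and this sum is 1 - 1 = 0.\<close>
  have "simplicial_chain 0 (punctured 0) (hemisphere 0 - chain_map 0 antipode (hemisphere 0))"
    by (intro simplicial_chain_diff simplicial_chain_antipode simplicial_chain_hemisphere)
  then show ?case
    by (simp add: hemisphere.simps(2) chain_boundary_simplicial_cone frag_extend_diff)
next
  case (Suc n)
  let ?c = "hemisphere (Suc n)"
  let ?d = "?c - frag_cmul ((-1) ^ Suc n) (chain_map (Suc n) antipode ?c)"
  have sc: "simplicial_chain (Suc n) (punctured (Suc n)) ?d"
    by (intro simplicial_chain_diff simplicial_chain_cmul simplicial_chain_antipode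
        simplicial_chain_hemisphere)
  have "singular_chain (Suc n) (subtopology (powertop_real UNIV) (punctured (Suc n))) ?c"
    by (intro simplicial_imp_singular_chain simplicial_chain_hemisphere)
  then have "chain_boundary (Suc n) (chain_map (Suc n) antipode ?c) =
      chain_map n antipode (chain_boundary (Suc n) ?c)"
    using chain_boundary_chain_map by fastforce
  also have "\<dots> = chain_map n antipode (hemisphere n) - frag_cmul ((-1) ^ n) (hemisphere n)"
    unfolding Suc chain_map_diff chain_map_cmul
    by (simp add: antipode_antipode[OF simplicial_chain_hemisphere])
  finally have "chain_boundary (Suc n) ?d = 0"
    unfolding chain_boundary_diff chain_boundary_cmul Suc
    by (cases "even n") simp_all
  then have "simplicial_cone n (basis_point (Suc (Suc n))) (chain_boundary (Suc n) ?d) = 0"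
    by (metis simplicial_cone_def frag_extend_0)
  then show ?case
    using chain_boundary_simplicial_cone[OF sc, of "basis_point (Suc (Suc n))"]
    unfolding hemisphere.simps(2)[of "Suc n"] by simp
qed

section \<open>Iterated barycentric subdivision and Ky Fan's argument\<close>

lemma singular_chain_iterated_subdivision:
  "singular_chain p X c \<Longrightarrow> singular_chain p X ((singular_subdivision p ^^ N) c)"
  by (induction N) (auto intro: singular_chain_singular_subdivision)

lemma chain_boundary_iterated_subdivision:
  assumes "singular_chain p X c"
  shows "chain_boundary p ((singular_subdivision p ^^ N) c) =
    (singular_subdivision (p - Suc 0) ^^ N) (chain_boundary p c)"
proof (induction N)
  case (Suc N)
  then show ?case
    using chain_boundary_singular_subdivision[OF singular_chain_iterated_subdivision[OF assms]] by simp
qed simp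

lemma naturality_iterated_subdivision:
  assumes "singular_chain p X c" 
  shows "(singular_subdivision p ^^ N) (chain_map p g c) = chain_map p g ((singular_subdivision p ^^ N) c)"
proof (induction N)
  case (Suc N)
  then show ?case
    using naturality_singular_subdivision[OF singular_chain_iterated_subdivision[OF assms]] by simp
qed simp

lemma iterated_subdivision_cmul_uminus_one_power:
  "(singular_subdivision p ^^ N) (frag_cmul ((-1) ^ k) c) = frag_cmul ((-1) ^ k) ((singular_subdivision p ^^ N) c)"
proof (cases "even k")
  case False
  have "(singular_subdivision p ^^ N) (- c) = - (singular_subdivision p ^^ N) c"
    using singular_subdivision_power_diff[of N p 0 c] by simp
  with False show ?thesis by simp
qed simp

lemma punctured_mono: "p \<le> n \<Longrightarrow> punctured p \<subseteq> punctured n"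
  by (auto simp: punctured_def)

lemma antipode_punctured: "x \<in> punctured n \<Longrightarrow> antipode x \<in> punctured n"
  by (auto simp: punctured_def)

text \<open>Ky Fan's counting argument: modulo 2, the number of alternating simplices in a sufficiently
  fine subdivision of the upper hemisphere is the same in every dimension, hence odd.\<close>

lemma exists_alternating_simplex:
  assumes cov: "\<And>V. V \<in> \<C> \<Longrightarrow> openin (subtopology (powertop_real UNIV) (punctured n)) V"
      "punctured n \<subseteq> \<Union>\<C>"
    and small: "\<And>V. V \<in> \<C> \<Longrightarrow> complement_free (l ` V)"
    and flip: "\<And>x. x \<in> punctured n \<Longrightarrow> l (antipode x) = flip (l x)"
  obtains s f where "f \<in> standard_simplex n \<rightarrow> punctured n" "complement_free (set (labels l n f))"
    "alternating s (sort (labels l n f))"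
proof -
  let ?X = "subtopology (powertop_real UNIV) (punctured n)"
  have ch: "singular_chain p ?X (hemisphere p)" if "p \<le> n" for p
    using singular_chain_mono[OF simplicial_imp_singular_chain[OF simplicial_chain_hemisphere]
        punctured_mono[OF that]] .
  have "\<exists>N. \<forall>m f. N \<le> m \<longrightarrow> f \<in> Poly_Mapping.keys ((singular_subdivision p ^^ m) (hemisphere p)) \<longrightarrow>
      (\<exists>V\<in>\<C>. f \<in> standard_simplex p \<rightarrow> V)" if "p \<le> n" for p
  proof -
    have "topspace ?X \<subseteq> \<Union>\<C>" using cov(2) by simp
    show ?thesis
    proof (rule sufficient_iterated_singular_subdivision_exists[OF cov(1) \<open>topspace ?X \<subseteq> \<Union>\<C>\<close> ch[OF that]])
      fix N
      assume N: "\<And>m f. \<lbrakk>N \<le> m; f \<in> Poly_Mapping.keys ((singular_subdivision p ^^ m) (hemisphere p))\<rbrakk>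
        \<Longrightarrow> \<exists>V\<in>\<C>. f \<in> standard_simplex p \<rightarrow> V"
      show ?thesis by (intro exI[of _ N] allI impI) (rule N)
    qed
  qed
  then obtain N where N: "\<And>p m f. p \<le> n \<Longrightarrow> N p \<le> m \<Longrightarrow>
      f \<in> Poly_Mapping.keys ((singular_subdivision p ^^ m) (hemisphere p)) \<Longrightarrow>
      \<exists>V\<in>\<C>. f \<in> standard_simplex p \<rightarrow> V"
    by metis
  \<comment> \<open>One depth of subdivision for all dimensions, because the boundary of
    \<open>d (Suc p)\<close> must again consist of copies of \<open>d p\<close>.\<close>
  define K where "K = Max (N ` {..n})"
  define d where "d p = (singular_subdivision p ^^ K) (hemisphere p)" for p
  have sm: "\<exists>V\<in>\<C>. f \<in> standard_simplex p \<rightarrow> V" if "p \<le> n" "f \<in> Poly_Mapping.keys (d p)" for p f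
    using N[of p K f] that by (simp add: K_def d_def)
  have V_sub: "V \<subseteq> punctured n" if "V \<in> \<C>" for V
    using openin_subset[OF cov(1)[OF that]] by simp
  have pts: "f \<in> standard_simplex p \<rightarrow> punctured n" if "p \<le> n" "f \<in> Poly_Mapping.keys (d p)" for p f
    using sm[OF that] V_sub by blast
  have free: "complement_free (set (labels l p f))" if "p \<le> n" "f \<in> Poly_Mapping.keys (d p)" for p f
  proof -
    obtain V where V: "V \<in> \<C>" "f \<in> standard_simplex p \<rightarrow> V" using sm[OF \<open>p \<le> n\<close> \<open>f \<in> _\<close>] by auto
    have "basis_point i \<in> standard_simplex p" if "i < Suc p" for i
      using that unfolding basis_point_def by simp
    then have "set (labels l p f) \<subseteq> l ` V"
      using V(2) by (auto simp: labels_def simp del: upt_Suc)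
    then show ?thesis
      using small[OF V(1)] unfolding complement_free_def by blast
  qed
  have bd: "chain_boundary (Suc p) (d (Suc p)) = d p - frag_cmul ((-1) ^ p) (chain_map p antipode (d p))"
    if "Suc p \<le> n" for p
    using chain_boundary_iterated_subdivision[OF ch[OF that], of K] ch[of p] that
    by (simp add: d_def chain_boundary_hemisphere singular_subdivision_power_diff
        iterated_subdivision_cmul_uminus_one_power naturality_iterated_subdivision)
  have "odd (alt_count l True p (d p) + alt_count l False p (d p))" if "p \<le> n" for p
    using that
  proof (induction p)
    case 0
    \<comment> \<open>Points are not subdivided, so \<open>d 0\<close> is a single vertex; a list
      with one entry alternates for exactly one initial sign.\<close>
    have "(singular_subdivision 0 ^^ K) c = c" if "singular_chain 0 ?X c" for c
    proof (induction K)
      case (Suc K)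
      then show ?case using singular_subdivision_zero[OF that] by simp
    qed simp
    then have "d 0 = hemisphere 0" using ch[of 0] by (simp add: d_def)
    then show ?case by (auto simp: alt_count_def labels_def)
  next
    case (Suc p)
    \<comment> \<open>The antipodal half of the boundary contributes the lists of \<open>d p\<close>
      with the opposite initial sign. The count on the boundary is thus odd by the induction
      hypothesis, and modulo 2 it is the number of alternating simplices of
      \<open>d (Suc p)\<close>.\<close>
    have "alt_count l True p (chain_boundary (Suc p) (d (Suc p))) =
        alt_count l True p (d p) - (-1) ^ p * alt_count l False p (d p)"
      using alt_count_chain_map[of "d p" l p "punctured n" antipode True] free pts flip Suc.prems
      by (simp add: bd alt_count_def chain_sum_diff chain_sum_cmul)
    then show ?case
      using Suc alt_count_boundary[of "Suc p" l True "d (Suc p)"] by (cases "even p") auto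
  qed
  then have "alt_count l True n (d n) \<noteq> 0 \<or> alt_count l False n (d n) \<noteq> 0"
    by fastforce
  then have "\<exists>s. alt_count l s n (d n) \<noteq> 0" by (elim disjE; intro exI)
  then obtain s where "alt_count l s n (d n) \<noteq> 0" ..
  then have "\<exists>f\<in>Poly_Mapping.keys (d n). alternating s (sort (labels l n f))"
    unfolding alt_count_def by (rule contrapos_np) (auto intro: chain_sum_eq_0)
  then obtain f where "f \<in> Poly_Mapping.keys (d n)" "alternating s (sort (labels l n f))" ..
  then show ?thesis using that[of f s] free[of n f] pts[of n f] by simp
qed

text \<open>Each point is labelled by the index of a component of \<open>F\<close> of largest
  modulus, together with its sign. Ky Fan's argument produces an alternating
  \<open>n\<close>-simplex, whose \<open>n + 1\<close> labels have distinct indices below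
  \<open>m\<close>.\<close>

theorem borsuk_ulam:
  fixes F :: "(nat \<Rightarrow> real) \<Rightarrow> nat \<Rightarrow> real"
  assumes cont: "\<And>j. j < m \<Longrightarrow>
      continuous_map (subtopology (powertop_real UNIV) (punctured n)) euclideanreal (\<lambda>x. F x j)"
    and nz: "\<And>x. x \<in> punctured n \<Longrightarrow> \<exists>j<m. F x j \<noteq> 0"
    and odd: "\<And>x j. x \<in> punctured n \<Longrightarrow> j < m \<Longrightarrow> F (antipode x) j = - F x j"
  shows "n < m"
proof -
  let ?X = "subtopology (powertop_real UNIV) (punctured n)"
  define mx where "mx x = Max ((\<lambda>j. \<bar>F x j\<bar>) ` {..<m})" for x
  \<comment> \<open>Ties are broken by the least index. The rule only sees moduli, so antipodal
    points get the same index and opposite signs.\<close>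
  define idx where "idx x = (LEAST j. j < m \<and> \<bar>F x j\<bar> = mx x)" for x
  define lab where "lab x = 2 * idx x + (if F x (idx x) > 0 then 0 else 1)" for x
  have mx_ge: "\<bar>F x j\<bar> \<le> mx x" if "j < m" for x j
    unfolding mx_def using that by (intro Max_ge) auto
  have mx_pos: "mx x > 0" if "x \<in> punctured n" for x
    using nz[OF that] mx_ge[of _ x] by (meson less_le_trans zero_less_abs_iff)
  have idx: "idx x < m \<and> \<bar>F x (idx x)\<bar> = mx x" if "x \<in> punctured n" for x
  proof -
    obtain j where "j < m" using nz[OF \<open>x \<in> _\<close>] by auto
    then have "mx x \<in> (\<lambda>j. \<bar>F x j\<bar>) ` {..<m}" unfolding mx_def by (intro Max_in) auto
    then have "\<exists>j. j < m \<and> \<bar>F x j\<bar> = mx x" by auto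
    then show ?thesis unfolding idx_def by (rule LeastI_ex)
  qed
  have lab_lt: "lab x < 2 * m" if "x \<in> punctured n" for x
    using idx[OF that] by (auto simp: lab_def)
  have flip: "lab (antipode x) = flip (lab x)" if x: "x \<in> punctured n" for x
  proof -
    have "mx (antipode x) = mx x"
      unfolding mx_def using odd[OF x] by (intro arg_cong[where f = Max] image_cong) auto
    then have "idx (antipode x) = idx x"
      unfolding idx_def using odd[OF x] by (intro arg_cong[where f = Least] ext) auto
    then show ?thesis
      using idx[OF x] mx_pos[OF x] odd[OF x, of "idx x"] by (auto simp: lab_def flip_def)
  qed
  \<comment> \<open>On \<open>V y\<close> every component stays within \<open>mx y / 3\<close> of
    its value at \<open>y\<close>, while the largest modulus exceeds \<open>2 * mx y / 3\<close>. A
    component selected with opposite signs at two points of \<open>V y\<close> would vary by more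
    than \<open>4 * mx y / 3\<close> there.\<close>
  define V where "V y = {x \<in> topspace ?X. \<forall>j\<in>{..<m}. F x j \<in> ball (F y j) (mx y / 3)}" for y
  have op: "openin ?X (V y)" if "y \<in> punctured n" for y
  proof (cases "m = 0")
    case True
    then show ?thesis using nz[OF that] by simp
  next
    case False
    have "V y = (\<Inter>j\<in>{..<m}. {x \<in> topspace ?X. F x j \<in> ball (F y j) (mx y / 3)})"
      using False by (auto simp: V_def)
    moreover have "openin ?X {x \<in> topspace ?X. F x j \<in> ball (F y j) (mx y / 3)}" if "j < m" for j
      using openin_continuous_map_preimage[OF cont[OF that], of "ball (F y j) (mx y / 3)"] by simp
    ultimately show ?thesis using False by (auto intro!: openin_INT2)
  qed
  have cv: "punctured n \<subseteq> \<Union>(V ` punctured n)"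
    using mx_pos by (auto simp: V_def)
  have cf: "complement_free (lab ` V y)" if y: "y \<in> punctured n" for y
    unfolding complement_free_def
  proof (intro ballI notI)
    fix a assume "a \<in> lab ` V y" "flip a \<in> lab ` V y"
    then obtain x z where x: "x \<in> V y" "a = lab x" and z: "z \<in> V y" "flip a = lab z" by auto
    then have xp: "x \<in> punctured n" and zp: "z \<in> punctured n" by (auto simp: V_def)
    have "idx z = flip a div 2" using z by (simp add: lab_def)
    also have "\<dots> = idx x" using x by (simp add: lab_def)
    finally have i: "idx z = idx x" .
    let ?i = "idx x"
    have close: "\<bar>F w j - F y j\<bar> < mx y / 3" if "w \<in> V y" "j < m" for w j
      using that by (auto simp: V_def dist_real_def abs_minus_commute)
    have big: "mx w > 2 * mx y / 3" if "w \<in> V y" for w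
      using close[OF that, of "idx y"] idx[OF y] mx_ge[of "idx y" w] by linarith
    have "even (lab x) \<noteq> even (lab z)" using x z even_flip by metis
    then have "(F x ?i > 0) \<noteq> (F z ?i > 0)"
      using i by (auto simp: lab_def split: if_splits)
    moreover have "\<bar>F x ?i - F y ?i\<bar> < mx y / 3" "\<bar>F z ?i - F y ?i\<bar> < mx y / 3"
      using close x(1) z(1) idx[OF xp] by blast+
    moreover have "\<bar>F x ?i\<bar> > 2 * mx y / 3" "\<bar>F z ?i\<bar> > 2 * mx y / 3"
      using big[OF x(1)] big[OF z(1)] idx[OF xp] idx[OF zp] i by simp_all
    ultimately show False by argo
  qed
  have "\<And>W. W \<in> V ` punctured n \<Longrightarrow> openin ?X W" "\<And>W. W \<in> V ` punctured n \<Longrightarrow> complement_free (lab ` W)"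
    using op cf by auto
  from exists_alternating_simplex[OF this(1) cv this(2) flip]
  obtain s f where f: "f \<in> standard_simplex n \<rightarrow> punctured n"
      "complement_free (set (labels lab n f))" "alternating s (sort (labels lab n f))" .
  have "lab (f (basis_point i)) < 2 * m" if "i < Suc n" for i
  proof -
    have "basis_point i \<in> standard_simplex n"
      using that unfolding basis_point_def by simp
    then show ?thesis using f(1) by (intro lab_lt) blast
  qed
  then have "set (labels lab n f) \<subseteq> {..<2 * m}"
    unfolding labels_def set_map set_upt by auto
  then have "length (sort (labels lab n f)) \<le> m"
    using f(2) by (intro alternating_length[OF f(3)]) (simp_all only: set_sort sorted_sort)
  then show ?thesis by simp
qed

section \<open>Square-integrable functions\<close>

text \<open>An arbitrary measure and Euclidean target let functions, gradients and pairs of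
  functions, over \<open>lebesgue\<close> and over \<open>lborel\<close>, share one calculus. The
  objects are functions rather than classes, so \<open>l2\<close> is only a seminorm.\<close>

definition l2s :: "'a measure \<Rightarrow> ('a \<Rightarrow> 'b::euclidean_space) \<Rightarrow> bool" where
  "l2s N f \<longleftrightarrow> f \<in> borel_measurable N \<and> integrable N (\<lambda>x. (norm (f x))\<^sup>2)"

definition l2 :: "'a measure \<Rightarrow> ('a \<Rightarrow> 'b::euclidean_space) \<Rightarrow> real" where
  "l2 N f = sqrt (\<integral>x. (norm (f x))\<^sup>2 \<partial>N)"

lemma l2s_measurable [measurable_dest]: "l2s N f \<Longrightarrow> f \<in> borel_measurable N"
  by (simp add: l2s_def)

lemma l2_nonneg [simp]: "0 \<le> l2 N f"
  by (simp add: l2_def)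

lemma l2_square: "(l2 N f)\<^sup>2 = (\<integral>x. (norm (f x))\<^sup>2 \<partial>N)"
  by (simp add: l2_def)

lemma nn_integral_l2: "l2s N f \<Longrightarrow> (\<integral>\<^sup>+x. ennreal ((norm (f x))\<^sup>2) \<partial>N) = ennreal ((l2 N f)\<^sup>2)"
  by (simp add: l2s_def l2_square nn_integral_eq_integral)

lemma l2sI_nn_integral:
  assumes "f \<in> borel_measurable N" "(\<integral>\<^sup>+x. ennreal ((norm (f x))\<^sup>2) \<partial>N) < \<infinity>"
  shows "l2s N f"
  using assms by (simp add: l2s_def integrable_iff_bounded)

lemma l2sI_nn_integral_le:
  assumes "f \<in> borel_measurable N" "(\<integral>\<^sup>+x. ennreal ((norm (f x))\<^sup>2) \<partial>N) \<le> ennreal (c\<^sup>2)" "0 \<le> c"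
  shows "l2s N f" "l2 N f \<le> c"
proof -
  show *: "l2s N f" using assms by (intro l2sI_nn_integral) (auto intro: le_less_trans)
  then have "(l2 N f)\<^sup>2 \<le> c\<^sup>2" using assms(2) nn_integral_l2[OF *] by simp
  then show "l2 N f \<le> c" using assms(3) by (rule power2_le_imp_le)
qed

lemma norm_add_square_le: "(norm (a + b))\<^sup>2 \<le> 2 * (norm a)\<^sup>2 + 2 * (norm (b::'b::real_inner))\<^sup>2"
  using zero_le_power2[of "norm (a - b)"]
  unfolding power2_norm_eq_inner by (simp add: inner_add inner_diff inner_commute)

lemma l2s_add: 
  assumes "l2s N f" "l2s N g" shows "l2s N (\<lambda>x. f x + g x)"
  unfolding l2s_def
proof
  show "integrable N (\<lambda>x. (norm (f x + g x))\<^sup>2)"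
  proof (rule Bochner_Integration.integrable_bound)
    show "integrable N (\<lambda>x. 2 * (norm (f x))\<^sup>2 + 2 * (norm (g x))\<^sup>2)"
      using assms by (auto simp: l2s_def)
    show "AE x in N. norm ((norm (f x + g x))\<^sup>2) \<le> norm (2 * (norm (f x))\<^sup>2 + 2 * (norm (g x))\<^sup>2)"
      using norm_add_square_le by auto
  qed (use assms in measurable)
qed (use assms in measurable)

lemma l2s_scaleR: "l2s N f \<Longrightarrow> l2s N (\<lambda>x. c *\<^sub>R f x)"
  by (auto simp: l2s_def power_mult_distrib)

lemma l2_scaleR: "l2 N (\<lambda>x. c *\<^sub>R f x) = \<bar>c\<bar> * l2 N f"
  by (simp add: l2_def power_mult_distrib real_sqrt_mult)

lemma l2s_diff: 
  assumes "l2s N f" "l2s N g" shows "l2s N (\<lambda>x. f x - g x)"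
  using l2s_add[OF assms(1) l2s_scaleR[OF assms(2), of "-1"]] by simp

lemma l2_commute: "l2 N (\<lambda>x. f x - g x) = l2 N (\<lambda>x. g x - f x)"
  by (simp add: l2_def norm_minus_commute)

lemma l2s_inner: 
  assumes "l2s N f" "l2s N g" shows "integrable N (\<lambda>x. f x \<bullet> g x)"
proof (rule Bochner_Integration.integrable_bound)
  show "integrable N (\<lambda>x. (norm (f x))\<^sup>2 + (norm (g x))\<^sup>2)"
    using assms by (auto simp: l2s_def)
  have "norm (a \<bullet> b) \<le> norm ((norm a)\<^sup>2 + (norm b)\<^sup>2)" for a b :: 'b
  proof -
    have "\<bar>a \<bullet> b\<bar> \<le> norm a * norm b" by (rule Cauchy_Schwarz_ineq2)
    also have "\<dots> \<le> (norm a)\<^sup>2 + (norm b)\<^sup>2"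
      using sum_squares_bound[of "norm a" "norm b"] mult_nonneg_nonneg[OF norm_ge_zero[of a] norm_ge_zero[of b]]
      by linarith
    finally show ?thesis by simp
  qed
  then show "AE x in N. norm (f x \<bullet> g x) \<le> norm ((norm (f x))\<^sup>2 + (norm (g x))\<^sup>2)" by auto
qed (use assms in measurable)

lemma l2_add_square:
  assumes "l2s N f" "l2s N g"
  shows "(l2 N (\<lambda>x. f x + g x))\<^sup>2 = (l2 N f)\<^sup>2 + 2 * (\<integral>x. f x \<bullet> g x \<partial>N) + (l2 N g)\<^sup>2"
proof -
  have "(\<integral>x. (norm (f x + g x))\<^sup>2 \<partial>N) = (\<integral>x. (norm (f x))\<^sup>2 + 2 * (f x \<bullet> g x) + (norm (g x))\<^sup>2 \<partial>N)"
    by (rule Bochner_Integration.integral_cong)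
      (auto simp: power2_norm_eq_inner inner_add inner_commute)
  then show ?thesis
    using assms l2s_inner[OF assms] by (simp add: l2_square l2s_def)
qed

lemma l2_parallelogram:
  assumes "l2s N f" "l2s N g"
  shows "(l2 N (\<lambda>x. f x + g x))\<^sup>2 + (l2 N (\<lambda>x. f x - g x))\<^sup>2 = 2 * (l2 N f)\<^sup>2 + 2 * (l2 N g)\<^sup>2"
  using l2_add_square[OF assms] l2_add_square[OF assms(1) l2s_scaleR[OF assms(2), of "-1"]]
    l2_scaleR[of N "-1" g] by simp

lemma l2_Cauchy_Schwarz:
  assumes "l2s N f" "l2s N g"
  shows "\<bar>\<integral>x. f x \<bullet> g x \<partial>N\<bar> \<le> l2 N f * l2 N g"
proof -
  let ?a = "(l2 N f)\<^sup>2" and ?b = "\<integral>x. f x \<bullet> g x \<partial>N" and ?c = "(l2 N g)\<^sup>2"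
  have *: "0 \<le> ?a + 2 * t * ?b + t\<^sup>2 * ?c" for t
  proof -
    have "0 \<le> (l2 N (\<lambda>x. f x + t *\<^sub>R g x))\<^sup>2" by simp
    also have "\<dots> = ?a + 2 * t * ?b + t\<^sup>2 * ?c"
      using l2_add_square[OF assms(1) l2s_scaleR[OF assms(2), of t]] 
      by (simp add: l2_scaleR power_mult_distrib)
    finally show ?thesis .
  qed
  have "?b\<^sup>2 \<le> ?a * ?c"
  proof (cases "?c = 0")
    case True
    have "?b = 0"
    proof (rule ccontr)
      assume b: "?b \<noteq> 0"
      \<comment> \<open>For \<open>?c = 0\<close> the quadratic form is affine in \<open>t\<close>;
        this \<open>t\<close> is the point at which it would take the value -1.\<close>
      have "0 \<le> ?a + 2 * (- (?a + 1) / (2 * ?b)) * ?b" using *[of "- (?a + 1) / (2 * ?b)"] True by simp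
      also have "\<dots> = -1" using b by (simp add: field_simps)
      finally show False by simp
    qed
    then show ?thesis by simp
  next
    case False
    then have "?c > 0" using zero_le_power2[of "l2 N g"] by linarith
    have "0 \<le> ?a + 2 * (- ?b / ?c) * ?b + (- ?b / ?c)\<^sup>2 * ?c" by (rule *)
    also have "\<dots> = ?a - ?b\<^sup>2 / ?c" using \<open>?c > 0\<close> by (simp add: field_simps power2_eq_square)
    finally show ?thesis using \<open>?c > 0\<close> by (simp add: field_simps)
  qed
  then have "\<bar>?b\<bar>\<^sup>2 \<le> (l2 N f * l2 N g)\<^sup>2" by (simp add: power_mult_distrib)
  then show ?thesis by (rule power2_le_imp_le) simp
qed

lemma l2_triangle:
  assumes "l2s N f" "l2s N g"
  shows "l2 N (\<lambda>x. f x + g x) \<le> l2 N f + l2 N g"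
proof (rule power2_le_imp_le)
  show "(l2 N (\<lambda>x. f x + g x))\<^sup>2 \<le> (l2 N f + l2 N g)\<^sup>2"
    using l2_Cauchy_Schwarz[OF assms] by (simp add: l2_add_square[OF assms] power2_sum)
qed simp

lemma l2_diff_triangle:
  assumes "l2s N f" "l2s N g" "l2s N h"
  shows "l2 N (\<lambda>x. f x - h x) \<le> l2 N (\<lambda>x. f x - g x) + l2 N (\<lambda>x. g x - h x)"
  using l2_triangle[OF l2s_diff[OF assms(1,2)] l2s_diff[OF assms(2,3)]] by simp

lemma l2_norm_triangle:
  assumes "l2s N f" "l2s N g"
  shows "l2 N f \<le> l2 N (\<lambda>x. f x - g x) + l2 N g"
  using l2_triangle[OF l2s_diff[OF assms] assms(2)] by simp

lemma l2_cong_AE: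
  assumes "f \<in> borel_measurable N" "g \<in> borel_measurable N" "AE x in N. f x = g x"
  shows "l2 N f = l2 N g"
proof -
  note [measurable] = assms(1,2)
  have "AE x in N. (norm (f x))\<^sup>2 = (norm (g x))\<^sup>2"
    using assms(3) by eventually_elim simp
  moreover have "(\<lambda>x. (norm (f x))\<^sup>2) \<in> borel_measurable N" "(\<lambda>x. (norm (g x))\<^sup>2) \<in> borel_measurable N"
    by measurable
  ultimately show ?thesis
    by (simp only: l2_def integral_cong_AE)
qed

lemma l2_eq_0_iff:
  assumes "l2s N f"
  shows "l2 N f = 0 \<longleftrightarrow> (AE x in N. f x = 0)"
proof -
  have "l2 N f = 0 \<longleftrightarrow> (\<integral>x. (norm (f x))\<^sup>2 \<partial>N) = 0" by (simp add: l2_def)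
  also have "\<dots> \<longleftrightarrow> (AE x in N. (norm (f x))\<^sup>2 = 0)"
    using assms by (intro integral_nonneg_eq_0_iff_AE) (auto simp: l2s_def)
  finally show ?thesis by simp
qed

lemma l2_fatou:
  assumes "\<And>n. l2s N (f n)" "\<And>n. l2 N (f n) \<le> c" "g \<in> borel_measurable N"
    "AE x in N. (\<lambda>n. f n x) \<longlonglongrightarrow> g x"
  shows "l2s N g" "l2 N g \<le> c"
proof -
  note [measurable] = assms(3) l2s_measurable[OF assms(1)]
  have c: "0 \<le> c" using assms(2)[of 0] l2_nonneg[of N "f 0"] by linarith
  have "(\<integral>\<^sup>+x. ennreal ((norm (g x))\<^sup>2) \<partial>N) = (\<integral>\<^sup>+x. liminf (\<lambda>n. ennreal ((norm (f n x))\<^sup>2)) \<partial>N)"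
  proof (rule nn_integral_cong_AE)
    show "AE x in N. ennreal ((norm (g x))\<^sup>2) = liminf (\<lambda>n. ennreal ((norm (f n x))\<^sup>2))"
      using assms(4)
    proof eventually_elim
      case (elim x)
      then have "(\<lambda>n. ennreal ((norm (f n x))\<^sup>2)) \<longlonglongrightarrow> ennreal ((norm (g x))\<^sup>2)"
        by (intro tendsto_ennrealI tendsto_intros)
      then show ?case by (rule lim_imp_Liminf[OF trivial_limit_sequentially, symmetric])
    qed
  qed
  also have "\<dots> \<le> liminf (\<lambda>n. \<integral>\<^sup>+x. ennreal ((norm (f n x))\<^sup>2) \<partial>N)"
    by (rule nn_integral_liminf) measurable
  also have "\<dots> \<le> liminf (\<lambda>n. ennreal (c\<^sup>2))"
    using assms(2) by (intro Liminf_mono always_eventually allI)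
      (auto simp: nn_integral_l2[OF assms(1)] intro!: power_mono)
  also have "\<dots> = ennreal (c\<^sup>2)" by (simp add: Liminf_const)
  finally show "l2s N g" "l2 N g \<le> c" using l2sI_nn_integral_le[OF assms(3) _ c] by auto
qed

lemma l2_AE_subseq:
  fixes f :: "nat \<Rightarrow> 'a \<Rightarrow> 'b::euclidean_space"
  assumes "\<And>n. l2s N (f n)" "l2s N g" "(\<lambda>n. l2 N (\<lambda>x. f n x - g x)) \<longlonglongrightarrow> 0"
  obtains r where "strict_mono (r :: nat \<Rightarrow> nat)" "AE x in N. (\<lambda>n. f (r n) x) \<longlonglongrightarrow> g x"
proof -
  have "(\<lambda>n. (l2 N (\<lambda>x. f n x - g x))\<^sup>2) \<longlonglongrightarrow> 0"
    using tendsto_power[OF assms(3), of 2] by simp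
  then have "(\<lambda>n. \<integral>x. norm ((norm (f n x - g x))\<^sup>2 - 0) \<partial>N) \<longlonglongrightarrow> 0"
    by (simp add: l2_square)
  then obtain r where r: "strict_mono (r :: nat \<Rightarrow> nat)" 
     "AE x in N. (\<lambda>n. (norm (f (r n) x - g x))\<^sup>2) \<longlonglongrightarrow> 0"
    using tendsto_L1_AE_subseq[of N "\<lambda>n x. (norm (f n x - g x))\<^sup>2"] l2s_diff[OF assms(1,2)]
    by (auto simp: l2s_def)
  have "AE x in N. (\<lambda>n. f (r n) x) \<longlonglongrightarrow> g x"
    using r(2)
  proof eventually_elim
    case (elim x)
    then have "(\<lambda>n. norm (f (r n) x - g x)) \<longlonglongrightarrow> 0"
      using tendsto_real_sqrt[OF elim] by simp
    then show ?case using LIM_zero_iff tendsto_norm_zero_iff by blast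
  qed
  then show ?thesis using r(1) that by blast
qed

text \<open>The Riesz--Fischer argument. Along \<open>r\<close> the increments have norm at most
  \<open>(1/4)^k\<close>, so the series of \<open>4^k * (norm (d k x))\<^sup>2\<close> has finite
  integral. Almost everywhere its terms tend to 0, which makes the increments eventually at most
  \<open>(1/2)^k\<close> and the subsequence convergent.\<close>

lemma l2_complete:
  fixes f :: "nat \<Rightarrow> 'a \<Rightarrow> 'b::euclidean_space"
  assumes f: "\<And>n. l2s N (f n)"
    and cauchy: "\<And>e. e > 0 \<Longrightarrow> \<exists>K. \<forall>m\<ge>K. \<forall>n\<ge>K. l2 N (\<lambda>x. f m x - f n x) < e"
  obtains g where "l2s N g" "(\<lambda>n. l2 N (\<lambda>x. f n x - g x)) \<longlonglongrightarrow> 0"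
proof -
  note [measurable] = l2s_measurable[OF f]
  have "\<exists>K. \<forall>m\<ge>K. \<forall>n\<ge>K. l2 N (\<lambda>x. f m x - f n x) < (1/4)^k" for k :: nat
    by (rule cauchy) simp
  then obtain K where K: "\<And>k m n. K k \<le> m \<Longrightarrow> K k \<le> n \<Longrightarrow> l2 N (\<lambda>x. f m x - f n x) < (1/4)^k"
    by metis
  define r where "r = rec_nat (K 0) (\<lambda>n a. max (Suc a) (K (Suc n)))"
  have rSuc: "r (Suc k) = max (Suc (r k)) (K (Suc k))" for k by (simp add: r_def)
  have rK: "K k \<le> r k" for k by (cases k) (auto simp: r_def)
  have r_mono: "r k \<le> r (Suc k)" for k by (simp add: rSuc)
  define d where "d k x = f (r (Suc k)) x - f (r k) x" for k x
  have [measurable]: "d k \<in> borel_measurable N" for k unfolding d_def by measurable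
  have d: "l2s N (d k)" "l2 N (d k) \<le> (1/4)^k" for k
    using l2s_diff[OF f f] K[of k "r (Suc k)" "r k"] rK[of k] r_mono[of k]
    by (auto simp: d_def[abs_def] less_imp_le)
  have "(\<integral>\<^sup>+x. suminf (\<lambda>k. ennreal (4^k * (norm (d k x))\<^sup>2)) \<partial>N) = suminf (\<lambda>k. \<integral>\<^sup>+x. ennreal (4^k * (norm (d k x))\<^sup>2) \<partial>N)"
    by (rule nn_integral_suminf) measurable
  also have "\<dots> \<le> suminf (\<lambda>k. ennreal ((1/2)^k))"
  proof (intro suminf_le allI)
    fix k
    have "(\<integral>\<^sup>+x. ennreal (4^k * (norm (d k x))\<^sup>2) \<partial>N) = ennreal (4^k) * ennreal ((l2 N (d k))\<^sup>2)"
      by (simp add: ennreal_mult nn_integral_cmult nn_integral_l2[OF d(1)])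
    also have "\<dots> = ennreal (4^k * (l2 N (d k))\<^sup>2)"
      by (simp add: ennreal_mult)
    also have "4^k * (l2 N (d k))\<^sup>2 \<le> 4^k * ((1/4)^k)\<^sup>2"
      using d(2) by (intro mult_left_mono power_mono) auto
    also have "4^k * ((1/4)^k)\<^sup>2 = (1/4 :: real)^k"
      by (simp add: power2_eq_square power_mult_distrib[symmetric] flip: mult.assoc)
    also have "\<dots> \<le> (1/2)^k" by (intro power_mono) auto
    finally show "(\<integral>\<^sup>+x. ennreal (4^k * (norm (d k x))\<^sup>2) \<partial>N) \<le> ennreal ((1/2)^k)"
      by (simp add: ennreal_leI)
  qed auto
  also have "\<dots> < \<infinity>"
    by (subst suminf_ennreal2) auto
  finally have "AE x in N. suminf (\<lambda>k. ennreal (4^k * (norm (d k x))\<^sup>2)) \<noteq> \<infinity>"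
    by (intro nn_integral_PInf_AE) auto
  then have conv: "AE x in N. convergent (\<lambda>k. f (r k) x)"
  proof eventually_elim
    case (elim x)
    then have "summable (\<lambda>k. 4^k * (norm (d k x))\<^sup>2)"
      by (intro summable_suminf_not_top) auto
    then have "(\<lambda>k. 4^k * (norm (d k x))\<^sup>2) \<longlonglongrightarrow> 0" by (rule summable_LIMSEQ_zero)
    then have "\<forall>\<^sub>F k in sequentially. 4^k * (norm (d k x))\<^sup>2 < 1"
      by (rule order_tendstoD) simp
    then have "\<forall>\<^sub>F k in sequentially. norm (d k x) \<le> (1/2)^k"
    proof eventually_elim
      case (elim k)
      have "(2^k * norm (d k x))\<^sup>2 \<le> 1\<^sup>2"
        using elim by (simp add: power_mult_distrib power_mult[symmetric] mult.commute[of k] power_mult[of 2 2 k])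
      then have "2^k * norm (d k x) \<le> 1" by (rule power2_le_imp_le) simp
      then show ?case by (simp add: field_simps power_divide)
    qed
    then have "summable (\<lambda>k. d k x)"
      by (rule summable_comparison_test_ev) (simp add: summable_geometric)
    then have "convergent (\<lambda>k. \<Sum>j<k. d j x)" by (simp add: summable_iff_convergent)
    then have "convergent (\<lambda>k. f (r 0) x + (\<Sum>j<k. d j x))" by (intro convergent_add convergent_const)
    moreover have "f (r 0) x + (\<Sum>j<k. d j x) = f (r k) x" for k
      unfolding d_def using sum_lessThan_telescope[of "\<lambda>j. f (r j) x" k] by simp
    ultimately show ?case by simp
  qed
  define g where "g x = lim (\<lambda>k. f (r k) x)" for x
  have [measurable]: "g \<in> borel_measurable N" unfolding g_def[abs_def]
    by (rule borel_measurable_lim_metric) measurable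
  have lim: "AE x in N. (\<lambda>k. f (r k) x) \<longlonglongrightarrow> g x"
    using conv by eventually_elim (simp add: g_def convergent_LIMSEQ_iff)
  \<comment> \<open>Fatou along the subsequence turns the Cauchy estimate into a bound for the
    distance to \<open>g\<close>, valid for the whole sequence.\<close>
  have close: "l2s N (\<lambda>x. f m x - g x) \<and> l2 N (\<lambda>x. f m x - g x) \<le> (1/4)^k" if "K k \<le> m" for m k
  proof -
    have rr: "r k \<le> r (j + k)" for j by (induction j) (use r_mono order_trans in auto)
    have "l2 N (\<lambda>x. f m x - f (r (j + k)) x) \<le> (1/4)^k" for j
      using K[of k m "r (j + k)"] that rK[of k] rr[of j] by auto
    moreover have "AE x in N. (\<lambda>j. f m x - f (r (j + k)) x) \<longlonglongrightarrow> f m x - g x"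
      using lim by eventually_elim (intro tendsto_intros LIMSEQ_ignore_initial_segment)
    ultimately show ?thesis
      using l2_fatou[of N "\<lambda>j x. f m x - f (r (j + k)) x" "(1/4)^k" "\<lambda>x. f m x - g x"] l2s_diff[OF f f]
      by auto
  qed
  have "l2s N g"
    using l2s_diff[OF f[of "K 0"] conjunct1[OF close[of 0 "K 0"]]] by simp
  moreover have "(\<lambda>n. l2 N (\<lambda>x. f n x - g x)) \<longlonglongrightarrow> 0"
  proof (rule LIMSEQ_I)
    fix e :: real assume "e > 0"
    then obtain k where k: "(1/4)^k < e" using real_arch_pow_inv[of e "1/4"] by auto
    have "l2 N (\<lambda>x. f n x - g x) < e" if "n \<ge> K k" for n
      using close[OF that] k by linarith
    then show "\<exists>no. \<forall>n\<ge>no. norm (l2 N (\<lambda>x. f n x - g x) - 0) < e" by auto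
  qed
  ultimately show ?thesis using that by blast
qed

lemma l2_tendsto_norm:
  assumes "\<And>n. l2s N (f n)" "l2s N g" "(\<lambda>n. l2 N (\<lambda>x. f n x - g x)) \<longlonglongrightarrow> 0"
  shows "(\<lambda>n. l2 N (f n)) \<longlonglongrightarrow> l2 N g"
proof -
  have "\<bar>l2 N (f n) - l2 N g\<bar> \<le> l2 N (\<lambda>x. f n x - g x)" for n
    using l2_norm_triangle[OF assms(1)[of n] assms(2)] l2_norm_triangle[OF assms(2) assms(1)[of n]]
    by (auto simp: l2_commute)
  then have "(\<lambda>n. l2 N (f n) - l2 N g) \<longlonglongrightarrow> 0"
    by (intro Lim_null_comparison[OF _ assms(3)]) auto
  then show ?thesis by (simp add: LIM_zero_iff)
qed

lemma l2_tendsto_inner: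
  assumes "\<And>n. l2s N (f n)" "l2s N g" "l2s N h" "(\<lambda>n. l2 N (\<lambda>x. f n x - g x)) \<longlonglongrightarrow> 0"
  shows "(\<lambda>n. \<integral>x. f n x \<bullet> h x \<partial>N) \<longlonglongrightarrow> (\<integral>x. g x \<bullet> h x \<partial>N)"
proof -
  have le: "\<bar>(\<integral>x. f n x \<bullet> h x \<partial>N) - (\<integral>x. g x \<bullet> h x \<partial>N)\<bar> \<le> l2 N (\<lambda>x. f n x - g x) * l2 N h" for n
    using l2_Cauchy_Schwarz[OF l2s_diff[OF assms(1)[of n] assms(2)] assms(3)]
    unfolding inner_diff_left
      Bochner_Integration.integral_diff[OF l2s_inner[OF assms(1)[of n] assms(3)] l2s_inner[OF assms(2,3)]] .
  have lim: "(\<lambda>n. l2 N (\<lambda>x. f n x - g x) * l2 N h) \<longlonglongrightarrow> 0"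
    by (rule tendsto_mult_left_zero[OF assms(4)])
  have "(\<lambda>n. (\<integral>x. f n x \<bullet> h x \<partial>N) - (\<integral>x. g x \<bullet> h x \<partial>N)) \<longlonglongrightarrow> 0"
    by (rule Lim_null_comparison[OF _ lim]) (simp only: real_norm_def le eventually_True)
  then show ?thesis by (simp add: LIM_zero_iff)
qed

section \<open>Continuously differentiable functions with compact support\<close>

lemma C1c_grad_support:
  assumes "C1c_grad \<Omega> \<phi> g"
  obtains K where "compact K" "K \<subseteq> \<Omega>" "\<And>x. x \<notin> K \<Longrightarrow> \<phi> x = 0" "\<And>x. x \<notin> K \<Longrightarrow> g x = 0"
proof
  let ?K = "closure {x. \<phi> x \<noteq> 0}"
  show "compact ?K" "?K \<subseteq> \<Omega>" using assms by (auto simp: C1c_grad_def)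
  show 0: "\<phi> x = 0" if "x \<notin> ?K" for x using that closure_subset[of "{x. \<phi> x \<noteq> 0}"] by auto
  show "g x = 0" if "x \<notin> ?K" for x
  proof -
    have "((\<lambda>x. 0) has_derivative (\<lambda>h. g x \<bullet> h)) (at x)"
    proof (rule has_derivative_transform_within_open)
      show "(\<phi> has_derivative (\<lambda>h. g x \<bullet> h)) (at x)" using assms by (simp add: C1c_grad_def)
      show "open (- ?K)" "x \<in> - ?K" using that by auto
      show "\<phi> y = 0" if "y \<in> - ?K" for y using that 0[of y] by blast
    qed
    then have "(\<lambda>h. g x \<bullet> h) = (\<lambda>h. 0)"
      using has_derivative_unique has_derivative_const by blast
    then have "g x \<bullet> g x = 0" by meson
    then show ?thesis by simp
  qed
qed

lemma C1c_gradI: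
  assumes "continuous_on UNIV g" "\<And>x. (\<phi> has_derivative (\<lambda>h. g x \<bullet> h)) (at x)"
    "compact K" "K \<subseteq> \<Omega>" "\<And>x. x \<notin> K \<Longrightarrow> \<phi> x = 0"
  shows "C1c_grad \<Omega> \<phi> g"
proof -
  have "{x. \<phi> x \<noteq> 0} \<subseteq> K" using assms(5) by blast
  then have sub: "closure {x. \<phi> x \<noteq> 0} \<subseteq> K"
    by (rule closure_minimal[OF _ compact_imp_closed[OF assms(3)]])
  then have "K \<inter> closure {x. \<phi> x \<noteq> 0} = closure {x. \<phi> x \<noteq> 0}" by blast
  then have "compact (closure {x. \<phi> x \<noteq> 0})"
    using compact_Int_closed[OF assms(3) closed_closure, of "{x. \<phi> x \<noteq> 0}"] by simp
  then show ?thesis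
    unfolding C1c_grad_def using assms(1,2,4) sub by blast
qed

lemma C1c_grad_mono: "C1c_grad \<Omega> \<phi> g \<Longrightarrow> \<Omega> \<subseteq> \<Omega>' \<Longrightarrow> C1c_grad \<Omega>' \<phi> g"
  by (auto simp: C1c_grad_def)

lemma C1c_grad_continuous:
  assumes "C1c_grad \<Omega> \<phi> g"
  shows "continuous_on UNIV \<phi>" "continuous_on UNIV g"
  using assms by (auto simp: C1c_grad_def intro!: continuous_at_imp_continuous_on has_derivative_continuous)

lemma C1c_grad_add:
  assumes "C1c_grad \<Omega> \<phi> g" "C1c_grad \<Omega> \<psi> h"
  shows "C1c_grad \<Omega> (\<lambda>x. \<phi> x + \<psi> x) (\<lambda>x. g x + h x)"
proof -
  obtain K where K: "compact K" "K \<subseteq> \<Omega>" "\<And>x. x \<notin> K \<Longrightarrow> \<phi> x = 0" using C1c_grad_support[OF assms(1)] by metis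
  obtain L where L: "compact L" "L \<subseteq> \<Omega>" "\<And>x. x \<notin> L \<Longrightarrow> \<psi> x = 0" using C1c_grad_support[OF assms(2)] by metis
  show ?thesis
    using assms K L by (intro C1c_gradI[of _ _ "K \<union> L"])
      (auto simp: C1c_grad_def inner_add_left intro!: continuous_intros has_derivative_add)
qed

lemma C1c_grad_cmult:
  assumes "C1c_grad \<Omega> \<phi> g"
  shows "C1c_grad \<Omega> (\<lambda>x. c * \<phi> x) (\<lambda>x. c *\<^sub>R g x)"
proof -
  obtain K where K: "compact K" "K \<subseteq> \<Omega>" "\<And>x. x \<notin> K \<Longrightarrow> \<phi> x = 0" using C1c_grad_support[OF assms(1)] by metis
  show ?thesis
    using assms K by (intro C1c_gradI[of _ _ K])
      (auto simp: C1c_grad_def intro!: continuous_intros has_derivative_mult_right)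
qed

lemma C1c_grad_diff:
  assumes "C1c_grad \<Omega> \<phi> g" "C1c_grad \<Omega> \<psi> h"
  shows "C1c_grad \<Omega> (\<lambda>x. \<phi> x - \<psi> x) (\<lambda>x. g x - h x)"
  using C1c_grad_add[OF assms(1) C1c_grad_cmult[OF assms(2), of "-1"]] by simp

lemma C1c_grad_mult:
  assumes "C1c_grad \<Omega> \<phi> g" "C1c_grad \<Omega> \<psi> h"
  shows "C1c_grad \<Omega> (\<lambda>x. \<phi> x * \<psi> x) (\<lambda>x. \<phi> x *\<^sub>R h x + \<psi> x *\<^sub>R g x)"
proof -
  obtain K where K: "compact K" "K \<subseteq> \<Omega>" "\<And>x. x \<notin> K \<Longrightarrow> \<phi> x = 0" using C1c_grad_support[OF assms(1)] by metis
  show ?thesis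
  proof (rule C1c_gradI[OF _ _ K(1,2)])
    show "continuous_on UNIV (\<lambda>x. \<phi> x *\<^sub>R h x + \<psi> x *\<^sub>R g x)"
      using C1c_grad_continuous[OF assms(1)] C1c_grad_continuous[OF assms(2)] by (intro continuous_intros)
    fix x
    have "((\<lambda>x. \<phi> x * \<psi> x) has_derivative (\<lambda>v. \<phi> x * (h x \<bullet> v) + (g x \<bullet> v) * \<psi> x)) (at x)"
      using assms by (intro has_derivative_mult) (auto simp: C1c_grad_def)
    then show "((\<lambda>x. \<phi> x * \<psi> x) has_derivative (\<lambda>v. (\<phi> x *\<^sub>R h x + \<psi> x *\<^sub>R g x) \<bullet> v)) (at x)"
      by (simp add: inner_add_left mult.commute)
  qed (use K in auto)
qed

lemma C1c_grad_translate:
  assumes "C1c_grad \<Omega> \<phi> g"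
  shows "C1c_grad UNIV (\<lambda>x. \<phi> (x + a)) (\<lambda>x. g (x + a))"
proof -
  obtain K where K: "compact K" "\<And>x. x \<notin> K \<Longrightarrow> \<phi> x = 0" using C1c_grad_support[OF assms(1)] by metis
  show ?thesis
  proof (rule C1c_gradI)
    show "continuous_on UNIV (\<lambda>x. g (x + a))"
      by (rule continuous_on_compose2[OF C1c_grad_continuous(2)[OF assms]]) (auto intro!: continuous_intros)
    show "compact ((\<lambda>x. x - a) ` K)"
      using K(1) by (intro compact_continuous_image continuous_intros)
    show "\<phi> (x + a) = 0" if "x \<notin> (\<lambda>x. x - a) ` K" for x
      using K(2)[of "x + a"] that by force
    fix x
    have "(\<phi> \<circ> (\<lambda>x. x + a) has_derivative (\<lambda>h. g (x + a) \<bullet> h) \<circ> (\<lambda>h. h)) (at x)"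
      using assms by (intro diff_chain_at) (auto simp: C1c_grad_def intro!: derivative_eq_intros)
    then show "((\<lambda>x. \<phi> (x + a)) has_derivative (\<lambda>h. g (x + a) \<bullet> h)) (at x)"
      by (simp add: o_def)
  qed auto
qed

lemma borel_measurable_lebesgue_continuous:
  fixes f :: "'a::euclidean_space \<Rightarrow> 'b::topological_space"
  assumes "continuous_on UNIV f"
  shows "f \<in> borel_measurable lebesgue"
  using borel_measurable_continuous_onI[OF assms] by (intro measurable_completion) simp

lemma l2s_indicator:
  fixes K :: "'a::euclidean_space set" and c :: "'b::euclidean_space"
  assumes "compact K"
  shows "l2s lebesgue (\<lambda>x. indicator K x *\<^sub>R c)"
proof -
  have "emeasure lebesgue K < \<infinity>" "K \<in> sets lebesgue" 
    using assms emeasure_compact_finite[OF assms] by (auto simp: borel_compact emeasure_completion)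
  moreover have "(norm (indicator K x *\<^sub>R c))\<^sup>2 = indicator K x *\<^sub>R (norm c)\<^sup>2" for x :: 'a
    by (simp add: indicator_def)
  ultimately show ?thesis
    unfolding l2s_def by (auto intro!: borel_measurable_scaleR borel_measurable_indicator integrable_real_indicator integrable_scaleR_left)
qed

lemma l2s_compact_support:
  fixes f :: "'a::euclidean_space \<Rightarrow> 'b::euclidean_space"
  assumes "continuous_on UNIV f" "compact K" "\<And>x. x \<notin> K \<Longrightarrow> f x = 0"
  shows "l2s lebesgue f"
proof -
  have "bounded (f ` K)"
    using assms(1,2) by (meson compact_continuous_image compact_imp_bounded continuous_on_subset subset_UNIV)
  then obtain B where B: "\<And>x. x \<in> K \<Longrightarrow> norm (f x) \<le> B" by (auto simp: bounded_iff)
  have "integrable lebesgue (\<lambda>x. (norm (f x))\<^sup>2)"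
  proof (rule Bochner_Integration.integrable_bound)
    show "integrable lebesgue (\<lambda>x::'a. (norm (indicator K x *\<^sub>R B))\<^sup>2)"
      using l2s_indicator[OF assms(2), of B] by (simp add: l2s_def)
    show "(\<lambda>x. (norm (f x))\<^sup>2) \<in> borel_measurable lebesgue"
      using borel_measurable_lebesgue_continuous[OF assms(1)] by measurable
    have "(norm (f x))\<^sup>2 \<le> (norm (indicator K x *\<^sub>R B))\<^sup>2" for x
      using B[of x] assms(3)[of x] by (cases "x \<in> K") (auto intro!: power_mono)
    then show "AE x in lebesgue. norm ((norm (f x))\<^sup>2) \<le> norm ((norm (indicator K x *\<^sub>R B))\<^sup>2)"
      by auto
  qed
  then show ?thesis
    using borel_measurable_lebesgue_continuous[OF assms(1)] by (simp add: l2s_def)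
qed

lemma C1c_grad_l2s:
  assumes "C1c_grad \<Omega> \<phi> g"
  shows "l2s lebesgue \<phi>" "l2s lebesgue g"
proof -
  obtain K where K: "compact K" "\<And>x. x \<notin> K \<Longrightarrow> \<phi> x = 0" "\<And>x. x \<notin> K \<Longrightarrow> g x = 0"
    using C1c_grad_support[OF assms(1)] by metis
  show "l2s lebesgue \<phi>" "l2s lebesgue g"
    using C1c_grad_continuous[OF assms] K l2s_compact_support by blast+
qed

lemma C1c_grad_bound:
  assumes "C1c_grad \<Omega> \<phi> g"
  obtains B where "0 < B" "\<And>x. norm (g x) \<le> B"
proof -
  obtain K where K: "compact K" "\<And>x. x \<notin> K \<Longrightarrow> g x = 0"
    using C1c_grad_support[OF assms(1)] by metis
  have "bounded (g ` K)"
    using K(1) C1c_grad_continuous(2)[OF assms]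
    by (meson compact_continuous_image compact_imp_bounded continuous_on_subset subset_UNIV)
  then obtain B where "0 < B" "\<And>x. x \<in> K \<Longrightarrow> norm (g x) \<le> B" by (auto simp: bounded_pos)
  then show ?thesis using K(2) that[of B] by (metis less_imp_le norm_zero)
qed

section \<open>Difference quotients and integration by parts\<close>

definition diff_quotient :: "(real^'n \<Rightarrow> real) \<Rightarrow> real^'n \<Rightarrow> nat \<Rightarrow> real^'n \<Rightarrow> real" where
  "diff_quotient \<phi> e j x = real (Suc j) * (\<phi> (x + inverse (real (Suc j)) *\<^sub>R e) - \<phi> x)"

lemma C1c_grad_diff_quotient:
  assumes "C1c_grad \<Omega> \<phi> g"
  shows "\<exists>h. C1c_grad UNIV (diff_quotient \<phi> e j) h"
  unfolding diff_quotient_def[abs_def]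
  using C1c_grad_cmult[OF C1c_grad_diff[OF C1c_grad_translate[OF assms] C1c_grad_mono[OF assms]]] by blast

text \<open>All steps have length at most \<open>norm e\<close>, so one ball contains the supports
  for every \<open>j\<close>.\<close>

lemma diff_quotient_support:
  assumes "C1c_grad \<Omega> \<phi> g"
  obtains K where "compact K" "\<And>j x. x \<notin> K \<Longrightarrow> diff_quotient \<phi> e j x = 0" "\<And>x. x \<notin> K \<Longrightarrow> \<phi> x = 0"
    "\<And>x. x \<notin> K \<Longrightarrow> g x = 0"
proof -
  obtain K where K: "compact K" "\<And>x. x \<notin> K \<Longrightarrow> \<phi> x = 0" "\<And>x. x \<notin> K \<Longrightarrow> g x = 0"
    using C1c_grad_support[OF assms(1)] by metis
  obtain R where R: "\<And>x. x \<in> K \<Longrightarrow> norm x \<le> R"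
    using compact_imp_bounded[OF K(1)] by (auto simp: bounded_iff)
  have far: "x \<notin> K \<and> x + inverse (real (Suc j)) *\<^sub>R e \<notin> K" if "x \<notin> cball 0 (R + norm e)" for x j
  proof -
    have "norm (inverse (real (Suc j)) *\<^sub>R e) \<le> norm e"
      by (simp add: mult_left_le_one_le inverse_le_1_iff)
    then have "norm (x + inverse (real (Suc j)) *\<^sub>R e) > R"
      using that norm_triangle_ineq4[of "x + inverse (real (Suc j)) *\<^sub>R e" "inverse (real (Suc j)) *\<^sub>R e"]
      by simp
    moreover have "norm x > R + norm e" using that by simp
    then have "norm x > R" using norm_ge_zero[of e] by linarith
    ultimately show ?thesis using R by force
  qed
  show ?thesis
    by (rule that[of "cball 0 (R + norm e)"]) (use far K in \<open>auto simp: diff_quotient_def\<close>)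
qed

text \<open>Dominated convergence: the mean value inequality bounds the quotients by
  \<open>B * norm e\<close> with \<open>B\<close> a bound for the gradient, and all of them live on
  one compact set.\<close>

lemma diff_quotient_tendsto:
  fixes \<phi> :: "real^'n \<Rightarrow> real"
  assumes C: "C1c_grad \<Omega> \<phi> g"
  shows "(\<lambda>j. l2 lebesgue (\<lambda>x. diff_quotient \<phi> e j x - g x \<bullet> e)) \<longlonglongrightarrow> 0"
proof -
  obtain B where B: "0 < B" "\<And>x. norm (g x) \<le> B" using C1c_grad_bound[OF C] by blast
  obtain K where K: "compact K" "\<And>j x. x \<notin> K \<Longrightarrow> diff_quotient \<phi> e j x = 0" "\<And>x. x \<notin> K \<Longrightarrow> g x = 0"
    using diff_quotient_support[OF C] by metis
  have der: "(\<phi> has_derivative (\<lambda>h. g x \<bullet> h)) (at x)" for x using C by (simp add: C1c_grad_def)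
  have lip: "norm (\<phi> x - \<phi> y) \<le> B * norm (x - y)" for x y
  proof (rule differentiable_bound[of UNIV \<phi> "\<lambda>x h. g x \<bullet> h"])
    show "onorm (\<lambda>h. g x \<bullet> h) \<le> B" for x
    proof (rule onorm_le)
      fix h
      have "norm (g x \<bullet> h) \<le> norm (g x) * norm h" using Cauchy_Schwarz_ineq2 by simp
      also have "\<dots> \<le> B * norm h" using B by (intro mult_right_mono) auto
      finally show "norm (g x \<bullet> h) \<le> B * norm h" .
    qed
  qed (use der in auto)
  have dq: "\<bar>diff_quotient \<phi> e j x\<bar> \<le> B * norm e" for j x
  proof -
    have "\<bar>diff_quotient \<phi> e j x\<bar> \<le> real (Suc j) * (B * norm (inverse (real (Suc j)) *\<^sub>R e))"
      unfolding diff_quotient_def abs_mult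
      using lip[of "x + inverse (real (Suc j)) *\<^sub>R e" x] by (intro mult_mono) auto
    also have "\<dots> = B * norm e" by (simp add: field_simps del: of_nat_Suc)
    finally show ?thesis .
  qed
  have ge: "\<bar>g x \<bullet> e\<bar> \<le> B * norm e" for x
    using Cauchy_Schwarz_ineq2[of "g x" e] mult_right_mono[OF B(2)[of x] norm_ge_zero[of e]] by linarith
  have cont: "continuous_on UNIV (\<lambda>x. diff_quotient \<phi> e j x - g x \<bullet> e)" for j
    using C1c_grad_continuous[OF C] C1c_grad_continuous(1)[OF C1c_grad_translate[OF C]]
    unfolding diff_quotient_def by (intro continuous_intros)
  have lim: "(\<lambda>j. diff_quotient \<phi> e j x - g x \<bullet> e) \<longlonglongrightarrow> 0" for x
  proof -
    have "((\<lambda>t. x + t *\<^sub>R e) has_derivative (\<lambda>t. t *\<^sub>R e)) (at (0::real))"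
      by (auto intro!: derivative_eq_intros)
    then have "((\<lambda>t. \<phi> (x + t *\<^sub>R e)) has_derivative (\<lambda>t. g x \<bullet> (t *\<^sub>R e))) (at 0)"
      using diff_chain_at[of "\<lambda>t. x + t *\<^sub>R e" "\<lambda>t. t *\<^sub>R e" "0::real" \<phi> "\<lambda>h. g x \<bullet> h"] der[of x]
      by (simp add: o_def)
    then have "((\<lambda>t. \<phi> (x + t *\<^sub>R e)) has_field_derivative g x \<bullet> e) (at 0)"
      by (rule has_derivative_imp_has_field_derivative) simp
    then have "((\<lambda>t. (\<phi> (x + t *\<^sub>R e) - \<phi> x) / t) \<longlongrightarrow> g x \<bullet> e) (at 0)"
      by (simp add: has_field_derivative_iff)
    moreover have "filterlim (\<lambda>j. inverse (real (Suc j))) (at 0) sequentially"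
      using LIMSEQ_inverse_real_of_nat by (intro filterlim_atI) auto
    ultimately have "(\<lambda>j. (\<phi> (x + inverse (real (Suc j)) *\<^sub>R e) - \<phi> x) / inverse (real (Suc j))) \<longlonglongrightarrow> g x \<bullet> e"
      by (rule filterlim_compose)
    moreover have "(\<phi> (x + inverse (real (Suc j)) *\<^sub>R e) - \<phi> x) / inverse (real (Suc j)) = diff_quotient \<phi> e j x" for j
      by (simp add: diff_quotient_def field_simps)
    ultimately show ?thesis by (simp only: LIM_zero_iff)
  qed
  have "(\<lambda>j. \<integral>x. (norm (diff_quotient \<phi> e j x - g x \<bullet> e))\<^sup>2 \<partial>lebesgue) \<longlonglongrightarrow> (\<integral>x. 0 \<partial>(lebesgue :: (real^'n) measure))"
  proof (rule integral_dominated_convergence)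
    show "integrable lebesgue (\<lambda>x. (norm (indicator K x *\<^sub>R (2 * B * norm e)))\<^sup>2)"
      using l2s_indicator[OF K(1), of "2 * B * norm e"] by (simp add: l2s_def)
    show "(\<lambda>x. (norm (diff_quotient \<phi> e j x - g x \<bullet> e))\<^sup>2) \<in> borel_measurable lebesgue" for j
      using borel_measurable_lebesgue_continuous[OF cont[of j]] by measurable
    show "AE x in lebesgue. (\<lambda>j. (norm (diff_quotient \<phi> e j x - g x \<bullet> e))\<^sup>2) \<longlonglongrightarrow> 0"
    proof (intro always_eventually allI)
      fix x
      show "(\<lambda>j. (norm (diff_quotient \<phi> e j x - g x \<bullet> e))\<^sup>2) \<longlonglongrightarrow> 0"
        using tendsto_power[OF tendsto_norm[OF lim[of x]], of 2] by simp
    qed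
    show "AE x in lebesgue. norm ((norm (diff_quotient \<phi> e j x - g x \<bullet> e))\<^sup>2)
        \<le> (norm (indicator K x *\<^sub>R (2 * B * norm e)))\<^sup>2" for j
    proof (intro always_eventually allI)
      fix x
      have "\<bar>diff_quotient \<phi> e j x - g x \<bullet> e\<bar> \<le> indicator K x * (2 * B * norm e)"
        using dq[of j x] ge[of x] K(2)[of x j] K(3)[of x] by (cases "x \<in> K") auto
      then have "\<bar>diff_quotient \<phi> e j x - g x \<bullet> e\<bar>\<^sup>2 \<le> (indicator K x * (2 * B * norm e))\<^sup>2"
        by (intro power_mono) auto
      then show "norm ((norm (diff_quotient \<phi> e j x - g x \<bullet> e))\<^sup>2)
        \<le> (norm (indicator K x *\<^sub>R (2 * B * norm e)))\<^sup>2" by (simp add: power_mult_distrib)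
    qed
  qed auto
  then have "(\<lambda>j. sqrt (\<integral>x. (norm (diff_quotient \<phi> e j x - g x \<bullet> e))\<^sup>2 \<partial>lebesgue)) \<longlonglongrightarrow> sqrt 0"
    by (intro tendsto_real_sqrt) simp
  then show ?thesis by (simp add: l2_def)
qed

lemma l2s_inner_const:
  assumes "l2s N f" shows "l2s N (\<lambda>x. f x \<bullet> e)" "l2 N (\<lambda>x. f x \<bullet> e) \<le> norm e * l2 N f"
proof -
  note [measurable] = l2s_measurable[OF assms]
  have le: "(norm (f x \<bullet> e))\<^sup>2 \<le> (norm (norm e *\<^sub>R f x))\<^sup>2" for x
    using Cauchy_Schwarz_ineq2[of "f x" e] by (intro power_mono) (auto simp: mult.commute)
  have i: "integrable N (\<lambda>x. (norm (norm e *\<^sub>R f x))\<^sup>2)"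
    using l2s_scaleR[OF assms] by (simp only: l2s_def)
  have "integrable N (\<lambda>x. (norm (f x \<bullet> e))\<^sup>2)"
  proof (rule Bochner_Integration.integrable_bound[OF i])
    show "AE x in N. norm ((norm (f x \<bullet> e))\<^sup>2) \<le> norm ((norm (norm e *\<^sub>R f x))\<^sup>2)"
      using le by (intro always_eventually allI) (simp only: real_norm_def abs_power2)
  qed measurable
  then show *: "l2s N (\<lambda>x. f x \<bullet> e)" unfolding l2s_def by (intro conjI) measurable
  have "l2 N (\<lambda>x. f x \<bullet> e) \<le> l2 N (\<lambda>x. norm e *\<^sub>R f x)"
    unfolding l2_def using * i le by (intro real_sqrt_le_mono integral_mono) (simp_all only: l2s_def)
  then show "l2 N (\<lambda>x. f x \<bullet> e) \<le> norm e * l2 N f" by (simp add: l2_scaleR)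
qed

lemma l2_diff_le:
  assumes "l2s N f" "l2s N g"
  shows "l2 N (\<lambda>x. f x - g x) \<le> l2 N f + l2 N g"
  using l2_triangle[OF assms(1) l2s_scaleR[OF assms(2), of "-1"]] l2_scaleR[of N "-1" g] by simp

lemma lebesgue_integral_translate:
  fixes f :: "'a::euclidean_space \<Rightarrow> real"
  assumes [measurable]: "f \<in> borel_measurable borel"
  shows "(\<integral>x. f (x + a) \<partial>lebesgue) = (\<integral>x. f x \<partial>lebesgue)"
proof -
  have "(\<integral>x. f x \<partial>lebesgue) = (\<integral>x. f x \<partial>(distr lborel borel ((+) a)))"
    by (simp add: lborel_distr_plus integral_completion)
  also have "\<dots> = (\<integral>x. f (a + x) \<partial>lborel)"
    by (rule integral_distr) simp_all
  also have "\<dots> = (\<integral>x. f (x + a) \<partial>lebesgue)"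
    by (simp add: integral_completion add.commute)
  finally show ?thesis by simp
qed

lemma C1c_grad_integrable:
  assumes "C1c_grad \<Omega> \<phi> g"
  shows "integrable lebesgue \<phi>"
proof -
  obtain K where K: "compact K" "\<And>x. x \<notin> K \<Longrightarrow> \<phi> x = 0"
    using C1c_grad_support[OF assms(1)] by metis
  have "integrable lebesgue (\<lambda>x. \<phi> x \<bullet> (indicator K x *\<^sub>R 1))"
    by (rule l2s_inner[OF C1c_grad_l2s(1)[OF assms] l2s_indicator[OF K(1)]])
  moreover have "(\<lambda>x. \<phi> x \<bullet> (indicator K x *\<^sub>R 1)) = \<phi>"
    using K(2) by (auto simp: indicator_def fun_eq_iff)
  ultimately show ?thesis by simp
qed

text \<open>By translation invariance every difference quotient has integral 0. Pairing with the
  indicator of a common support turns convergence in \<open>l2\<close> into convergence of the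
  integrals.\<close>

lemma C1c_grad_integral_eq_0:
  assumes C: "C1c_grad \<Omega> \<phi> g"
  shows "(\<integral>x. g x \<bullet> e \<partial>lebesgue) = 0"
proof -
  obtain K where K: "compact K" "\<And>j x. x \<notin> K \<Longrightarrow> diff_quotient \<phi> e j x = 0" "\<And>x. x \<notin> K \<Longrightarrow> g x = 0"
    using diff_quotient_support[OF C] by metis
  let ?h = "\<lambda>x. indicator K x *\<^sub>R (1 :: real)"
  have dq: "l2s lebesgue (diff_quotient \<phi> e j)" for j
    using C1c_grad_diff_quotient[OF C] C1c_grad_l2s by blast
  have lim: "(\<lambda>j. \<integral>x. diff_quotient \<phi> e j x \<bullet> ?h x \<partial>lebesgue) \<longlonglongrightarrow> (\<integral>x. (g x \<bullet> e) \<bullet> ?h x \<partial>lebesgue)"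
    by (rule l2_tendsto_inner[OF dq l2s_inner_const(1)[OF C1c_grad_l2s(2)[OF C]] l2s_indicator[OF K(1)]
          diff_quotient_tendsto[OF C]])
  have "(\<integral>x. diff_quotient \<phi> e j x \<bullet> ?h x \<partial>lebesgue) = 0" for j
  proof -
    have "(\<lambda>x. diff_quotient \<phi> e j x \<bullet> ?h x) = diff_quotient \<phi> e j"
      using K(2) by (auto simp: indicator_def fun_eq_iff)
    moreover have "(\<integral>x. diff_quotient \<phi> e j x \<partial>lebesgue) = 0"
      unfolding diff_quotient_def
      using C1c_grad_integrable[OF C] C1c_grad_integrable[OF C1c_grad_translate[OF C]]
        lebesgue_integral_translate[OF borel_measurable_continuous_onI[OF C1c_grad_continuous(1)[OF C]]]
      by simp
    ultimately show ?thesis by simp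
  qed
  then have "(\<integral>x. (g x \<bullet> e) \<bullet> ?h x \<partial>lebesgue) = 0"
    using lim by (simp only: LIMSEQ_const_iff)
  moreover have "(\<lambda>x. (g x \<bullet> e) \<bullet> ?h x) = (\<lambda>x. g x \<bullet> e)"
    using K(3) by (auto simp: indicator_def fun_eq_iff)
  ultimately show ?thesis by simp
qed

lemma C1c_grad_integration_by_parts:
  assumes "C1c_grad \<Omega> \<phi> g" "C1c_grad \<Omega> \<psi> h"
  shows "(\<integral>x. (g x \<bullet> e) * \<psi> x \<partial>lebesgue) = - (\<integral>x. \<phi> x * (h x \<bullet> e) \<partial>lebesgue)"
proof -
  have "integrable lebesgue (\<lambda>x. (g x \<bullet> e) * \<psi> x)" "integrable lebesgue (\<lambda>x. \<phi> x * (h x \<bullet> e))"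
    using l2s_inner[OF l2s_inner_const(1)[OF C1c_grad_l2s(2)[OF assms(1)]] C1c_grad_l2s(1)[OF assms(2)]]
      l2s_inner[OF C1c_grad_l2s(1)[OF assms(1)] l2s_inner_const(1)[OF C1c_grad_l2s(2)[OF assms(2)]]]
    by simp_all
  moreover have "(\<integral>x. \<phi> x * (h x \<bullet> e) + (g x \<bullet> e) * \<psi> x \<partial>lebesgue) = 0"
    using C1c_grad_integral_eq_0[OF C1c_grad_mult[OF assms], of e]
    by (simp add: inner_add_left mult.commute)
  ultimately show ?thesis by simp
qed

text \<open>Since the \<open>C\<^sup>1\<close> functions in the definition of \<open>H10\<close> are
  only once differentiable, difference quotients of \<open>\<psi> m\<close> replace its derivative as test functions.\<close>

lemma gradient_closable:
  fixes \<psi> :: "nat \<Rightarrow> real^'n \<Rightarrow> real"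
  assumes C: "\<And>n. C1c_grad UNIV (\<psi> n) (d\<psi> n)" and h: "l2s lebesgue h"
    and 0: "(\<lambda>n. l2 lebesgue (\<psi> n)) \<longlonglongrightarrow> 0"
    and lim: "(\<lambda>n. l2 lebesgue (\<lambda>x. d\<psi> n x - h x)) \<longlonglongrightarrow> 0"
  shows "AE x in lebesgue. h x = 0"
proof -
  have he: "l2s lebesgue (\<lambda>x. h x \<bullet> e)" for e by (rule l2s_inner_const(1)[OF h])
  have de: "l2s lebesgue (\<lambda>x. d\<psi> n x \<bullet> e)" for n e by (rule l2s_inner_const(1)[OF C1c_grad_l2s(2)[OF C]])
  have lime: "(\<lambda>n. l2 lebesgue (\<lambda>x. d\<psi> n x \<bullet> e - h x \<bullet> e)) \<longlonglongrightarrow> 0" for e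
  proof (rule Lim_null_comparison)
    show "(\<lambda>n. norm e * l2 lebesgue (\<lambda>x. d\<psi> n x - h x)) \<longlonglongrightarrow> 0"
      by (rule tendsto_mult_right_zero[OF lim])
    show "\<forall>\<^sub>F n in sequentially. norm (l2 lebesgue (\<lambda>x. d\<psi> n x \<bullet> e - h x \<bullet> e)) \<le> norm e * l2 lebesgue (\<lambda>x. d\<psi> n x - h x)"
      using l2s_inner_const(2)[OF l2s_diff[OF C1c_grad_l2s(2)[OF C] h], where e = e]
      by (simp add: inner_diff_left)
  qed
  have test: "(\<integral>x. (h x \<bullet> e) \<bullet> \<theta> x \<partial>lebesgue) = 0" if \<theta>: "C1c_grad UNIV \<theta> d\<theta>" for \<theta> d\<theta> e
  proof (rule LIMSEQ_unique)
    show "(\<lambda>n. \<integral>x. (d\<psi> n x \<bullet> e) \<bullet> \<theta> x \<partial>lebesgue) \<longlonglongrightarrow> (\<integral>x. (h x \<bullet> e) \<bullet> \<theta> x \<partial>lebesgue)"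
      by (rule l2_tendsto_inner[OF de he C1c_grad_l2s(1)[OF \<theta>] lime])
    have le: "\<bar>\<integral>x. (d\<psi> n x \<bullet> e) \<bullet> \<theta> x \<partial>lebesgue\<bar> \<le> l2 lebesgue (\<psi> n) * l2 lebesgue (\<lambda>x. d\<theta> x \<bullet> e)" for n
      using l2_Cauchy_Schwarz[OF C1c_grad_l2s(1)[OF C[of n]] l2s_inner_const(1)[OF C1c_grad_l2s(2)[OF \<theta>], of e]]
        C1c_grad_integration_by_parts[OF C[of n] \<theta>, of e]
      by simp
    show "(\<lambda>n. \<integral>x. (d\<psi> n x \<bullet> e) \<bullet> \<theta> x \<partial>lebesgue) \<longlonglongrightarrow> 0"
      by (rule Lim_null_comparison[OF _ tendsto_mult_left_zero[OF 0, of "l2 lebesgue (\<lambda>x. d\<theta> x \<bullet> e)"]])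
        (simp only: real_norm_def le eventually_True)
  qed
  have test2: "(\<integral>x. (d\<psi> m x \<bullet> e) \<bullet> (h x \<bullet> e) \<partial>lebesgue) = 0" for m e
  proof (rule LIMSEQ_unique)
    have dq: "l2s lebesgue (diff_quotient (\<psi> m) e j)" for j
      using C1c_grad_diff_quotient[OF C] C1c_grad_l2s by blast
    show "(\<lambda>j. \<integral>x. diff_quotient (\<psi> m) e j x \<bullet> (h x \<bullet> e) \<partial>lebesgue) \<longlonglongrightarrow> (\<integral>x. (d\<psi> m x \<bullet> e) \<bullet> (h x \<bullet> e) \<partial>lebesgue)"
      by (rule l2_tendsto_inner[OF dq de he diff_quotient_tendsto[OF C]])
    have "(\<integral>x. diff_quotient (\<psi> m) e j x \<bullet> (h x \<bullet> e) \<partial>lebesgue) = 0" for j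
      using C1c_grad_diff_quotient[OF C[of m], of e j] test[of "diff_quotient (\<psi> m) e j" _ e]
      by (auto simp: mult.commute)
    then show "(\<lambda>j. \<integral>x. diff_quotient (\<psi> m) e j x \<bullet> (h x \<bullet> e) \<partial>lebesgue) \<longlonglongrightarrow> 0" by simp
  qed
  \<comment> \<open>\<open>h x \<bullet> e\<close> is the \<open>l2\<close> limit of the functions
    \<open>d\<psi> n x \<bullet> e\<close>, to each of which it has just been shown to be
    orthogonal; hence it is orthogonal to itself.\<close>
  have "AE x in lebesgue. h x \<bullet> e = 0" for e
  proof -
    have "(\<lambda>n. \<integral>x. (d\<psi> n x \<bullet> e) \<bullet> (h x \<bullet> e) \<partial>lebesgue) \<longlonglongrightarrow> (\<integral>x. (h x \<bullet> e) \<bullet> (h x \<bullet> e) \<partial>lebesgue)"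
      by (rule l2_tendsto_inner[OF de he he lime])
    then have "(\<integral>x. (h x \<bullet> e) \<bullet> (h x \<bullet> e) \<partial>lebesgue) = 0"
      unfolding test2 by (simp add: LIMSEQ_const_iff)
    then have "l2 lebesgue (\<lambda>x. h x \<bullet> e) = 0"
      by (simp add: l2_def power2_eq_square)
    then show ?thesis using l2_eq_0_iff[OF he] by blast
  qed
  then have "AE x in lebesgue. \<forall>e\<in>Basis. h x \<bullet> e = 0"
    by (intro AE_finite_allI) auto
  then show ?thesis
    by eventually_elim (simp add: euclidean_all_zero_iff)
qed

section \<open>Weak gradients in terms of \<open>l2\<close>\<close>

lemma tendsto_nn_integral_l2:
  assumes "\<And>n. l2s N (f n)"
  shows "((\<lambda>n. \<integral>\<^sup>+x. ennreal ((norm (f n x))\<^sup>2) \<partial>N) \<longlongrightarrow> 0) sequentially \<longleftrightarrow> (\<lambda>n. l2 N (f n)) \<longlonglongrightarrow> 0"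
proof
  assume "((\<lambda>n. \<integral>\<^sup>+x. ennreal ((norm (f n x))\<^sup>2) \<partial>N) \<longlongrightarrow> 0) sequentially"
  then have "(\<lambda>n. ennreal ((l2 N (f n))\<^sup>2)) \<longlonglongrightarrow> ennreal 0"
    by (simp only: nn_integral_l2[OF assms] ennreal_0)
  then have "(\<lambda>n. (l2 N (f n))\<^sup>2) \<longlonglongrightarrow> 0"
    by (rule tendsto_ennrealD) simp_all
  then show "(\<lambda>n. l2 N (f n)) \<longlonglongrightarrow> 0"
    using tendsto_real_sqrt by fastforce
next
  assume "(\<lambda>n. l2 N (f n)) \<longlonglongrightarrow> 0"
  then have "(\<lambda>n. ennreal ((l2 N (f n))\<^sup>2)) \<longlonglongrightarrow> ennreal (0\<^sup>2)"
    by (intro tendsto_ennrealI tendsto_power)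
  then show "((\<lambda>n. \<integral>\<^sup>+x. ennreal ((norm (f n x))\<^sup>2) \<partial>N) \<longlongrightarrow> 0) sequentially"
    by (simp add: nn_integral_l2[OF assms])
qed

lemma l2s_of_tendsto:
  assumes "\<And>n. l2s N (f n)" "g \<in> borel_measurable N"
    "((\<lambda>n. \<integral>\<^sup>+x. ennreal ((norm (f n x - g x))\<^sup>2) \<partial>N) \<longlongrightarrow> 0) sequentially"
  shows "l2s N g"
proof -
  have "\<forall>\<^sub>F n in sequentially. (\<integral>\<^sup>+x. ennreal ((norm (f n x - g x))\<^sup>2) \<partial>N) < 1"
    using assms(3) by (rule order_tendstoD) simp
  then obtain n where n: "(\<integral>\<^sup>+x. ennreal ((norm (f n x - g x))\<^sup>2) \<partial>N) < 1"
    by (auto simp: eventually_sequentially)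
  note [measurable] = assms(2) l2s_measurable[OF assms(1)]
  have "l2s N (\<lambda>x. f n x - g x)"
    using n by (intro l2sI_nn_integral) (auto intro: less_trans)
  from l2s_diff[OF assms(1)[of n] this] show ?thesis by simp
qed

text \<open>The definition speaks of nonnegative integrals of measurable functions. Square
  integrability of \<open>u\<close> and \<open>g\<close> comes for free, as both lie at finite
  distance from a square-integrable function.\<close>

lemma H10_grad_iff:
  "H10_grad \<Omega> u g \<longleftrightarrow> l2s lebesgue u \<and> l2s lebesgue g \<and>
    (\<exists>\<phi> d\<phi>. (\<forall>n. C1c_grad \<Omega> (\<phi> n) (d\<phi> n)) \<and> (\<lambda>n. l2 lebesgue (\<lambda>x. \<phi> n x - u x)) \<longlonglongrightarrow> 0 \<and>
      (\<lambda>n. l2 lebesgue (\<lambda>x. d\<phi> n x - g x)) \<longlonglongrightarrow> 0)"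
  (is "?L = ?R")
proof
  assume ?L
  then obtain \<phi> d\<phi> where C: "\<And>n. C1c_grad \<Omega> (\<phi> n) (d\<phi> n)"
    and m: "u \<in> borel_measurable lebesgue" "g \<in> borel_measurable lebesgue"
    and lim: "((\<lambda>n. \<integral>\<^sup>+x. ennreal ((norm (\<phi> n x - u x))\<^sup>2) \<partial>lebesgue) \<longlongrightarrow> 0) sequentially"
      "((\<lambda>n. \<integral>\<^sup>+x. ennreal ((norm (d\<phi> n x - g x))\<^sup>2) \<partial>lebesgue) \<longlongrightarrow> 0) sequentially"
    by (auto simp: H10_grad_def)
  note l = l2s_of_tendsto[OF C1c_grad_l2s(1)[OF C] m(1) lim(1)]
    l2s_of_tendsto[OF C1c_grad_l2s(2)[OF C] m(2) lim(2)]
  have "(\<lambda>n. l2 lebesgue (\<lambda>x. \<phi> n x - u x)) \<longlonglongrightarrow> 0"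
    using lim(1) tendsto_nn_integral_l2[of lebesgue "\<lambda>n x. \<phi> n x - u x"] l2s_diff[OF C1c_grad_l2s(1)[OF C] l(1)]
    by blast
  moreover have "(\<lambda>n. l2 lebesgue (\<lambda>x. d\<phi> n x - g x)) \<longlonglongrightarrow> 0"
    using lim(2) tendsto_nn_integral_l2[of lebesgue "\<lambda>n x. d\<phi> n x - g x"] l2s_diff[OF C1c_grad_l2s(2)[OF C] l(2)]
    by blast
  ultimately show ?R using l C by blast
next
  assume ?R
  then obtain \<phi> d\<phi> where C: "\<And>n. C1c_grad \<Omega> (\<phi> n) (d\<phi> n)"
    and l: "l2s lebesgue u" "l2s lebesgue g"
    and lim: "(\<lambda>n. l2 lebesgue (\<lambda>x. \<phi> n x - u x)) \<longlonglongrightarrow> 0"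
      "(\<lambda>n. l2 lebesgue (\<lambda>x. d\<phi> n x - g x)) \<longlonglongrightarrow> 0"
    by blast
  have "((\<lambda>n. \<integral>\<^sup>+x. ennreal ((norm (\<phi> n x - u x))\<^sup>2) \<partial>lebesgue) \<longlongrightarrow> 0) sequentially"
    using lim(1) tendsto_nn_integral_l2[of lebesgue "\<lambda>n x. \<phi> n x - u x"] l2s_diff[OF C1c_grad_l2s(1)[OF C] l(1)]
    by blast
  moreover have "((\<lambda>n. \<integral>\<^sup>+x. ennreal ((norm (d\<phi> n x - g x))\<^sup>2) \<partial>lebesgue) \<longlongrightarrow> 0) sequentially"
    using lim(2) tendsto_nn_integral_l2[of lebesgue "\<lambda>n x. d\<phi> n x - g x"] l2s_diff[OF C1c_grad_l2s(2)[OF C] l(2)]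
    by blast
  ultimately show ?L
    unfolding H10_grad_def using C l by (auto dest: l2s_measurable)
qed

text \<open>The difference of two approximating sequences tends to 0 while its gradients tend to
  \<open>g - g'\<close>, so closability applies. This makes \<open>H10_norm2\<close>, which is
  defined through a choice of the gradient, well defined.\<close>

lemma H10_grad_unique:
  assumes "H10_grad \<Omega> u g" "H10_grad \<Omega> u g'"
  shows "AE x in lebesgue. g x = g' x"
proof -
  obtain \<phi> d\<phi> where C: "\<And>n. C1c_grad \<Omega> (\<phi> n) (d\<phi> n)" and l: "l2s lebesgue u" "l2s lebesgue g"
    and lim: "(\<lambda>n. l2 lebesgue (\<lambda>x. \<phi> n x - u x)) \<longlonglongrightarrow> 0" "(\<lambda>n. l2 lebesgue (\<lambda>x. d\<phi> n x - g x)) \<longlonglongrightarrow> 0"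
    using assms(1) unfolding H10_grad_iff by blast
  obtain \<psi> d\<psi> where C': "\<And>n. C1c_grad \<Omega> (\<psi> n) (d\<psi> n)" and l': "l2s lebesgue g'"
    and lim': "(\<lambda>n. l2 lebesgue (\<lambda>x. \<psi> n x - u x)) \<longlonglongrightarrow> 0" "(\<lambda>n. l2 lebesgue (\<lambda>x. d\<psi> n x - g' x)) \<longlonglongrightarrow> 0"
    using assms(2) unfolding H10_grad_iff by blast
  note s = C1c_grad_l2s[OF C] and s' = C1c_grad_l2s[OF C']
  have "AE x in lebesgue. g x - g' x = 0"
  proof (rule gradient_closable)
    show "C1c_grad UNIV (\<lambda>x. \<phi> n x - \<psi> n x) (\<lambda>x. d\<phi> n x - d\<psi> n x)" for n
      by (rule C1c_grad_mono[OF C1c_grad_diff[OF C C']]) simp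
    show "l2s lebesgue (\<lambda>x. g x - g' x)" by (rule l2s_diff[OF l(2) l'])
    show "(\<lambda>n. l2 lebesgue (\<lambda>x. \<phi> n x - \<psi> n x)) \<longlonglongrightarrow> 0"
    proof (rule Lim_null_comparison)
      show "(\<lambda>n. l2 lebesgue (\<lambda>x. \<phi> n x - u x) + l2 lebesgue (\<lambda>x. \<psi> n x - u x)) \<longlonglongrightarrow> 0"
        using tendsto_add[OF lim(1) lim'(1)] by simp
      show "\<forall>\<^sub>F n in sequentially. norm (l2 lebesgue (\<lambda>x. \<phi> n x - \<psi> n x)) \<le> l2 lebesgue (\<lambda>x. \<phi> n x - u x) + l2 lebesgue (\<lambda>x. \<psi> n x - u x)"
        using l2_diff_triangle[OF s(1) l(1) s'(1)] by (simp add: l2_commute[of _ u])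
    qed
    show "(\<lambda>n. l2 lebesgue (\<lambda>x. d\<phi> n x - d\<psi> n x - (g x - g' x))) \<longlonglongrightarrow> 0"
    proof (rule Lim_null_comparison)
      show "(\<lambda>n. l2 lebesgue (\<lambda>x. d\<phi> n x - g x) + l2 lebesgue (\<lambda>x. d\<psi> n x - g' x)) \<longlonglongrightarrow> 0"
        using tendsto_add[OF lim(2) lim'(2)] by simp
      have "(\<lambda>x. d\<phi> n x - d\<psi> n x - (g x - g' x)) = (\<lambda>x. (d\<phi> n x - g x) - (d\<psi> n x - g' x))" for n by auto
      then show "\<forall>\<^sub>F n in sequentially. norm (l2 lebesgue (\<lambda>x. d\<phi> n x - d\<psi> n x - (g x - g' x)))
          \<le> l2 lebesgue (\<lambda>x. d\<phi> n x - g x) + l2 lebesgue (\<lambda>x. d\<psi> n x - g' x)"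
        using l2_diff_le[OF l2s_diff[OF s(2) l(2)] l2s_diff[OF s'(2) l']] by simp
    qed
  qed
  then show ?thesis by simp
qed

section \<open>The space H10\<close>

text \<open>The approximating functions vanish outside \<Omega>, and a subsequence of them converges
  almost everywhere. Integrals over \<Omega> may therefore be replaced by integrals over the whole
  space from here on.\<close>

lemma H10_grad_AE_zero:
  assumes "H10_grad \<Omega> u g"
  shows "AE x in lebesgue. x \<notin> \<Omega> \<longrightarrow> u x = 0" "AE x in lebesgue. x \<notin> \<Omega> \<longrightarrow> g x = 0"
proof -
  obtain \<phi> d\<phi> where C: "\<And>n. C1c_grad \<Omega> (\<phi> n) (d\<phi> n)" and l: "l2s lebesgue u" "l2s lebesgue g"
    and lim: "(\<lambda>n. l2 lebesgue (\<lambda>x. \<phi> n x - u x)) \<longlonglongrightarrow> 0" "(\<lambda>n. l2 lebesgue (\<lambda>x. d\<phi> n x - g x)) \<longlonglongrightarrow> 0"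
    using assms unfolding H10_grad_iff by blast
  have zero: "\<phi> n x = 0 \<and> d\<phi> n x = 0" if "x \<notin> \<Omega>" for n x
    using C1c_grad_support[OF C[of n]] that by (metis subsetD)
  obtain r :: "nat \<Rightarrow> nat" where "strict_mono r" "AE x in lebesgue. (\<lambda>n. \<phi> (r n) x) \<longlonglongrightarrow> u x"
    by (rule l2_AE_subseq[OF C1c_grad_l2s(1)[OF C] l(1) lim(1)])
  from this(2) show "AE x in lebesgue. x \<notin> \<Omega> \<longrightarrow> u x = 0"
  proof eventually_elim
    case (elim x)
    show ?case
    proof
      assume "x \<notin> \<Omega>"
      then have "(\<lambda>n. \<phi> (r n) x) = (\<lambda>n. 0)" using zero by blast
      then show "u x = 0" using elim by (simp add: LIMSEQ_const_iff)
    qed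
  qed
  obtain r :: "nat \<Rightarrow> nat" where "strict_mono r" "AE x in lebesgue. (\<lambda>n. d\<phi> (r n) x) \<longlonglongrightarrow> g x"
    by (rule l2_AE_subseq[OF C1c_grad_l2s(2)[OF C] l(2) lim(2)])
  from this(2) show "AE x in lebesgue. x \<notin> \<Omega> \<longrightarrow> g x = 0"
  proof eventually_elim
    case (elim x)
    show ?case
    proof
      assume "x \<notin> \<Omega>"
      then have "(\<lambda>n. d\<phi> (r n) x) = (\<lambda>n. 0)" using zero by blast
      then show "g x = 0" using elim by (simp add: LIMSEQ_const_iff)
    qed
  qed
qed

lemma set_lebesgue_integral_AE_zero:
  fixes f :: "'a::euclidean_space \<Rightarrow> real"
  assumes "open \<Omega>" "f \<in> borel_measurable lebesgue" "AE x in lebesgue. x \<notin> \<Omega> \<longrightarrow> f x = 0"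
  shows "(LINT x:\<Omega>|lebesgue. f x) = (\<integral>x. f x \<partial>lebesgue)"
proof -
  have "\<Omega> \<in> sets lebesgue" using assms(1) by (simp add: borel_open sets_completionI_sets)
  then have "(\<lambda>x. indicator \<Omega> x *\<^sub>R f x) \<in> borel_measurable lebesgue"
    using assms(2) by (intro borel_measurable_scaleR borel_measurable_indicator)
  moreover have "AE x in lebesgue. indicator \<Omega> x *\<^sub>R f x = f x"
    using assms(3) by eventually_elim (auto simp: indicator_def)
  ultimately show ?thesis
    unfolding set_lebesgue_integral_def using assms(2) by (intro integral_cong_AE)
qed

lemma H10_norm2_eq:
  assumes "H10_grad \<Omega> u g" "open \<Omega>"
  shows "H10_norm2 \<Omega> u = (l2 lebesgue g)\<^sup>2"
proof -
  define g' where "g' = (SOME g. H10_grad \<Omega> u g)"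
  have g': "H10_grad \<Omega> u g'" unfolding g'_def using someI[of "H10_grad \<Omega> u", OF assms(1)] .
  then have [measurable]: "g' \<in> borel_measurable lebesgue" by (simp add: H10_grad_def)
  have "H10_norm2 \<Omega> u = (LINT x:\<Omega>|lebesgue. (norm (g' x))\<^sup>2)"
    by (simp add: H10_norm2_def g'_def)
  also have "\<dots> = (\<integral>x. (norm (g' x))\<^sup>2 \<partial>lebesgue)"
  proof (rule set_lebesgue_integral_AE_zero[OF assms(2)])
    show "AE x in lebesgue. x \<notin> \<Omega> \<longrightarrow> (norm (g' x))\<^sup>2 = 0"
      using H10_grad_AE_zero(2)[OF g'] by eventually_elim simp
  qed measurable
  also have "\<dots> = (l2 lebesgue g')\<^sup>2" by (simp add: l2_square)
  also have "l2 lebesgue g' = l2 lebesgue g"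
    using H10_grad_unique[OF g' assms(1)] g' assms(1) by (intro l2_cong_AE) (simp_all add: H10_grad_def)
  finally show ?thesis .
qed

lemma H10_l2s: "u \<in> H10 \<Omega> \<Longrightarrow> l2s lebesgue u"
  by (auto simp: H10_def H10_grad_iff)

lemma H10_AE_zero: "u \<in> H10 \<Omega> \<Longrightarrow> AE x in lebesgue. x \<notin> \<Omega> \<longrightarrow> u x = 0"
  using H10_grad_AE_zero(1) by (auto simp: H10_def)

lemma H10_norm2_nonneg: "0 \<le> H10_norm2 \<Omega> u"
  unfolding H10_norm2_def set_lebesgue_integral_def by (intro integral_nonneg_AE) auto

lemma C1c_grad_H10:
  assumes "C1c_grad \<Omega> \<phi> g"
  shows "H10_grad \<Omega> \<phi> g"
  unfolding H10_grad_iff using assms C1c_grad_l2s[OF assms] 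
  by (intro conjI exI[of _ "\<lambda>_. \<phi>"] exI[of _ "\<lambda>_. g"]) (auto simp: l2_def)

lemma H10_approx:
  assumes "u \<in> H10 \<Omega>" "open \<Omega>" "e > 0"
  obtains \<phi> d\<phi> where "C1c_grad \<Omega> \<phi> d\<phi>" "l2 lebesgue (\<lambda>x. \<phi> x - u x) < e" "(l2 lebesgue d\<phi>)\<^sup>2 < H10_norm2 \<Omega> u + e"
proof -
  obtain g where g: "H10_grad \<Omega> u g" using assms(1) by (auto simp: H10_def)
  then obtain \<phi> d\<phi> where C: "\<And>n. C1c_grad \<Omega> (\<phi> n) (d\<phi> n)" and l: "l2s lebesgue u" "l2s lebesgue g"
    and lim: "(\<lambda>n. l2 lebesgue (\<lambda>x. \<phi> n x - u x)) \<longlonglongrightarrow> 0" "(\<lambda>n. l2 lebesgue (\<lambda>x. d\<phi> n x - g x)) \<longlonglongrightarrow> 0"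
    unfolding H10_grad_iff by blast
  have "(\<lambda>n. (l2 lebesgue (d\<phi> n))\<^sup>2) \<longlonglongrightarrow> (l2 lebesgue g)\<^sup>2"
    by (intro tendsto_power l2_tendsto_norm[OF C1c_grad_l2s(2)[OF C] l(2) lim(2)])
  then have "\<forall>\<^sub>F n in sequentially. (l2 lebesgue (d\<phi> n))\<^sup>2 < (l2 lebesgue g)\<^sup>2 + e"
    using assms(3) by (intro order_tendstoD) auto
  moreover have "\<forall>\<^sub>F n in sequentially. l2 lebesgue (\<lambda>x. \<phi> n x - u x) < e"
    using lim(1) assms(3) by (rule order_tendstoD)
  ultimately have "\<forall>\<^sub>F n in sequentially. (l2 lebesgue (d\<phi> n))\<^sup>2 < (l2 lebesgue g)\<^sup>2 + e \<and>
      l2 lebesgue (\<lambda>x. \<phi> n x - u x) < e"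
    by eventually_elim simp
  then obtain n where "(l2 lebesgue (d\<phi> n))\<^sup>2 < (l2 lebesgue g)\<^sup>2 + e" "l2 lebesgue (\<lambda>x. \<phi> n x - u x) < e"
    by (auto simp: eventually_sequentially)
  then show ?thesis using that[OF C[of n]] H10_norm2_eq[OF g assms(2)] by simp
qed

text \<open>Weak closedness of balls in \<open>H10\<close> without weak topologies: for the convex sets of \<open>C\<^sup>1\<close>
  functions close to \<open>u\<close>, near-minimizers of the Dirichlet energy form a Cauchy sequence by the
  parallelogram law.\<close>

lemma H10I_approx:
  fixes u :: "real^'n \<Rightarrow> real"
  assumes u: "l2s lebesgue u" and \<Omega>: "open \<Omega>"
    and approx: "\<And>e. e > 0 \<Longrightarrow> \<exists>\<phi> d\<phi>. C1c_grad \<Omega> \<phi> d\<phi> \<and> l2 lebesgue (\<lambda>x. \<phi> x - u x) < e \<and> (l2 lebesgue d\<phi>)\<^sup>2 < c + e"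
  shows "u \<in> H10 \<Omega>" "H10_norm2 \<Omega> u \<le> c"
proof -
  define \<epsilon> where "\<epsilon> n = inverse (real (Suc n))" for n
  have \<epsilon>_lim: "\<epsilon> \<longlonglongrightarrow> 0" unfolding \<epsilon>_def[abs_def] by (rule LIMSEQ_inverse_real_of_nat)
  have \<epsilon>_pos: "\<epsilon> n > 0" for n by (simp add: \<epsilon>_def)
  define K where "K n = {(\<phi>, d\<phi>). C1c_grad \<Omega> \<phi> d\<phi> \<and> l2 lebesgue (\<lambda>x. \<phi> x - u x) < \<epsilon> n}" for n
  define E where "E n = (\<lambda>(\<phi> :: real^'n \<Rightarrow> real, d\<phi> :: real^'n \<Rightarrow> real^'n). (l2 lebesgue d\<phi>)\<^sup>2) ` K n" for n
  have bdd: "bdd_below (E n)" for n unfolding E_def by (rule bdd_belowI[of _ 0]) auto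
  have ne: "E n \<noteq> {}" for n
    using approx[OF \<epsilon>_pos[of n]] by (auto simp: E_def K_def)
  have Inf_le: "Inf (E n) \<le> c" for n
  proof (rule field_le_epsilon)
    fix e :: real assume "e > 0"
    then obtain \<phi> d\<phi> where *: "C1c_grad \<Omega> \<phi> d\<phi>" "l2 lebesgue (\<lambda>x. \<phi> x - u x) < min e (\<epsilon> n)"
      "(l2 lebesgue d\<phi>)\<^sup>2 < c + min e (\<epsilon> n)"
      using approx[of "min e (\<epsilon> n)"] \<epsilon>_pos[of n] by auto
    then have "(l2 lebesgue d\<phi>)\<^sup>2 \<in> E n" by (force simp: E_def K_def)
    then have "Inf (E n) \<le> (l2 lebesgue d\<phi>)\<^sup>2" using bdd by (rule cInf_lower)
    then show "Inf (E n) \<le> c + e" using *(3) by auto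
  qed
  have "\<exists>p\<in>K n. (l2 lebesgue (snd p))\<^sup>2 < Inf (E n) + \<epsilon> n" for n
  proof -
    have "Inf (E n) < Inf (E n) + \<epsilon> n" using \<epsilon>_pos by simp
    from cInf_lessD[OF ne this] obtain y where "y \<in> E n" "y < Inf (E n) + \<epsilon> n" by blast
    moreover from this(1) obtain p where "p \<in> K n" "y = (l2 lebesgue (snd p))\<^sup>2" unfolding E_def by auto
    ultimately show ?thesis by blast
  qed
  then obtain p where p: "\<And>n. p n \<in> K n" "\<And>n. (l2 lebesgue (snd (p n)))\<^sup>2 < Inf (E n) + \<epsilon> n"
    by metis
  define \<phi> where "\<phi> n = fst (p n)" for n
  define d\<phi> where "d\<phi> n = snd (p n)" for n
  have C: "C1c_grad \<Omega> (\<phi> n) (d\<phi> n)" and close: "l2 lebesgue (\<lambda>x. \<phi> n x - u x) < \<epsilon> n"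
    and en: "(l2 lebesgue (d\<phi> n))\<^sup>2 < Inf (E n) + \<epsilon> n" for n
    using p[of n] by (auto simp: K_def \<phi>_def d\<phi>_def split_beta)
  note s = C1c_grad_l2s[OF C]
  have inv_mono: "\<epsilon> m \<le> \<epsilon> n" if "n \<le> m" for m n
    using that by (simp add: \<epsilon>_def le_imp_inverse_le)
  have KK: "K m \<subseteq> K n" if "n \<le> m" for m n
    using less_le_trans[OF _ inv_mono[OF that]] unfolding K_def by blast
  have mono: "Inf (E n) \<le> Inf (E m)" if "n \<le> m" for m n
    using KK[OF that] by (intro cInf_superset_mono ne bdd) (auto simp: E_def)
  \<comment> \<open>The sets \<open>K n\<close> shrink, so the infima increase; they are bounded
    above by \<open>c\<close>.\<close>
  have "\<exists>L. (\<lambda>n. Inf (E n)) \<longlonglongrightarrow> L"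
  proof -
    have "Bseq (\<lambda>n. Inf (E n))"
    proof (rule BseqI')
      fix n
      have "0 \<le> Inf (E n)" by (intro cInf_greatest ne) (auto simp: E_def)
      then show "norm (Inf (E n)) \<le> c" using Inf_le[of n] by simp
    qed
    moreover have "monoseq (\<lambda>n. Inf (E n))" using mono by (auto simp: monoseq_def)
    ultimately show ?thesis using Bseq_monoseq_convergent by (auto simp: convergent_def)
  qed
  then obtain L where L: "(\<lambda>n. Inf (E n)) \<longlonglongrightarrow> L" by blast
  have L_ge: "Inf (E n) \<le> L" for n
    using L mono by (intro LIMSEQ_le_const[OF L]) auto
  \<comment> \<open>By convexity the midpoint lies in \<open>K n\<close>, so its energy is at least
    \<open>Inf (E n)\<close>. In the parallelogram law the two energies are at most
    \<open>Inf (E n) + \<epsilon> n\<close> and \<open>L + \<epsilon> n\<close>, which leaves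
    exactly the right-hand side.\<close>
  have dist: "(l2 lebesgue (\<lambda>x. d\<phi> n x - d\<phi> m x))\<^sup>2 \<le> 2 * (L - Inf (E n)) + 4 * \<epsilon> n" if "n \<le> m" for n m
  proof -
    define \<psi> where "\<psi> x = (1/2) * (\<phi> n x + \<phi> m x)" for x
    define d\<psi> where "d\<psi> x = (1/2) *\<^sub>R (d\<phi> n x + d\<phi> m x)" for x
    have "C1c_grad \<Omega> \<psi> d\<psi>"
      unfolding \<psi>_def[abs_def] d\<psi>_def[abs_def] by (intro C1c_grad_cmult C1c_grad_add C)
    moreover have "l2 lebesgue (\<lambda>x. \<psi> x - u x) < \<epsilon> n"
    proof -
      have "(\<lambda>x. \<psi> x - u x) = (\<lambda>x. (1/2) *\<^sub>R ((\<phi> n x - u x) + (\<phi> m x - u x)))"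
        by (auto simp: \<psi>_def field_simps)
      then have "l2 lebesgue (\<lambda>x. \<psi> x - u x) \<le> (1/2) * (l2 lebesgue (\<lambda>x. \<phi> n x - u x) + l2 lebesgue (\<lambda>x. \<phi> m x - u x))"
        using l2_triangle[OF l2s_diff[OF s(1)[of n] u] l2s_diff[OF s(1)[of m] u]] by (simp only: l2_scaleR) simp
      moreover have "s < c" if "s \<le> 1/2 * (a + b)" "a < c" "b < d" "d \<le> c" for a b c d s :: real
        using that by argo
      ultimately show ?thesis using close[of n] close[of m] inv_mono[OF that] by blast
    qed
    ultimately have "(l2 lebesgue d\<psi>)\<^sup>2 \<in> E n" by (force simp: E_def K_def)
    then have "Inf (E n) \<le> (l2 lebesgue d\<psi>)\<^sup>2" using bdd by (rule cInf_lower)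
    also have "l2 lebesgue d\<psi> = (1/2) * l2 lebesgue (\<lambda>x. d\<phi> n x + d\<phi> m x)"
      unfolding d\<psi>_def[abs_def] by (simp only: l2_scaleR)
    finally have "4 * Inf (E n) \<le> (l2 lebesgue (\<lambda>x. d\<phi> n x + d\<phi> m x))\<^sup>2"
      by (simp add: power_divide)
    then show ?thesis
      using l2_parallelogram[OF s(2)[of n] s(2)[of m]] en[of n] en[of m] L_ge[of m] inv_mono[OF that]
      by argo
  qed
  have lim0: "(\<lambda>n. 2 * (L - Inf (E n)) + 4 * \<epsilon> n) \<longlonglongrightarrow> 2 * (L - L) + 4 * 0"
    by (intro tendsto_intros L \<epsilon>_lim)
  have cauchy: "\<exists>K. \<forall>m\<ge>K. \<forall>n\<ge>K. l2 lebesgue (\<lambda>x. d\<phi> m x - d\<phi> n x) < e" if "e > 0" for e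
  proof -
    have "\<forall>\<^sub>F n in sequentially. 2 * (L - Inf (E n)) + 4 * \<epsilon> n < (e/2)\<^sup>2"
      using lim0 that by (intro order_tendstoD) auto
    then obtain K where K: "2 * (L - Inf (E K)) + 4 * \<epsilon> K < (e/2)\<^sup>2"
      by (auto simp: eventually_sequentially)
    have *: "l2 lebesgue (\<lambda>x. d\<phi> K x - d\<phi> m x) < e/2" if "m \<ge> K" for m
      using dist[OF that] K \<open>e > 0\<close> by (intro power2_less_imp_less[of _ "e/2"]) auto
    have "l2 lebesgue (\<lambda>x. d\<phi> m x - d\<phi> n x) < e" if "m \<ge> K" "n \<ge> K" for m n
      using l2_diff_triangle[OF s(2)[of m] s(2)[of K] s(2)[of n]] *[OF that(1)] *[OF that(2)]
        l2_commute[of lebesgue "d\<phi> m" "d\<phi> K"] by linarith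
    then show ?thesis by blast
  qed
  obtain g where g: "l2s lebesgue g" "(\<lambda>n. l2 lebesgue (\<lambda>x. d\<phi> n x - g x)) \<longlonglongrightarrow> 0"
    using l2_complete[OF s(2) cauchy] by blast
  have "(\<lambda>n. l2 lebesgue (\<lambda>x. \<phi> n x - u x)) \<longlonglongrightarrow> 0"
    using close by (intro Lim_null_comparison[OF _ \<epsilon>_lim]) (auto intro!: always_eventually less_imp_le)
  then have grad: "H10_grad \<Omega> u g" unfolding H10_grad_iff using u g C by blast
  then show "u \<in> H10 \<Omega>" by (auto simp: H10_def)
  have "(\<lambda>n. (l2 lebesgue (d\<phi> n))\<^sup>2) \<longlonglongrightarrow> (l2 lebesgue g)\<^sup>2"
    by (intro tendsto_power l2_tendsto_norm[OF s(2) g])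
  moreover have "(\<lambda>n. c + \<epsilon> n) \<longlonglongrightarrow> c + 0"
    by (intro tendsto_intros \<epsilon>_lim)
  moreover have "(l2 lebesgue (d\<phi> n))\<^sup>2 \<le> c + \<epsilon> n" for n
    using en[of n] Inf_le[of n] by linarith
  ultimately have "(l2 lebesgue g)\<^sup>2 \<le> c + 0"
    by (intro LIMSEQ_le) auto
  then show "H10_norm2 \<Omega> u \<le> c" using H10_norm2_eq[OF grad \<Omega>] by simp
qed

text \<open>A \<open>C1c_grad\<close> function close to a late \<open>un n\<close> is also close to
  \<open>u\<close>, with nearly the same energy. The bound is only asymptotic so that
  \<open>c\<close> can be the limit of the energies along a subsequence.\<close>

lemma H10_norm2_lsc:
  assumes \<Omega>: "open \<Omega>" and un: "\<And>n. un n \<in> H10 \<Omega>" and bound: "\<And>e. e > 0 \<Longrightarrow> \<forall>\<^sub>F n in sequentially. H10_norm2 \<Omega> (un n) \<le> c + e"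
    and u: "l2s lebesgue u" and lim: "(\<lambda>n. l2 lebesgue (\<lambda>x. un n x - u x)) \<longlonglongrightarrow> 0"
  shows "u \<in> H10 \<Omega>" "H10_norm2 \<Omega> u \<le> c"
proof -
  have "\<exists>\<phi> d\<phi>. C1c_grad \<Omega> \<phi> d\<phi> \<and> l2 lebesgue (\<lambda>x. \<phi> x - u x) < e \<and> (l2 lebesgue d\<phi>)\<^sup>2 < c + e" if "e > 0" for e
  proof -
    have "\<forall>\<^sub>F n in sequentially. l2 lebesgue (\<lambda>x. un n x - u x) < e/2"
      using lim that by (intro order_tendstoD) auto
    with bound[of "e/2"] that have "\<forall>\<^sub>F n in sequentially. l2 lebesgue (\<lambda>x. un n x - u x) < e/2 \<and> H10_norm2 \<Omega> (un n) \<le> c + e/2"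
      by (simp add: eventually_conj_iff)
    then obtain n where n: "l2 lebesgue (\<lambda>x. un n x - u x) < e/2" "H10_norm2 \<Omega> (un n) \<le> c + e/2"
      by (auto simp: eventually_sequentially)
    have e2: "e/2 > 0" using that by simp
    obtain \<phi> d\<phi> where \<phi>: "C1c_grad \<Omega> \<phi> d\<phi>" "l2 lebesgue (\<lambda>x. \<phi> x - un n x) < e/2" "(l2 lebesgue d\<phi>)\<^sup>2 < H10_norm2 \<Omega> (un n) + e/2"
      by (rule H10_approx[OF un[of n] \<Omega> e2])
    have "l2 lebesgue (\<lambda>x. \<phi> x - u x) < e"
      using l2_diff_triangle[OF C1c_grad_l2s(1)[OF \<phi>(1)] H10_l2s[OF un] u, of n] \<phi>(2) n(1) by linarith
    moreover have "(l2 lebesgue d\<phi>)\<^sup>2 < c + e" using \<phi>(3) n(2) by linarith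
    ultimately show ?thesis using \<phi>(1) by blast
  qed
  from H10I_approx[OF u \<Omega> this] show "u \<in> H10 \<Omega>" "H10_norm2 \<Omega> u \<le> c" by simp_all
qed

section \<open>Rellich's theorem\<close>

lemma l2_translate:
  fixes f :: "'a::euclidean_space \<Rightarrow> 'b::euclidean_space"
  assumes "continuous_on UNIV f"
  shows "l2 lebesgue (\<lambda>x. f (x + a)) = l2 lebesgue f"
proof -
  have "(\<lambda>x. (norm (f x))\<^sup>2) \<in> borel_measurable borel"
    using borel_measurable_continuous_onI[OF assms] by measurable
  from lebesgue_integral_translate[OF this, of a] show ?thesis by (simp add: l2_def)
qed

text \<open>Telescoping along \<open>k\<close> equal steps bounds the increment by \<open>k\<close> times the increment over one
  step, which tends to the norm of the directional derivative.\<close>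

lemma C1c_grad_translation_estimate:
  assumes C: "C1c_grad \<Omega> \<phi> g"
  shows "l2 lebesgue (\<lambda>x. \<phi> (x + z) - \<phi> x) \<le> norm z * l2 lebesgue g"
proof -
  have Ct: "C1c_grad UNIV (\<lambda>x. \<phi> (x + a)) (\<lambda>x. g (x + a))" for a by (rule C1c_grad_translate[OF C])
  have st: "l2s lebesgue (\<lambda>x. \<phi> (x + a))" for a by (rule C1c_grad_l2s(1)[OF Ct])
  have s: "l2s lebesgue \<phi>" by (rule C1c_grad_l2s(1)[OF C])
  have step: "l2 lebesgue (\<lambda>x. \<phi> (x + real k *\<^sub>R w) - \<phi> x) \<le> real k * l2 lebesgue (\<lambda>x. \<phi> (x + w) - \<phi> x)" for k w
  proof (induction k)
    case 0
    show ?case by (simp add: l2_def)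
  next
    case (Suc k)
    have "continuous_on UNIV (\<lambda>x. \<phi> (x + w) - \<phi> x)"
      by (intro continuous_intros C1c_grad_continuous(1)[OF Ct] C1c_grad_continuous(1)[OF C])
    from l2_translate[OF this, of "real k *\<^sub>R w"]
    have "l2 lebesgue (\<lambda>x. \<phi> (x + real (Suc k) *\<^sub>R w) - \<phi> (x + real k *\<^sub>R w)) = l2 lebesgue (\<lambda>x. \<phi> (x + w) - \<phi> x)"
      by (simp add: algebra_simps)
    with l2_diff_triangle[OF st st s, of "real (Suc k) *\<^sub>R w" "real k *\<^sub>R w"] Suc
    show ?case by (simp add: algebra_simps)
  qed
  have "l2 lebesgue (\<lambda>x. \<phi> (x + z) - \<phi> x) \<le> l2 lebesgue (diff_quotient \<phi> z j)" for j
  proof -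
    have "l2 lebesgue (diff_quotient \<phi> z j) = real (Suc j) * l2 lebesgue (\<lambda>x. \<phi> (x + inverse (real (Suc j)) *\<^sub>R z) - \<phi> x)"
      using l2_scaleR[of lebesgue "real (Suc j)" "\<lambda>x. \<phi> (x + inverse (real (Suc j)) *\<^sub>R z) - \<phi> x"]
      unfolding diff_quotient_def[abs_def] by simp
    then show ?thesis
      using step[of "Suc j" "inverse (real (Suc j)) *\<^sub>R z"] by (simp del: of_nat_Suc)
  qed
  moreover have "(\<lambda>j. l2 lebesgue (diff_quotient \<phi> z j)) \<longlonglongrightarrow> l2 lebesgue (\<lambda>x. g x \<bullet> z)"
  proof (rule l2_tendsto_norm)
    show "l2s lebesgue (diff_quotient \<phi> z j)" for j
      using C1c_grad_diff_quotient[OF C] C1c_grad_l2s by blast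
  qed (rule l2s_inner_const(1)[OF C1c_grad_l2s(2)[OF C]] diff_quotient_tendsto[OF C])+
  ultimately have "l2 lebesgue (\<lambda>x. \<phi> (x + z) - \<phi> x) \<le> l2 lebesgue (\<lambda>x. g x \<bullet> z)"
    by (intro LIMSEQ_le_const) auto
  also have "\<dots> \<le> norm z * l2 lebesgue g" by (rule l2s_inner_const(2)[OF C1c_grad_l2s(2)[OF C]])
  finally show ?thesis .
qed

section \<open>Averages over the cells of a cubic grid\<close>

definition same_cell :: "real \<Rightarrow> 'a::euclidean_space \<Rightarrow> 'a \<Rightarrow> bool" where
  "same_cell h x y \<longleftrightarrow> (\<forall>b\<in>Basis. \<lfloor>x \<bullet> b / h\<rfloor> = \<lfloor>y \<bullet> b / h\<rfloor>)"

text \<open>The partition into half-open cubes is encoded as a relation, not as an indexed family of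
  sets: measurability in both points jointly is what Fubini's theorem will require.\<close>

lemma measurable_same_cell [measurable]:
  assumes [measurable]: "f \<in> borel_measurable N" "g \<in> borel_measurable N"
  shows "Measurable.pred N (\<lambda>x. same_cell h (f x) (g x :: 'a::euclidean_space))"
  unfolding same_cell_def by (intro pred_intros_finite) measurable

lemma same_cell_bounds:
  assumes "h > 0" "b \<in> Basis" "same_cell h x y"
  shows "\<bar>x \<bullet> b - y \<bullet> b\<bar> < h"
proof -
  have "\<lfloor>x \<bullet> b / h\<rfloor> = \<lfloor>y \<bullet> b / h\<rfloor>" using assms by (simp add: same_cell_def)
  then have "\<bar>x \<bullet> b / h - y \<bullet> b / h\<bar> < 1" by linarith
  then have "\<bar>(x \<bullet> b - y \<bullet> b) / h\<bar> < 1" by (simp add: diff_divide_distrib)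
  then show ?thesis using assms(1) by (simp add: abs_divide field_simps)
qed

definition cell_corner :: "real \<Rightarrow> 'a::euclidean_space \<Rightarrow> 'a" where
  "cell_corner h x = (\<Sum>b\<in>Basis. (h * of_int \<lfloor>x \<bullet> b / h\<rfloor>) *\<^sub>R b)"

lemma cell_corner_inner: "b \<in> Basis \<Longrightarrow> cell_corner h x \<bullet> b = h * of_int \<lfloor>x \<bullet> b / h\<rfloor>"
  by (simp add: cell_corner_def)

lemma same_cell_iff:
  assumes "h > 0"
  shows "same_cell h x y \<longleftrightarrow> (\<forall>b\<in>Basis. cell_corner h x \<bullet> b \<le> y \<bullet> b \<and> y \<bullet> b < cell_corner h x \<bullet> b + h)"
proof -
  have "\<lfloor>y \<bullet> b / h\<rfloor> = k \<longleftrightarrow> h * of_int k \<le> y \<bullet> b \<and> y \<bullet> b < h * of_int k + h" for b k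
    using assms by (simp add: floor_eq_iff field_simps)
  then show ?thesis
    unfolding same_cell_def by (auto simp: cell_corner_inner eq_commute[of "\<lfloor>x \<bullet> _ / h\<rfloor>"])
qed

text \<open>The half-open cube lies between the open and the closed box with the same corners, which
  have equal measure.\<close>

lemma emeasure_cell:
  fixes x :: "'a::euclidean_space"
  assumes "h > 0"
  shows "emeasure lborel {y. same_cell h x y} = ennreal (h ^ DIM('a))"
proof -
  let ?a = "cell_corner h x" and ?b = "cell_corner h x + h *\<^sub>R One"
  have le: "?a \<bullet> b \<le> ?b \<bullet> b" if "b \<in> Basis" for b using assms that by (simp add: inner_add_left)
  have m: "{y. same_cell h x y} \<in> sets lborel" by measurable
  have pr: "(\<Prod>b\<in>Basis. (?b - ?a) \<bullet> b) = h ^ DIM('a)" by simp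
  have "box ?a ?b \<subseteq> {y. same_cell h x y}"
    using assms by (auto simp: same_cell_iff mem_box inner_add_left less_imp_le)
  then have "ennreal (h ^ DIM('a)) \<le> emeasure lborel {y. same_cell h x y}"
    using emeasure_mono[OF _ m, of "box ?a ?b"] le by (simp only: emeasure_lborel_box[OF le] pr)
  moreover have "{y. same_cell h x y} \<subseteq> cbox ?a ?b"
    using assms by (auto simp: same_cell_iff mem_box inner_add_left less_imp_le)
  then have "emeasure lborel {y. same_cell h x y} \<le> ennreal (h ^ DIM('a))"
    using emeasure_mono[of _ "cbox ?a ?b" lborel] le by (simp add: emeasure_lborel_cbox_eq pr)
  ultimately show ?thesis by (rule antisym[rotated])
qed

definition cell_integral :: "real \<Rightarrow> ('a::euclidean_space \<Rightarrow> real) \<Rightarrow> 'a \<Rightarrow> real" where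
  "cell_integral h f x = (\<integral>y. of_bool (same_cell h x y) * f y \<partial>lborel)"

lemma l2s_cell:
  fixes x :: "'a::euclidean_space"
  assumes "h > 0"
  shows "l2s lborel (\<lambda>y. of_bool (same_cell h x y) :: real)"
    "(l2 lborel (\<lambda>y. of_bool (same_cell h x y) :: real))\<^sup>2 = h ^ DIM('a)"
proof -
  have *: "(norm (of_bool (same_cell h x y) :: real))\<^sup>2 = indicator {y. same_cell h x y} y" for y
    by (simp add: indicator_def)
  have m: "{y. same_cell h x y} \<in> sets lborel" by measurable
  show "l2s lborel (\<lambda>y. of_bool (same_cell h x y) :: real)"
    unfolding l2s_def * using emeasure_cell[OF assms, of x] m by (auto intro!: integrable_real_indicator)
  show "(l2 lborel (\<lambda>y. of_bool (same_cell h x y) :: real))\<^sup>2 = h ^ DIM('a)"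
    unfolding l2_square * using emeasure_cell[OF assms, of x] m assms by (simp add: measure_def)
qed

lemma cell_integral_bound:
  fixes f :: "'a::euclidean_space \<Rightarrow> real"
  assumes "h > 0" "l2s lborel f"
  shows "\<bar>cell_integral h f x\<bar> \<le> sqrt (h ^ DIM('a)) * l2 lborel f"
proof -
  have "l2 lborel (\<lambda>y. of_bool (same_cell h x y) :: real) = sqrt (h ^ DIM('a))"
    using l2s_cell(2)[OF assms(1), of x] by (metis l2_nonneg real_sqrt_unique)
  then show ?thesis
    using l2_Cauchy_Schwarz[OF l2s_cell(1)[OF assms(1)] assms(2), of x] by (simp add: cell_integral_def)
qed

text \<open>The error at \<open>x\<close> is the average of \<open>f x - f y\<close> over the cell.
  Cauchy--Schwarz against the indicator of the cell bounds its square by the average of the squares;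
  \<open>h ^ DIM('a)\<close> is the volume of the cell.\<close>

lemma cell_average_pointwise:
  fixes f :: "'a::euclidean_space \<Rightarrow> real"
  assumes h: "h > 0" and f: "l2s lborel f"
  shows "ennreal ((f x - cell_integral h f x / h ^ DIM('a))\<^sup>2) \<le>
    ennreal (1 / h ^ DIM('a)) * (\<integral>\<^sup>+y. of_bool (same_cell h x y) * ennreal ((f x - f y)\<^sup>2) \<partial>lborel)"
proof -
  let ?V = "h ^ DIM('a)" and ?S = "\<lambda>y. of_bool (same_cell h x y) :: real"
  let ?G = "\<lambda>y. ?S y * (f x - f y)"
  have V: "?V > 0" using h by simp
  note [measurable] = l2s_measurable[OF f]
  have S: "l2s lborel ?S" by (rule l2s_cell(1)[OF h])
  have iS: "integrable lborel ?S" "(\<integral>y. ?S y \<partial>lborel) = ?V"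
  proof -
    have "(norm (?S y))\<^sup>2 = ?S y" for y by auto
    then show "integrable lborel ?S" "(\<integral>y. ?S y \<partial>lborel) = ?V"
      using S l2s_cell(2)[OF h, of x] unfolding l2s_def l2_square by simp_all
  qed
  have iSf: "integrable lborel (\<lambda>y. ?S y * f y)" using l2s_inner[OF S f] by simp
  have G: "l2s lborel ?G"
  proof -
    have "l2s lborel (\<lambda>y. ?S y * f y)"
      unfolding l2s_def
    proof
      show "integrable lborel (\<lambda>y. (norm (?S y * f y))\<^sup>2)"
        by (rule Bochner_Integration.integrable_bound[of _ "\<lambda>y. (norm (f y))\<^sup>2"]) (use f in \<open>auto simp: l2s_def\<close>)
    qed measurable
    from l2s_diff[OF l2s_scaleR[OF S, of "f x"] this] show ?thesis by (simp add: algebra_simps)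
  qed
  have "(\<integral>y. ?S y * ?G y \<partial>lborel) = (\<integral>y. f x * ?S y - ?S y * f y \<partial>lborel)"
    by (intro Bochner_Integration.integral_cong) (auto simp: algebra_simps)
  also have "\<dots> = f x * ?V - cell_integral h f x"
    using iS iSf by (simp add: cell_integral_def)
  finally have "\<bar>f x * ?V - cell_integral h f x\<bar> \<le> l2 lborel ?S * l2 lborel ?G"
    using l2_Cauchy_Schwarz[OF S G] by simp
  then have "(f x * ?V - cell_integral h f x)\<^sup>2 \<le> ?V * (l2 lborel ?G)\<^sup>2"
    using power_mono[of "\<bar>f x * ?V - cell_integral h f x\<bar>" "l2 lborel ?S * l2 lborel ?G" 2] l2s_cell(2)[OF h, of x]
    by (simp add: power_mult_distrib)
  moreover have "(f x - cell_integral h f x / ?V)\<^sup>2 = (f x * ?V - cell_integral h f x)\<^sup>2 / ?V\<^sup>2"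
    using h by (simp add: power_divide[symmetric] diff_divide_distrib)
  ultimately have "(f x - cell_integral h f x / ?V)\<^sup>2 \<le> ?V * (l2 lborel ?G)\<^sup>2 / ?V\<^sup>2"
    by (simp add: divide_right_mono)
  also have "\<dots> = 1 / ?V * (l2 lborel ?G)\<^sup>2" using V by (simp add: power2_eq_square)
  finally have "ennreal ((f x - cell_integral h f x / ?V)\<^sup>2) \<le> ennreal (1 / ?V) * ennreal ((l2 lborel ?G)\<^sup>2)"
    using V by (simp add: ennreal_mult[symmetric] ennreal_leI)
  also have "ennreal ((l2 lborel ?G)\<^sup>2) = (\<integral>\<^sup>+y. of_bool (same_cell h x y) * ennreal ((f x - f y)\<^sup>2) \<partial>lborel)"
    unfolding nn_integral_l2[OF G, symmetric] by (intro nn_integral_cong) auto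
  finally show ?thesis .
qed

lemma nn_integral_lborel_translate:
  fixes f :: "'a::euclidean_space \<Rightarrow> ennreal"
  assumes [measurable]: "f \<in> borel_measurable borel"
  shows "(\<integral>\<^sup>+x. f (a + x) \<partial>lborel) = (\<integral>\<^sup>+x. f x \<partial>lborel)"
proof -
  have "(\<integral>\<^sup>+x. f x \<partial>lborel) = (\<integral>\<^sup>+x. f x \<partial>(distr lborel borel ((+) a)))"
    by (simp add: lborel_distr_plus)
  also have "\<dots> = (\<integral>\<^sup>+x. f (a + x) \<partial>lborel)"
    by (rule nn_integral_distr) simp_all
  finally show ?thesis by simp
qed

lemma l2_lebesgue_eq_lborel: "f \<in> borel_measurable borel \<Longrightarrow> l2 lebesgue f = l2 lborel f"
  unfolding l2_def by (subst integral_completion) auto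

lemma l2s_lebesgue_eq_lborel: "f \<in> borel_measurable borel \<Longrightarrow> l2s lebesgue f \<longleftrightarrow> l2s lborel f"
  unfolding l2s_def by (subst integrable_completion) (auto intro: measurable_completion)

lemma measurable_cell_integral [measurable]:
  assumes [measurable]: "f \<in> borel_measurable borel"
  shows "cell_integral h f \<in> borel_measurable borel"
  unfolding cell_integral_def[abs_def] by measurable

text \<open>The pointwise bound is integrated, \<open>y = x + z\<close> is substituted and the
  integrals are exchanged. What remains for each displacement \<open>z\<close> is the squared norm
  of a translation increment of \<phi>, controlled by \<open>norm z * l2 lebesgue g\<close>. The
  essential point is that the bound tends to 0 with \<open>h\<close>, uniformly for bounded
  gradients.\<close>

lemma cell_average_estimate:
  fixes \<phi> :: "real^'n \<Rightarrow> real" and h :: real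
  assumes C: "C1c_grad \<Omega> \<phi> g" and h: "h > 0"
  shows "l2 lborel (\<lambda>x. \<phi> x - cell_integral h \<phi> x / h ^ CARD('n)) \<le> sqrt (2 ^ CARD('n)) * (CARD('n) * h) * l2 lebesgue g"
    "l2s lborel (\<lambda>x. \<phi> x - cell_integral h \<phi> x / h ^ CARD('n))"
proof -
  let ?N = "CARD('n)" 
  have m\<phi> [measurable]: "\<phi> \<in> borel_measurable borel"
    by (rule borel_measurable_continuous_onI[OF C1c_grad_continuous(1)[OF C]])
  have s: "l2s lborel \<phi>" using C1c_grad_l2s(1)[OF C] l2s_lebesgue_eq_lborel[OF m\<phi>] by simp
  \<comment> \<open>Points of a common cell differ by less than \<open>h\<close> in each coordinate,
    so only displacements in this cube count. Its volume \<open>(2 * h) ^ CARD('n)\<close>, divided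
    by that of a cell, is the origin of the factor \<open>2 ^ CARD('n)\<close>; the factor
    \<open>CARD('n) * h\<close> bounds \<open>norm z\<close>.\<close>
  define Q where "Q = cbox (- h *\<^sub>R One) (h *\<^sub>R One :: real^'n)"
  have [measurable]: "Q \<in> sets borel" by (simp add: Q_def)
  have Q: "norm z \<le> ?N * h" if "z \<in> Q" for z
  proof -
    have "norm z \<le> (\<Sum>b\<in>Basis. \<bar>z \<bullet> b\<bar>)" by (rule norm_le_l1)
    also have "\<dots> \<le> (\<Sum>b\<in>(Basis :: (real^'n) set). h)"
      using that by (intro sum_mono) (auto simp: Q_def mem_box abs_le_iff)
    finally show ?thesis by simp
  qed
  have emQ: "emeasure lborel Q = ennreal ((2 * h) ^ ?N)"
  proof -
    have "(\<Prod>b\<in>Basis. (h *\<^sub>R One - (- h *\<^sub>R One :: real^'n)) \<bullet> b) = (\<Prod>b\<in>(Basis :: (real^'n) set). 2 * h)"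
      unfolding inner_diff_left inner_scaleR_left by (intro prod.cong) auto
    then have pr: "(\<Prod>b\<in>Basis. (h *\<^sub>R One - (- h *\<^sub>R One :: real^'n)) \<bullet> b) = (2 * h) ^ ?N"
      by (simp only: prod_constant DIM_cart DIM_real mult_1_right)
    have "(- h *\<^sub>R One :: real^'n) \<bullet> b \<le> (h *\<^sub>R One) \<bullet> b" if "b \<in> Basis" for b
      using h that by simp
    from emeasure_lborel_cbox[OF this] show ?thesis unfolding Q_def pr .
  qed
  have "(\<integral>\<^sup>+x. ennreal ((norm (\<phi> x - cell_integral h \<phi> x / h ^ ?N))\<^sup>2) \<partial>lborel) \<le>
      (\<integral>\<^sup>+x. ennreal (1 / h ^ ?N) * (\<integral>\<^sup>+y. of_bool (same_cell h x y) * ennreal ((\<phi> x - \<phi> y)\<^sup>2) \<partial>lborel) \<partial>lborel)"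
    using cell_average_pointwise[OF h s] by (intro nn_integral_mono) simp
  also have "\<dots> = ennreal (1 / h ^ ?N) * (\<integral>\<^sup>+x. \<integral>\<^sup>+y. of_bool (same_cell h x y) * ennreal ((\<phi> x - \<phi> y)\<^sup>2) \<partial>lborel \<partial>lborel)"
    by (rule nn_integral_cmult) measurable
  also have "(\<integral>\<^sup>+x. \<integral>\<^sup>+y. of_bool (same_cell h x y) * ennreal ((\<phi> x - \<phi> y)\<^sup>2) \<partial>lborel \<partial>lborel) =
      (\<integral>\<^sup>+x. \<integral>\<^sup>+z. of_bool (same_cell h x (x + z)) * ennreal ((\<phi> x - \<phi> (x + z))\<^sup>2) \<partial>lborel \<partial>lborel)"
    by (intro nn_integral_cong nn_integral_lborel_translate[symmetric]) measurable
  also have "\<dots> \<le> (\<integral>\<^sup>+x. \<integral>\<^sup>+z. indicator Q z * ennreal ((\<phi> (x + z) - \<phi> x)\<^sup>2) \<partial>lborel \<partial>lborel)"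
  proof (intro nn_integral_mono)
    fix x z :: "real^'n"
    have "z \<in> Q" if "same_cell h x (x + z)"
      using same_cell_bounds[OF h _ that] by (auto simp: Q_def mem_box inner_add_left abs_less_iff less_imp_le)
        (metis add.inverse_inverse less_imp_le neg_less_iff_less)
    then show "of_bool (same_cell h x (x + z)) * ennreal ((\<phi> x - \<phi> (x + z))\<^sup>2) \<le> indicator Q z * ennreal ((\<phi> (x + z) - \<phi> x)\<^sup>2)"
      by (auto simp: power2_commute)
  qed
  also have "\<dots> = (\<integral>\<^sup>+z. \<integral>\<^sup>+x. indicator Q z * ennreal ((\<phi> (x + z) - \<phi> x)\<^sup>2) \<partial>lborel \<partial>lborel)"
    by (rule lborel_pair.Fubini') measurable
  also have "\<dots> \<le> (\<integral>\<^sup>+z. indicator Q z * ennreal ((?N * h * l2 lebesgue g)\<^sup>2) \<partial>lborel)"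
  proof (intro nn_integral_mono)
    fix z :: "real^'n"
    have m: "(\<lambda>x. \<phi> (x + z) - \<phi> x) \<in> borel_measurable borel" by measurable
    have sz: "l2s lborel (\<lambda>x. \<phi> (x + z) - \<phi> x)"
      using l2s_diff[OF C1c_grad_l2s(1)[OF C1c_grad_translate[OF C]] C1c_grad_l2s(1)[OF C]] l2s_lebesgue_eq_lborel[OF m] by blast
    have "(\<integral>\<^sup>+x. indicator Q z * ennreal ((\<phi> (x + z) - \<phi> x)\<^sup>2) \<partial>lborel) = 
        indicator Q z * (\<integral>\<^sup>+x. ennreal ((norm (\<phi> (x + z) - \<phi> x))\<^sup>2) \<partial>lborel)"
      by (simp add: nn_integral_cmult)
    also have "\<dots> = indicator Q z * ennreal ((l2 lebesgue (\<lambda>x. \<phi> (x + z) - \<phi> x))\<^sup>2)"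
      by (simp only: nn_integral_l2[OF sz] l2_lebesgue_eq_lborel[OF m])
    also have "\<dots> \<le> indicator Q z * ennreal ((?N * h * l2 lebesgue g)\<^sup>2)"
    proof (cases "z \<in> Q")
      case True
      have "l2 lebesgue (\<lambda>x. \<phi> (x + z) - \<phi> x) \<le> ?N * h * l2 lebesgue g"
        using C1c_grad_translation_estimate[OF C, of z] mult_right_mono[OF Q[OF True] l2_nonneg[of lebesgue g]]
        by linarith
      then show ?thesis using True by (auto intro!: ennreal_leI power_mono)
    qed simp
    finally show "(\<integral>\<^sup>+x. indicator Q z * ennreal ((\<phi> (x + z) - \<phi> x)\<^sup>2) \<partial>lborel) \<le> indicator Q z * ennreal ((?N * h * l2 lebesgue g)\<^sup>2)" .
  qed
  also have "\<dots> = ennreal ((2 * h) ^ ?N) * ennreal ((?N * h * l2 lebesgue g)\<^sup>2)"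
    using emQ by (subst nn_integral_multc) auto
  finally have le1: "(\<integral>\<^sup>+x. ennreal ((norm (\<phi> x - cell_integral h \<phi> x / h ^ ?N))\<^sup>2) \<partial>lborel) \<le>
     ennreal (1 / h ^ ?N) * (ennreal ((2 * h) ^ ?N) * ennreal ((?N * h * l2 lebesgue g)\<^sup>2))"
    by (simp add: mult_left_mono)
  have em: "ennreal a * (ennreal b * ennreal c) = ennreal (a * (b * c))" if "0 \<le> a" "0 \<le> b" "0 \<le> c" for a b c
    using that by (simp add: ennreal_mult)
  note le1
  also have "ennreal (1 / h ^ ?N) * (ennreal ((2 * h) ^ ?N) * ennreal ((?N * h * l2 lebesgue g)\<^sup>2)) = ennreal (1 / h ^ ?N * ((2 * h) ^ ?N * (?N * h * l2 lebesgue g)\<^sup>2))"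
    using h by (intro em) auto
  also have "1 / h ^ ?N * ((2 * h) ^ ?N * (?N * h * l2 lebesgue g)\<^sup>2) = (sqrt (2 ^ ?N) * (?N * h) * l2 lebesgue g)\<^sup>2"
    using h by (simp add: power_mult_distrib)
  finally have le: "(\<integral>\<^sup>+x. ennreal ((norm (\<phi> x - cell_integral h \<phi> x / h ^ ?N))\<^sup>2) \<partial>lborel) \<le> ennreal ((sqrt (2 ^ ?N) * (?N * h) * l2 lebesgue g)\<^sup>2)" .
  have m: "(\<lambda>x. \<phi> x - cell_integral h \<phi> x / h ^ ?N) \<in> borel_measurable lborel" by measurable
  have nn: "0 \<le> sqrt (2 ^ ?N) * (?N * h) * l2 lebesgue g" using h by (intro mult_nonneg_nonneg) auto
  from l2sI_nn_integral_le[OF m le nn]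
  show "l2 lborel (\<lambda>x. \<phi> x - cell_integral h \<phi> x / h ^ ?N) \<le> sqrt (2 ^ ?N) * (?N * h) * l2 lebesgue g"
    "l2s lborel (\<lambda>x. \<phi> x - cell_integral h \<phi> x / h ^ ?N)" by auto
qed

lemma same_cell_sym: "same_cell h x y \<Longrightarrow> same_cell h y x"
  by (simp add: same_cell_def)

lemma same_cell_trans: "same_cell h x y \<Longrightarrow> same_cell h y z \<Longrightarrow> same_cell h x z"
  by (simp add: same_cell_def)

lemma cell_integral_cong:
  assumes "same_cell h x y"
  shows "cell_integral h f x = cell_integral h f y"
proof -
  have "same_cell h x z \<longleftrightarrow> same_cell h y z" for z
    using assms same_cell_sym same_cell_trans by blast
  then show ?thesis by (simp add: cell_integral_def)
qed

lemma same_cell_norm: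
  fixes x y :: "'a::euclidean_space"
  assumes "h > 0" "same_cell h x y"
  shows "norm (x - y) \<le> real DIM('a) * h"
proof -
  have "norm (x - y) \<le> (\<Sum>b\<in>Basis. \<bar>(x - y) \<bullet> b\<bar>)" by (rule norm_le_l1)
  also have "\<dots> \<le> (\<Sum>b\<in>(Basis :: 'a set). h)"
    using same_cell_bounds[OF assms(1) _ assms(2)] by (intro sum_mono) (auto simp: inner_diff_left less_imp_le)
  finally show ?thesis by simp
qed

text \<open>A cell integral is constant on its cell, and every cell meets a countable dense set. For
  all mesh sizes \<open>1 / (m + 1)\<close> together there are only countably many bounded sequences
  of numbers, and a diagonal subsequence makes all of them converge.\<close>

lemma cell_integrals_convergent_subseq:
  fixes f :: "nat \<Rightarrow> 'a::euclidean_space \<Rightarrow> real"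
  assumes f: "\<And>n. l2s lborel (f n)" "\<And>n. l2 lborel (f n) \<le> A"
  obtains r :: "nat \<Rightarrow> nat" where "strict_mono r"
    "\<And>m x. convergent (\<lambda>n. cell_integral (inverse (real (Suc m))) (f (r n)) x)"
proof -
  obtain D :: "'a set" where D: "countable D" "\<And>X. open X \<Longrightarrow> X \<noteq> {} \<Longrightarrow> \<exists>d\<in>D. d \<in> X"
    by (rule countable_dense_setE) blast
  have ne: "D \<noteq> {}" using D(2)[of UNIV] by auto
  define h where "h m = inverse (real (Suc m))" for m
  have h: "h m > 0" for m by (simp add: h_def)
  define e where "e = from_nat_into ((UNIV :: nat set) \<times> D)"
  have e: "range e = UNIV \<times> D"
    unfolding e_def using ne D(1) by (intro range_from_nat_into) auto
  define P where "P i s = convergent (\<lambda>n. cell_integral (h (fst (e i))) (f (s n)) (snd (e i)))" for i and s :: "nat \<Rightarrow> nat"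
  interpret subseqs P
  proof
    fix i and s :: "nat \<Rightarrow> nat"
    have "bounded (range (\<lambda>n. cell_integral (h (fst (e i))) (f (s n)) (snd (e i))))"
    proof (rule boundedI)
      fix y assume "y \<in> range (\<lambda>n. cell_integral (h (fst (e i))) (f (s n)) (snd (e i)))"
      then obtain n where y: "y = cell_integral (h (fst (e i))) (f (s n)) (snd (e i))" by blast
      have "\<bar>y\<bar> \<le> sqrt (h (fst (e i)) ^ DIM('a)) * l2 lborel (f (s n))"
        unfolding y by (rule cell_integral_bound[OF h f(1)])
      also have "\<dots> \<le> sqrt (h (fst (e i)) ^ DIM('a)) * A"
        using h[of "fst (e i)"] f(2) by (intro mult_left_mono) auto
      finally show "norm y \<le> sqrt (h (fst (e i)) ^ DIM('a)) * A" by simp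
    qed
    from bounded_imp_convergent_subsequence[OF this]
    show "\<exists>r'. strict_mono r' \<and> P i (s \<circ> r')"
      by (auto simp: P_def convergent_def o_def)
  qed
  have conv: "convergent (\<lambda>n. cell_integral (h (fst (e i))) (f (diagseq n)) (snd (e i)))" for i
  proof -
    have "P i (diagseq \<circ> ((+) (Suc i)))"
    proof (rule diagseq_holds)
      fix r s :: "nat \<Rightarrow> nat" and n
      assume "strict_mono r" "P n s"
      then show "P n (s \<circ> r)"
        using convergent_subseq_convergent by (fastforce simp: P_def o_def)
    qed
    then have "convergent (\<lambda>n. cell_integral (h (fst (e i))) (f (diagseq (n + Suc i))) (snd (e i)))"
      by (simp add: P_def o_def add.commute)
    then show ?thesis
      by (subst (asm) convergent_ignore_initial_segment)
  qed
  show ?thesis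
  proof (rule that[OF subseq_diagseq])
    fix m and x :: 'a
    let ?a = "cell_corner (h m) x"
    \<comment> \<open>The interior of the cell is a nonempty open set, hence it contains a point of
      \<open>D\<close>.\<close>
    have "box ?a (?a + h m *\<^sub>R One) \<noteq> {}"
      using h[of m] by (auto simp: box_ne_empty inner_add_left)
    then obtain d where d: "d \<in> D" "d \<in> box ?a (?a + h m *\<^sub>R One)"
      using D(2)[OF open_box] by blast
    then have sc: "same_cell (h m) x d"
      using h[of m] by (auto simp: same_cell_iff mem_box inner_add_left less_imp_le)
    obtain i where i: "e i = (m, d)" using e d(1) by (metis UNIV_I mem_Sigma_iff rangeE)
    show "convergent (\<lambda>n. cell_integral (inverse (real (Suc m))) (f (diagseq n)) x)"
      using conv[of i] cell_integral_cong[OF sc] by (simp add: i h_def)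
  qed
qed

text \<open>Dominated convergence at one fixed mesh: all cell integrals are bounded by one constant,
  and they vanish outside one ball because points of a common cell are at distance at most
  \<open>DIM('a) * h\<close>.\<close>

lemma cell_integral_l2_convergent:
  fixes f :: "nat \<Rightarrow> 'a::euclidean_space \<Rightarrow> real"
  assumes f: "\<And>n. l2s lborel (f n)" "\<And>n. l2 lborel (f n) \<le> A" and h: "h > 0"
    and supp: "\<And>n x. norm x > R \<Longrightarrow> f n x = 0"
    and conv: "\<And>x. convergent (\<lambda>n. cell_integral h (f n) x)"
  obtains F where "l2s lborel F" "(\<lambda>n. l2 lborel (\<lambda>x. cell_integral h (f n) x - F x)) \<longlonglongrightarrow> 0"
    "\<And>n. l2s lborel (cell_integral h (f n))"
proof -
  have [measurable]: "f n \<in> borel_measurable borel" for n using l2s_measurable[OF f(1)] by simp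
  define B where "B = sqrt (h ^ DIM('a)) * A"
  define S where "S = cball (0::'a) (R + real DIM('a) * h)"
  have bound: "\<bar>cell_integral h (f n) x\<bar> \<le> indicator S x * B" for n x
  proof (cases "x \<in> S")
    case True
    have "\<bar>cell_integral h (f n) x\<bar> \<le> sqrt (h ^ DIM('a)) * l2 lborel (f n)" by (rule cell_integral_bound[OF h f(1)])
    also have "\<dots> \<le> B" unfolding B_def using h f(2) by (intro mult_left_mono) auto
    finally show ?thesis using True by simp
  next
    case False
    have "of_bool (same_cell h x y) * f n y = 0" for y
    proof (cases "same_cell h x y")
      case True
      have "norm x \<le> norm y + norm (x - y)" using norm_triangle_sub by blast
      then have "norm y > R" using same_cell_norm[OF h True] False by (auto simp: S_def)
      then show ?thesis using supp by simp
    qed simp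
    then have "(\<lambda>y. of_bool (same_cell h x y) * f n y) = (\<lambda>_. 0)" by blast
    then have "cell_integral h (f n) x = 0" by (simp only: cell_integral_def Bochner_Integration.integral_zero)
    then show ?thesis using False by simp
  qed
  define F where "F x = lim (\<lambda>n. cell_integral h (f n) x)" for x
  have [measurable]: "F \<in> borel_measurable borel"
    unfolding F_def[abs_def] by (rule borel_measurable_lim_metric) measurable
  have lim: "(\<lambda>n. cell_integral h (f n) x) \<longlonglongrightarrow> F x" for x
    using conv[of x] by (simp add: F_def convergent_LIMSEQ_iff)
  have Fb: "\<bar>F x\<bar> \<le> indicator S x * B" for x
    by (rule LIMSEQ_le_const2[OF tendsto_rabs[OF lim]]) (use bound in blast)
  have cS: "compact S" by (simp add: S_def)
  have SB: "l2s lborel (\<lambda>x. indicator S x * c :: real)" for c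
  proof -
    have [measurable]: "S \<in> sets borel" using cS by (rule borel_compact)
    have "(\<lambda>x. indicator S x * c :: real) \<in> borel_measurable borel" by measurable
    from l2s_lebesgue_eq_lborel[OF this] show ?thesis using l2s_indicator[OF cS, of c] by simp
  qed
  have dom: "l2s lborel G" if "G \<in> borel_measurable borel" "\<And>x. \<bar>G x\<bar> \<le> indicator S x * c" for G :: "'a \<Rightarrow> real" and c
    unfolding l2s_def
  proof
    show "integrable lborel (\<lambda>x. (norm (G x))\<^sup>2)"
    proof (rule Bochner_Integration.integrable_bound)
      show "integrable lborel (\<lambda>x. (norm (indicator S x * c))\<^sup>2)" using SB[of c] by (simp only: l2s_def)
      have "(norm (G x))\<^sup>2 \<le> (norm (indicator S x * c))\<^sup>2" for x
        using that(2)[of x] by (intro power_mono) auto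
      then show "AE x in lborel. norm ((norm (G x))\<^sup>2) \<le> norm ((norm (indicator S x * c))\<^sup>2)" by simp
    qed (use that(1) in measurable)
  qed (use that(1) in simp)
  have "(\<lambda>n. \<integral>x. (norm (cell_integral h (f n) x - F x))\<^sup>2 \<partial>lborel) \<longlonglongrightarrow> (\<integral>x. 0 \<partial>(lborel :: 'a measure))"
  proof (rule integral_dominated_convergence)
    show "integrable lborel (\<lambda>x. (norm (indicator S x * (2 * B)))\<^sup>2)" using SB[of "2 * B"] by (simp only: l2s_def)
    show "AE x in lborel. (\<lambda>n. (norm (cell_integral h (f n) x - F x))\<^sup>2) \<longlonglongrightarrow> 0"
    proof (intro always_eventually allI)
      fix x
      have "(\<lambda>n. cell_integral h (f n) x - F x) \<longlonglongrightarrow> 0" using lim[of x] by (simp add: LIM_zero_iff)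
      then show "(\<lambda>n. (norm (cell_integral h (f n) x - F x))\<^sup>2) \<longlonglongrightarrow> 0"
        using tendsto_power[OF tendsto_norm, of _ 0 _ 2] by fastforce
    qed
    fix n
    have "\<bar>cell_integral h (f n) x - F x\<bar> \<le> \<bar>indicator S x * (2 * B)\<bar>" for x
      using bound[of n x] Fb[of x] by (simp add: indicator_def)
    then have "(norm (cell_integral h (f n) x - F x))\<^sup>2 \<le> (norm (indicator S x * (2 * B)))\<^sup>2" for x
      by (intro power_mono) auto
    then show "AE x in lborel. norm ((norm (cell_integral h (f n) x - F x))\<^sup>2) \<le> (norm (indicator S x * (2 * B)))\<^sup>2"
      by simp
  qed (measurable)
  then have "(\<lambda>n. sqrt (\<integral>x. (norm (cell_integral h (f n) x - F x))\<^sup>2 \<partial>lborel)) \<longlonglongrightarrow> sqrt 0"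
    by (intro tendsto_real_sqrt) simp
  then have "(\<lambda>n. l2 lborel (\<lambda>x. cell_integral h (f n) x - F x)) \<longlonglongrightarrow> 0"
    by (simp add: l2_def)
  moreover have "l2s lborel F" by (rule dom[OF _ Fb]) measurable
  moreover have "l2s lborel (cell_integral h (f n))" for n by (rule dom[OF _ bound]) measurable
  ultimately show ?thesis by (intro that)
qed

text \<open>Bounded gradients make the averages over cells of side \<open>h\<close> approximate
  every \<open>\<phi> n\<close> with the same error of order \<open>h\<close>, and for fixed
  \<open>h\<close> the averages converge in \<open>l2\<close> along \<open>r\<close>. As
  \<open>r\<close> serves all mesh sizes, choosing \<open>h\<close> after \<open>e\<close> shows
  that the subsequence is Cauchy.\<close>

theorem rellich:
  fixes \<phi> :: "nat \<Rightarrow> real^'n \<Rightarrow> real"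
  assumes \<Omega>: "bounded \<Omega>" and C: "\<And>n. C1c_grad \<Omega> (\<phi> n) (d\<phi> n)"
    and A: "\<And>n. l2 lebesgue (\<phi> n) \<le> A" and B: "\<And>n. l2 lebesgue (d\<phi> n) \<le> B"
  obtains r :: "nat \<Rightarrow> nat" and g where "strict_mono r" "l2s lebesgue g"
    "(\<lambda>n. l2 lebesgue (\<lambda>x. \<phi> (r n) x - g x)) \<longlonglongrightarrow> 0"
proof -
  have m [measurable]: "\<phi> n \<in> borel_measurable borel" for n
    by (rule borel_measurable_continuous_onI[OF C1c_grad_continuous(1)[OF C]])
  have s: "l2s lborel (\<phi> n)" for n using C1c_grad_l2s(1)[OF C] l2s_lebesgue_eq_lborel[OF m] by blast
  have A': "l2 lborel (\<phi> n) \<le> A" for n using A l2_lebesgue_eq_lborel[OF m] by simp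
  obtain R where R: "\<And>x. x \<in> \<Omega> \<Longrightarrow> norm x \<le> R" using \<Omega> by (auto simp: bounded_iff)
  have supp: "\<phi> n x = 0" if "norm x > R" for n x
  proof -
    have "x \<notin> \<Omega>" using R[of x] that by auto
    then show ?thesis using C1c_grad_support[OF C[of n]] by (metis subsetD)
  qed
  obtain r :: "nat \<Rightarrow> nat" where r: "strict_mono r"
    and conv: "\<And>m x. convergent (\<lambda>n. cell_integral (inverse (real (Suc m))) (\<phi> (r n)) x)"
    by (rule cell_integrals_convergent_subseq[of \<phi> A, OF s A']) (rule that)
  define k where "k = sqrt (2 ^ CARD('n)) * CARD('n) * B"
  have cauchy: "\<exists>K. \<forall>i\<ge>K. \<forall>j\<ge>K. l2 lebesgue (\<lambda>x. \<phi> (r i) x - \<phi> (r j) x) < e" if e: "e > 0" for e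
  proof -
    have "(\<lambda>m. k * inverse (real (Suc m))) \<longlonglongrightarrow> k * 0"
      by (intro tendsto_intros LIMSEQ_inverse_real_of_nat)
    then have "\<forall>\<^sub>F m in sequentially. k * inverse (real (Suc m)) < e / 4"
      using e by (intro order_tendstoD) auto
    then obtain m where m4: "k * inverse (real (Suc m)) < e / 4" by (auto simp: eventually_sequentially)
    define h where "h = inverse (real (Suc m))"
    have h: "h > 0" by (simp add: h_def)
    let ?P = "\<lambda>n x. cell_integral h (\<phi> n) x / h ^ CARD('n)"
    have close: "l2 lborel (\<lambda>x. \<phi> n x - ?P n x) < e / 4" for n
    proof -
      have "l2 lborel (\<lambda>x. \<phi> n x - ?P n x) \<le> sqrt (2 ^ CARD('n)) * (CARD('n) * h) * l2 lebesgue (d\<phi> n)"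
        by (rule cell_average_estimate(1)[OF C h])
      also have "\<dots> \<le> sqrt (2 ^ CARD('n)) * (CARD('n) * h) * B"
        using h B by (intro mult_left_mono) auto
      also have "\<dots> = k * h" by (simp add: k_def)
      also have "\<dots> < e / 4" using m4 by (simp only: h_def)
      finally show ?thesis .
    qed
    obtain F where F: "l2s lborel F" "(\<lambda>n. l2 lborel (\<lambda>x. cell_integral h (\<phi> (r n)) x - F x)) \<longlonglongrightarrow> 0"
      "\<And>n. l2s lborel (cell_integral h (\<phi> (r n)))"
      by (rule cell_integral_l2_convergent[of "\<lambda>n. \<phi> (r n)" A h R, OF s A' h supp conv[of m, folded h_def]])
        (assumption, rule that)
    define c where "c = 1 / h ^ CARD('n)"
    have c: "c > 0" using h by (simp add: c_def)
    let ?F = "\<lambda>x. c *\<^sub>R F x"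
    have Pp: "cell_integral h (\<phi> n) x / h ^ CARD('n) = c * cell_integral h (\<phi> n) x" for n x by (simp add: c_def)
    have P: "?P n = (\<lambda>x. c *\<^sub>R cell_integral h (\<phi> n) x)" for n by (simp add: c_def fun_eq_iff)
    have "l2 lborel (\<lambda>x. ?P (r n) x - ?F x) = c * l2 lborel (\<lambda>x. cell_integral h (\<phi> (r n)) x - F x)" for n
      using l2_scaleR[of lborel c "\<lambda>x. cell_integral h (\<phi> (r n)) x - F x"] c by (simp add: Pp right_diff_distrib)
    then have "(\<lambda>n. l2 lborel (\<lambda>x. ?P (r n) x - ?F x)) \<longlonglongrightarrow> 0"
      using tendsto_mult_right_zero[OF F(2), of c] by simp
    then have "\<forall>\<^sub>F n in sequentially. l2 lborel (\<lambda>x. ?P (r n) x - ?F x) < e / 4"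
      using e by (intro order_tendstoD) auto
    then obtain K where K: "\<And>n. n \<ge> K \<Longrightarrow> l2 lborel (\<lambda>x. ?P (r n) x - ?F x) < e / 4"
      by (auto simp: eventually_sequentially)
    have sF: "l2s lborel ?F" by (rule l2s_scaleR[OF F(1)])
    have sP: "l2s lborel (?P (r n))" for n unfolding P by (rule l2s_scaleR[OF F(3)])
    have near: "l2 lborel (\<lambda>x. \<phi> (r n) x - ?F x) < e / 2" if "n \<ge> K" for n
      using l2_diff_triangle[OF s[of "r n"] sP[of n] sF] close[of "r n"] K[OF that] by argo
    have "l2 lborel (\<lambda>x. \<phi> (r i) x - \<phi> (r j) x) < e" if "i \<ge> K" "j \<ge> K" for i j
      using l2_diff_triangle[OF s[of "r i"] sF s[of "r j"]] near[OF that(1)] near[OF that(2)]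
      unfolding l2_commute[of lborel ?F] by argo
    moreover have "l2 lborel (\<lambda>x. \<phi> (r i) x - \<phi> (r j) x) = l2 lebesgue (\<lambda>x. \<phi> (r i) x - \<phi> (r j) x)" for i j
      by (rule l2_lebesgue_eq_lborel[symmetric]) measurable
    ultimately show ?thesis by auto
  qed
  obtain g where "l2s lebesgue g" "(\<lambda>n. l2 lebesgue (\<lambda>x. \<phi> (r n) x - g x)) \<longlonglongrightarrow> 0"
    by (rule l2_complete[OF C1c_grad_l2s(1)[OF C] cauchy])
  then show ?thesis using that r by blast
qed

section \<open>Ladyzhenskaya's inequality\<close>

text \<open>A type \<open>real^'n\<close> with two indices is not literally a product and offers
  only an unordered basis. The coordinates come from \<open>lborel\<close> as the image of the
  product measure over \<open>Basis\<close>, whose factors are split off one by one.\<close>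

lemma nn_integral_basis_2:
  fixes F :: "'a::euclidean_space \<Rightarrow> ennreal"
  assumes [measurable]: "F \<in> borel_measurable borel" and B: "Basis = {a, b}" "a \<noteq> b"
  shows "(\<integral>\<^sup>+w. F w \<partial>lborel) = (\<integral>\<^sup>+w. F (fst w *\<^sub>R a + snd w *\<^sub>R b) \<partial>(lborel :: (real \<times> real) measure))"
proof -
  interpret product_sigma_finite "\<lambda>_::'a. lborel :: real measure" ..
  have "(\<integral>\<^sup>+w. F w \<partial>lborel) = (\<integral>\<^sup>+f. F (\<Sum>c\<in>Basis. f c *\<^sub>R c) \<partial>(\<Pi>\<^sub>M c\<in>{a, b}. lborel))"
    unfolding B(1)[symmetric] by (subst lborel_eq, subst nn_integral_distr) simp_all
  also have "\<dots> = (\<integral>\<^sup>+f. (\<integral>\<^sup>+x. F (\<Sum>c\<in>Basis. (f(a := x)) c *\<^sub>R c) \<partial>lborel) \<partial>(\<Pi>\<^sub>M c\<in>{b}. lborel))"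
    using B(2) by (subst product_nn_integral_insert) (simp_all flip: B(1))
  also have "\<dots> = (\<integral>\<^sup>+f. (\<lambda>y. \<integral>\<^sup>+x. F (x *\<^sub>R a + y *\<^sub>R b) \<partial>lborel) (f b) \<partial>(\<Pi>\<^sub>M c\<in>{b}. lborel))"
    unfolding B(1) using B(2) by simp
  also have "\<dots> = (\<integral>\<^sup>+y. \<integral>\<^sup>+x. F (x *\<^sub>R a + y *\<^sub>R b) \<partial>lborel \<partial>lborel)"
    by (rule product_nn_integral_singleton) measurable
  also have "\<dots> = (\<integral>\<^sup>+w. F (fst w *\<^sub>R a + snd w *\<^sub>R b) \<partial>(lborel \<Otimes>\<^sub>M lborel))"
    by (subst lborel_pair.nn_integral_snd[symmetric]) auto
  finally show ?thesis by (simp add: lborel_prod)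
qed

text \<open>The third coordinate is kept outside and the first two form one integral over the plane,
  so that the planar estimate can be applied to each slice.\<close>

lemma nn_integral_basis_3:
  fixes F :: "'a::euclidean_space \<Rightarrow> ennreal"
  assumes [measurable]: "F \<in> borel_measurable borel" and B: "Basis = {a, b, c}" "a \<noteq> b" "a \<noteq> c" "b \<noteq> c"
  shows "(\<integral>\<^sup>+w. F w \<partial>lborel) =
    (\<integral>\<^sup>+z. \<integral>\<^sup>+w. F (fst w *\<^sub>R a + snd w *\<^sub>R b + z *\<^sub>R c) \<partial>(lborel :: (real \<times> real) measure) \<partial>lborel)"
proof -
  interpret product_sigma_finite "\<lambda>_::'a. lborel :: real measure" ..
  have "(\<integral>\<^sup>+w. F w \<partial>lborel) = (\<integral>\<^sup>+f. F (\<Sum>c\<in>Basis. f c *\<^sub>R c) \<partial>(\<Pi>\<^sub>M c\<in>{a, b, c}. lborel))"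
    unfolding B(1)[symmetric] by (subst lborel_eq, subst nn_integral_distr) simp_all
  also have "\<dots> = (\<integral>\<^sup>+f. (\<integral>\<^sup>+x. F (\<Sum>c\<in>Basis. (f(a := x)) c *\<^sub>R c) \<partial>lborel) \<partial>(\<Pi>\<^sub>M c\<in>{b, c}. lborel))"
    using B(2-4) by (subst product_nn_integral_insert) (simp_all flip: B(1))
  also have "\<dots> = (\<integral>\<^sup>+f. (\<integral>\<^sup>+x. F (x *\<^sub>R a + f b *\<^sub>R b + f c *\<^sub>R c) \<partial>lborel) \<partial>(\<Pi>\<^sub>M c\<in>{b, c}. lborel))"
    unfolding B(1) using B(2-4) by (simp add: add.assoc)
  also have "\<dots> = (\<integral>\<^sup>+f. (\<integral>\<^sup>+y. (\<integral>\<^sup>+x. F (x *\<^sub>R a + (f(b := y)) b *\<^sub>R b + (f(b := y)) c *\<^sub>R c) \<partial>lborel) \<partial>lborel) \<partial>(\<Pi>\<^sub>M c\<in>{c}. lborel))"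
    using B(2-4) by (subst product_nn_integral_insert) simp_all
  also have "\<dots> = (\<integral>\<^sup>+f. (\<lambda>z. \<integral>\<^sup>+y. \<integral>\<^sup>+x. F (x *\<^sub>R a + y *\<^sub>R b + z *\<^sub>R c) \<partial>lborel \<partial>lborel) (f c) \<partial>(\<Pi>\<^sub>M c\<in>{c}. lborel))"
    using B by simp
  also have "\<dots> = (\<integral>\<^sup>+z. \<integral>\<^sup>+y. \<integral>\<^sup>+x. F (x *\<^sub>R a + y *\<^sub>R b + z *\<^sub>R c) \<partial>lborel \<partial>lborel \<partial>lborel)"
    by (rule product_nn_integral_singleton) measurable
  also have "\<dots> = (\<integral>\<^sup>+z. \<integral>\<^sup>+w. F (fst w *\<^sub>R a + snd w *\<^sub>R b + z *\<^sub>R c) \<partial>(lborel \<Otimes>\<^sub>M lborel) \<partial>lborel)"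
  proof (rule nn_integral_cong)
    fix z
    show "(\<integral>\<^sup>+y. \<integral>\<^sup>+x. F (x *\<^sub>R a + y *\<^sub>R b + z *\<^sub>R c) \<partial>lborel \<partial>lborel) =
        (\<integral>\<^sup>+w. F (fst w *\<^sub>R a + snd w *\<^sub>R b + z *\<^sub>R c) \<partial>(lborel \<Otimes>\<^sub>M lborel))"
      by (subst lborel_pair.nn_integral_snd[symmetric]) auto
  qed
  finally show ?thesis by (simp add: lborel_prod)
qed

text \<open>The fundamental theorem of calculus for the square of \<phi> along the line through
  \<open>p\<close> in direction \<open>a\<close>, starting from a point outside the support.\<close>

lemma C1c_grad_line_estimate:
  assumes C: "C1c_grad \<Omega> \<phi> g" and a: "norm a = 1"
  shows "ennreal ((\<phi> p)\<^sup>2) \<le> (\<integral>\<^sup>+s. ennreal (2 * \<bar>\<phi> (p + s *\<^sub>R a)\<bar> * \<bar>g (p + s *\<^sub>R a) \<bullet> a\<bar>) \<partial>lborel)"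
proof -
  obtain K where K: "compact K" "\<And>x. x \<notin> K \<Longrightarrow> \<phi> x = 0" using C1c_grad_support[OF C] by metis
  obtain R where R: "R > 0" "\<And>x. x \<in> K \<Longrightarrow> norm x \<le> R"
    using compact_imp_bounded[OF K(1)] by (auto simp: bounded_pos)
  define w where "w s = \<phi> (p + s *\<^sub>R a)" for s
  define w' where "w' s = g (p + s *\<^sub>R a) \<bullet> a" for s
  \<comment> \<open>At this parameter the point on the line has norm at least \<open>R + 1\<close>,
    which is beyond the support.\<close>
  define S where "S = - (R + norm p + 1)"
  have S: "S \<le> 0" using R(1) norm_ge_zero[of p] unfolding S_def by linarith
  have "w S = 0"
  proof -
    have "norm (S *\<^sub>R a) \<le> norm (p + S *\<^sub>R a) + norm p"
      using norm_triangle_ineq4[of "p + S *\<^sub>R a" p] by simp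
    moreover have "norm (S *\<^sub>R a) = R + norm p + 1"
      using a S unfolding S_def norm_scaleR by simp
    ultimately have "norm (p + S *\<^sub>R a) > R" by simp
    then show ?thesis using K(2) R(2) by (force simp: w_def)
  qed
  have der: "(w has_real_derivative w' s) (at s)" for s
  proof -
    have "((\<lambda>s. p + s *\<^sub>R a) has_derivative (\<lambda>t. t *\<^sub>R a)) (at s)"
      by (auto intro!: derivative_eq_intros)
    then have "(w has_derivative (\<lambda>t. g (p + s *\<^sub>R a) \<bullet> (t *\<^sub>R a))) (at s)"
      using diff_chain_at[of "\<lambda>s. p + s *\<^sub>R a" "\<lambda>t. t *\<^sub>R a" s \<phi> "\<lambda>h. g (p + s *\<^sub>R a) \<bullet> h"] C
      by (simp add: o_def C1c_grad_def w_def[abs_def])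
    then show ?thesis
      by (rule has_derivative_imp_has_field_derivative) (simp add: w'_def)
  qed
  have cw: "continuous_on UNIV w" "continuous_on UNIV w'"
  proof -
    have "continuous_on UNIV (\<lambda>s. p + s *\<^sub>R a)" by (intro continuous_intros)
    then show "continuous_on UNIV w" "continuous_on UNIV w'"
      unfolding w_def[abs_def] w'_def[abs_def]
      using C1c_grad_continuous[OF C]
      by (auto intro!: continuous_intros intro: continuous_on_compose2[of UNIV])
  qed
  have [measurable]: "w \<in> borel_measurable borel" "w' \<in> borel_measurable borel"
    using cw by (auto intro: borel_measurable_continuous_onI)
  have FTC: "(\<integral>s. (2 * w s * w' s) * indicator {S..0} s \<partial>lborel) = (w 0)\<^sup>2 - (w S)\<^sup>2"
  proof (rule integral_FTC_Icc_real[OF S])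
    show "DERIV (\<lambda>s. (w s)\<^sup>2) x :> 2 * w x * w' x" for x
      using DERIV_power[OF der[of x], of 2] by (simp add: ac_simps)
    show "isCont (\<lambda>s. 2 * w s * w' s) x" for x
      using cw by (auto intro!: continuous_intros simp: continuous_on_eq_continuous_at)
  qed
  have int: "integrable lborel (\<lambda>s. (2 * w s * w' s) * indicator {S..0} s)"
  proof -
    have "continuous_on {S..0} (\<lambda>s. 2 * w s * w' s)"
      by (intro continuous_intros continuous_on_subset[OF cw(1)] continuous_on_subset[OF cw(2)] subset_UNIV)
    from borel_integrable_compact[OF compact_Icc this] show ?thesis
      by (simp add: mult.commute[of "indicator _ _"])
  qed
  have "ennreal ((w 0)\<^sup>2) = ennreal (norm (\<integral>s. (2 * w s * w' s) * indicator {S..0} s \<partial>lborel))"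
    unfolding FTC using \<open>w S = 0\<close> by simp
  also have "\<dots> \<le> (\<integral>\<^sup>+s. ennreal (norm ((2 * w s * w' s) * indicator {S..0} s)) \<partial>lborel)"
    by (rule integral_norm_bound_ennreal[OF int])
  also have "\<dots> \<le> (\<integral>\<^sup>+s. ennreal (2 * \<bar>w s\<bar> * \<bar>w' s\<bar>) \<partial>lborel)"
    by (intro nn_integral_mono ennreal_leI) (auto simp: indicator_def abs_mult)
  finally show ?thesis by (simp add: w_def w'_def)
qed

lemma nn_integral_Cauchy_Schwarz:
  fixes f g :: "'a \<Rightarrow> real"
  assumes f: "l2s N f" and g: "l2s N g"
  shows "(\<integral>\<^sup>+x. ennreal (2 * \<bar>f x\<bar> * \<bar>g x\<bar>) \<partial>N) \<le> ennreal (2 * l2 N f * l2 N g)"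
proof -
  have abs: "l2s N (\<lambda>x. \<bar>f x\<bar>)" "l2s N (\<lambda>x. \<bar>g x\<bar>)"
    using f g by (auto simp: l2s_def)
  have "integrable N (\<lambda>x. \<bar>f x\<bar> * \<bar>g x\<bar>)" using l2s_inner[OF abs] by simp
  then have int: "integrable N (\<lambda>x. 2 * \<bar>f x\<bar> * \<bar>g x\<bar>)" by (simp add: mult.assoc)
  have "(\<integral>x. 2 * \<bar>f x\<bar> * \<bar>g x\<bar> \<partial>N) = 2 * (\<integral>x. \<bar>f x\<bar> \<bullet> \<bar>g x\<bar> \<partial>N)" by (simp add: mult.assoc)
  also have "\<dots> \<le> 2 * (l2 N (\<lambda>x. \<bar>f x\<bar>) * l2 N (\<lambda>x. \<bar>g x\<bar>))"
    using l2_Cauchy_Schwarz[OF abs] by simp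
  also have "\<dots> = 2 * l2 N f * l2 N g" by (simp add: l2_def)
  finally show ?thesis
    using int by (subst nn_integral_eq_integral) (auto intro: ennreal_leI)
qed

text \<open>Ladyzhenskaya's argument: \<open>\<phi>\<^sup>4\<close> is bounded by a product of two functions each of which depends on
  one of the two variables only.\<close>

lemma C1c_grad_plane_estimate:
  fixes \<phi> :: "real^'n \<Rightarrow> real" and a b p :: "real^'n"
  assumes C: "C1c_grad \<Omega> \<phi> g" and ab: "norm a = 1" "norm b = 1" "a \<bullet> b = 0"
  defines "T \<equiv> \<lambda>w :: real \<times> real. fst w *\<^sub>R a + snd w *\<^sub>R b + p"
  shows "(\<integral>\<^sup>+w. ennreal (\<phi> (T w) ^ 4) \<partial>lborel) \<le>
      ennreal (2 * l2 lborel (\<lambda>w. \<phi> (T w)) * l2 lborel (\<lambda>w. g (T w) \<bullet> a)) *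
      ennreal (2 * l2 lborel (\<lambda>w. \<phi> (T w)) * l2 lborel (\<lambda>w. g (T w) \<bullet> b))"
    "l2s lborel (\<lambda>w. \<phi> (T w))" "l2s lborel (\<lambda>w. g (T w))"
proof -
  have cT: "continuous_on UNIV T" unfolding T_def by (intro continuous_intros)
  have cont: "continuous_on UNIV (\<lambda>w. \<phi> (T w))" "continuous_on UNIV (\<lambda>w. g (T w))"
    using C1c_grad_continuous[OF C] cT by (auto intro: continuous_on_compose2[of UNIV])
  note [measurable] = borel_measurable_continuous_onI[OF cont(1)] borel_measurable_continuous_onI[OF cont(2)]
    borel_measurable_continuous_onI[OF C1c_grad_continuous(1)[OF C]]
    borel_measurable_continuous_onI[OF C1c_grad_continuous(2)[OF C]]
  obtain K where K: "compact K" "\<And>x. x \<notin> K \<Longrightarrow> \<phi> x = 0" "\<And>x. x \<notin> K \<Longrightarrow> g x = 0" using C1c_grad_support[OF C] by metis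
  obtain R where R: "R > 0" "\<And>x. x \<in> K \<Longrightarrow> norm x \<le> R"
    using compact_imp_bounded[OF K(1)] by (auto simp: bounded_pos)
  \<comment> \<open>As \<open>a\<close> and \<open>b\<close> are orthonormal, \<open>T\<close> is an
    isometric embedding up to the shift by \<open>p\<close>, so the composed functions again have
    compact support.\<close>
  have far: "T w \<notin> K" if "w \<notin> cball 0 (R + norm p)" for w
  proof -
    have "(norm (fst w *\<^sub>R a + snd w *\<^sub>R b))\<^sup>2 = (norm w)\<^sup>2"
      using ab unfolding norm_Pair power2_norm_eq_inner
      by (cases w) (simp add: inner_add inner_commute norm_eq_1 power2_eq_square)
    then have "norm (fst w *\<^sub>R a + snd w *\<^sub>R b) = norm w" by (simp add: power2_eq_iff_nonneg)
    then have "norm w \<le> norm (T w) + norm p"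
      using norm_triangle_ineq4[of "T w" p] by (simp add: T_def)
    then show ?thesis using that R(2)[of "T w"] by auto
  qed
  show sl: "l2s lborel (\<lambda>w. \<phi> (T w))" "l2s lborel (\<lambda>w. g (T w))"
  proof -
    have "l2s lebesgue (\<lambda>w. \<phi> (T w))" "l2s lebesgue (\<lambda>w. g (T w))"
      by (rule l2s_compact_support[OF cont(1) compact_cball]; use far K in blast)
        (rule l2s_compact_support[OF cont(2) compact_cball]; use far K in blast)
    then show "l2s lborel (\<lambda>w. \<phi> (T w))" "l2s lborel (\<lambda>w. g (T w))"
      by (simp_all add: l2s_lebesgue_eq_lborel)
  qed
  define f where "f e q = ennreal (2 * \<bar>\<phi> q\<bar> * \<bar>g q \<bullet> e\<bar>)" for e q
  have [measurable]: "f e \<in> borel_measurable borel" for e unfolding f_def[abs_def] by measurable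
  have mT [measurable]: "T \<in> borel_measurable borel" by (rule borel_measurable_continuous_onI[OF cT])
  have [measurable]: "T \<in> measurable (lborel \<Otimes>\<^sub>M lborel) borel" using mT by (simp add: lborel_prod)
  have xa: "ennreal ((\<phi> (T (x, y)))\<^sup>2) \<le> (\<integral>\<^sup>+s. f a (T (s, y)) \<partial>lborel)" for x y
  proof -
    have "ennreal ((\<phi> (T (x, y)))\<^sup>2) \<le> (\<integral>\<^sup>+s. f a (T (x + s, y)) \<partial>lborel)"
      using C1c_grad_line_estimate[OF C ab(1), of "T (x, y)"] by (simp add: T_def f_def algebra_simps)
    also have "\<dots> = (\<integral>\<^sup>+s. f a (T (s, y)) \<partial>lborel)"
      by (rule nn_integral_lborel_translate) measurable
    finally show ?thesis .
  qed
  have yb: "ennreal ((\<phi> (T (x, y)))\<^sup>2) \<le> (\<integral>\<^sup>+s. f b (T (x, s)) \<partial>lborel)" for x y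
  proof -
    have "ennreal ((\<phi> (T (x, y)))\<^sup>2) \<le> (\<integral>\<^sup>+s. f b (T (x, y + s)) \<partial>lborel)"
      using C1c_grad_line_estimate[OF C ab(2), of "T (x, y)"] by (simp add: T_def f_def algebra_simps)
    also have "\<dots> = (\<integral>\<^sup>+s. f b (T (x, s)) \<partial>lborel)"
      by (rule nn_integral_lborel_translate) measurable
    finally show ?thesis .
  qed
  have "(\<integral>\<^sup>+w. ennreal (\<phi> (T w) ^ 4) \<partial>lborel) = (\<integral>\<^sup>+w. ennreal (\<phi> (T w) ^ 4) \<partial>(lborel \<Otimes>\<^sub>M lborel))"
    by (simp add: lborel_prod)
  also have "\<dots> = (\<integral>\<^sup>+x. \<integral>\<^sup>+y. ennreal (\<phi> (T (x, y)) ^ 4) \<partial>lborel \<partial>lborel)"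
    by (rule lborel.nn_integral_fst[symmetric]) measurable
  also have "\<dots> \<le> (\<integral>\<^sup>+x. \<integral>\<^sup>+y. (\<integral>\<^sup>+s. f a (T (s, y)) \<partial>lborel) * (\<integral>\<^sup>+s. f b (T (x, s)) \<partial>lborel) \<partial>lborel \<partial>lborel)"
  proof (intro nn_integral_mono)
    fix x y
    have "ennreal (\<phi> (T (x, y)) ^ 4) = ennreal ((\<phi> (T (x, y)))\<^sup>2) * ennreal ((\<phi> (T (x, y)))\<^sup>2)"
      by (simp add: ennreal_mult[symmetric] power_add[symmetric])
    also have "\<dots> \<le> (\<integral>\<^sup>+s. f a (T (s, y)) \<partial>lborel) * (\<integral>\<^sup>+s. f b (T (x, s)) \<partial>lborel)"
      by (intro mult_mono xa yb) auto
    finally show "ennreal (\<phi> (T (x, y)) ^ 4) \<le> (\<integral>\<^sup>+s. f a (T (s, y)) \<partial>lborel) * (\<integral>\<^sup>+s. f b (T (x, s)) \<partial>lborel)" .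
  qed
  also have "\<dots> = (\<integral>\<^sup>+x. (\<integral>\<^sup>+y. \<integral>\<^sup>+s. f a (T (s, y)) \<partial>lborel \<partial>lborel) * (\<integral>\<^sup>+s. f b (T (x, s)) \<partial>lborel) \<partial>lborel)"
    by (intro nn_integral_cong nn_integral_multc) measurable
  also have "\<dots> = (\<integral>\<^sup>+y. \<integral>\<^sup>+s. f a (T (s, y)) \<partial>lborel \<partial>lborel) * (\<integral>\<^sup>+x. \<integral>\<^sup>+s. f b (T (x, s)) \<partial>lborel \<partial>lborel)"
    by (rule nn_integral_cmult) measurable
  also have "(\<integral>\<^sup>+y. \<integral>\<^sup>+s. f a (T (s, y)) \<partial>lborel \<partial>lborel) = (\<integral>\<^sup>+w. f a (T w) \<partial>(lborel \<Otimes>\<^sub>M lborel))"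
    by (rule lborel_pair.nn_integral_snd) measurable
  also have "(\<integral>\<^sup>+x. \<integral>\<^sup>+s. f b (T (x, s)) \<partial>lborel \<partial>lborel) = (\<integral>\<^sup>+w. f b (T w) \<partial>(lborel \<Otimes>\<^sub>M lborel))"
    by (rule lborel.nn_integral_fst) measurable
  also have "(\<integral>\<^sup>+w. f a (T w) \<partial>(lborel \<Otimes>\<^sub>M lborel)) * (\<integral>\<^sup>+w. f b (T w) \<partial>(lborel \<Otimes>\<^sub>M lborel)) \<le>
      ennreal (2 * l2 lborel (\<lambda>w. \<phi> (T w)) * l2 lborel (\<lambda>w. g (T w) \<bullet> a)) *
      ennreal (2 * l2 lborel (\<lambda>w. \<phi> (T w)) * l2 lborel (\<lambda>w. g (T w) \<bullet> b))"
    unfolding lborel_prod f_def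
    by (intro mult_mono nn_integral_Cauchy_Schwarz sl(1) l2s_inner_const(1)[OF sl(2)]) auto
  finally show "(\<integral>\<^sup>+w. ennreal (\<phi> (T w) ^ 4) \<partial>lborel) \<le>
      ennreal (2 * l2 lborel (\<lambda>w. \<phi> (T w)) * l2 lborel (\<lambda>w. g (T w) \<bullet> a)) *
      ennreal (2 * l2 lborel (\<lambda>w. \<phi> (T w)) * l2 lborel (\<lambda>w. g (T w) \<bullet> b))" .
qed

lemma nn_integral_lebesgue_eq_lborel:
  "f \<in> borel_measurable borel \<Longrightarrow> (\<integral>\<^sup>+x. f x \<partial>lebesgue) = (\<integral>\<^sup>+x. f x \<partial>lborel)"
  by (rule nn_integral_completion) 

lemma l2_inner_le:
  assumes "l2s N f" "norm a = 1" shows "l2 N (\<lambda>x. f x \<bullet> a) \<le> l2 N f"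
  using l2s_inner_const(2)[OF assms(1), of a] assms(2) by simp

text \<open>With \<open>u\<close> and \<open>d\<close> the norms of \<phi> and of its gradient, the
  planar estimate gives \<open>4 * u\<^sup>2 * d\<^sup>2\<close> in dimension 2. In dimension 3 it
  is applied to the slices with norms \<open>S z\<close> and \<open>D z\<close>: the factor
  \<open>(S z)\<^sup>2\<close> is bounded uniformly in \<open>z\<close>, and
  \<open>(D z)\<^sup>2\<close> integrates to \<open>d\<^sup>2\<close>. The right-hand side is a
  common bound for both cases.\<close>

lemma ladyzhenskaya:
  fixes \<phi> :: "real^'n \<Rightarrow> real"
  assumes C: "C1c_grad \<Omega> \<phi> g" and n: "CARD('n) = 2 \<or> CARD('n) = 3"
  shows "(\<integral>\<^sup>+x. ennreal (\<phi> x ^ 4) \<partial>lebesgue) \<le> ennreal (4 * ((l2 lebesgue \<phi>)\<^sup>2 + (l2 lebesgue g)\<^sup>2)\<^sup>2)"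
proof -
  have m [measurable]: "\<phi> \<in> borel_measurable borel" "g \<in> borel_measurable borel"
    using C1c_grad_continuous[OF C] by (auto intro: borel_measurable_continuous_onI)
  define u where "u = l2 lborel \<phi>"
  define d where "d = l2 lborel g"
  have ud: "l2 lebesgue \<phi> = u" "l2 lebesgue g = d" by (simp_all add: u_def d_def l2_lebesgue_eq_lborel)
  have ud0: "0 \<le> u" "0 \<le> d" by (simp_all add: u_def d_def)
  have s: "l2s lborel \<phi>" "l2s lborel g" using C1c_grad_l2s[OF C] by (simp_all add: l2s_lebesgue_eq_lborel)
  have four: "4 * u\<^sup>2 * d\<^sup>2 \<le> 4 * (u\<^sup>2 + d\<^sup>2)\<^sup>2"
    using zero_le_power2[of "u\<^sup>2 - d\<^sup>2"] zero_le_power2[of "u\<^sup>2"] zero_le_power2[of "d\<^sup>2"]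
    by (auto simp: power2_sum power2_diff)
  have "(\<integral>\<^sup>+x. ennreal (\<phi> x ^ 4) \<partial>lborel) \<le> ennreal (4 * (u\<^sup>2 + d\<^sup>2)\<^sup>2)"
    using n
  proof
    assume "CARD('n) = 2"
    then have "card (Basis :: (real^'n) set) = 2" by simp
    then obtain a b :: "real^'n" where B: "Basis = {a, b}" "a \<noteq> b" unfolding card_2_iff by blast
    have ab: "norm a = 1" "norm b = 1" "a \<bullet> b = 0" using B by (auto intro: norm_Basis inner_not_same_Basis)
    let ?T = "\<lambda>w :: real \<times> real. fst w *\<^sub>R a + snd w *\<^sub>R b"
    note pl = C1c_grad_plane_estimate[OF C ab, of 0, simplified]
    have u: "l2 lborel (\<lambda>w. \<phi> (?T w)) = u"
    proof -
      have "ennreal ((l2 lborel (\<lambda>w. \<phi> (?T w)))\<^sup>2) = ennreal (u\<^sup>2)"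
        unfolding nn_integral_l2[OF pl(2), symmetric] u_def nn_integral_l2[OF s(1), symmetric]
        by (rule nn_integral_basis_2[OF _ B, symmetric]) measurable
      then show ?thesis using ud0 by (simp add: power2_eq_iff_nonneg)
    qed
    have d: "l2 lborel (\<lambda>w. g (?T w)) = d"
    proof -
      have "ennreal ((l2 lborel (\<lambda>w. g (?T w)))\<^sup>2) = ennreal (d\<^sup>2)"
        unfolding nn_integral_l2[OF pl(3), symmetric] d_def nn_integral_l2[OF s(2), symmetric]
        by (rule nn_integral_basis_2[OF _ B, symmetric]) measurable
      then show ?thesis using ud0 by (simp add: power2_eq_iff_nonneg)
    qed
    have "(\<integral>\<^sup>+x. ennreal (\<phi> x ^ 4) \<partial>lborel) = (\<integral>\<^sup>+w. ennreal (\<phi> (?T w) ^ 4) \<partial>lborel)"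
      by (rule nn_integral_basis_2[OF _ B]) measurable
    also have "\<dots> \<le> ennreal (2 * u * l2 lborel (\<lambda>w. g (?T w) \<bullet> a)) * ennreal (2 * u * l2 lborel (\<lambda>w. g (?T w) \<bullet> b))"
      using pl(1) by (simp only: u)
    also have "\<dots> \<le> ennreal (2 * u * d) * ennreal (2 * u * d)"
      using l2_inner_le[OF pl(3) ab(1)] l2_inner_le[OF pl(3) ab(2)] ud0 unfolding d
      by (intro mult_mono ennreal_leI mult_left_mono) auto
    also have "\<dots> = ennreal (4 * u\<^sup>2 * d\<^sup>2)"
      using ud0 by (simp add: ennreal_mult[symmetric] power2_eq_square algebra_simps)
    also have "\<dots> \<le> ennreal (4 * (u\<^sup>2 + d\<^sup>2)\<^sup>2)"
      using four by (rule ennreal_leI)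
    finally show ?thesis .
  next
    assume "CARD('n) = 3"
    then have "card (Basis :: (real^'n) set) = 3" by simp
    then obtain a b c :: "real^'n" where B: "Basis = {a, b, c}" "a \<noteq> b" "a \<noteq> c" "b \<noteq> c" unfolding card_3_iff by blast
    have ab: "norm a = 1" "norm b = 1" "norm c = 1" "a \<bullet> b = 0" using B by (auto intro: norm_Basis inner_not_same_Basis)
    let ?T = "\<lambda>z w. fst w *\<^sub>R a + snd w *\<^sub>R b + z *\<^sub>R c"
    note pl = C1c_grad_plane_estimate[OF C ab(1,2,4)]
    have mT: "(\<lambda>q. ?T (fst q) (snd q)) \<in> measurable (lborel \<Otimes>\<^sub>M (lborel :: (real \<times> real) measure)) borel"
    proof -
      have "continuous_on UNIV (\<lambda>q :: real \<times> real \<times> real. ?T (fst q) (snd q))" by (intro continuous_intros)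
      from borel_measurable_continuous_onI[OF this] show ?thesis by (simp add: lborel_prod)
    qed
    define S where "S z = l2 lborel (\<lambda>w. \<phi> (?T z w))" for z
    define D where "D z = l2 lborel (\<lambda>w. g (?T z w))" for z
    \<comment> \<open>The line estimate in the direction \<open>c\<close> bounds the square of
      \<phi> on the slice by an integral that does not depend on \<open>z\<close>; integrated over
      the slice it is at most \<open>2 * u * d\<close>.\<close>
    have S: "(S z)\<^sup>2 \<le> u\<^sup>2 + d\<^sup>2" for z
    proof -
      define f where "f q = ennreal (2 * \<bar>\<phi> q\<bar> * \<bar>g q \<bullet> c\<bar>)" for q
      have [measurable]: "f \<in> borel_measurable borel" unfolding f_def[abs_def] by measurable
      have "ennreal ((S z)\<^sup>2) = (\<integral>\<^sup>+w. ennreal ((norm (\<phi> (?T z w)))\<^sup>2) \<partial>lborel)"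
        unfolding S_def by (rule nn_integral_l2[OF pl(2), symmetric])
      also have "\<dots> \<le> (\<integral>\<^sup>+w. \<integral>\<^sup>+s. f (?T s w) \<partial>lborel \<partial>(lborel :: (real \<times> real) measure))"
      proof (intro nn_integral_mono)
        fix w :: "real \<times> real"
        have "ennreal ((norm (\<phi> (?T z w)))\<^sup>2) \<le> (\<integral>\<^sup>+s. f (?T (z + s) w) \<partial>lborel)"
          using C1c_grad_line_estimate[OF C ab(3), of "?T z w"] by (simp add: f_def algebra_simps)
        also have "\<dots> = (\<integral>\<^sup>+s. f (?T s w) \<partial>lborel)"
          by (rule nn_integral_lborel_translate) measurable
        finally show "ennreal ((norm (\<phi> (?T z w)))\<^sup>2) \<le> (\<integral>\<^sup>+s. f (?T s w) \<partial>lborel)" .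
      qed
      also have "\<dots> = (\<integral>\<^sup>+s. \<integral>\<^sup>+w. f (?T s w) \<partial>(lborel :: (real \<times> real) measure) \<partial>lborel)"
        using measurable_compose[OF mT, of f] by (intro lborel_pair.Fubini') (simp add: case_prod_beta')
      also have "\<dots> = (\<integral>\<^sup>+q. f q \<partial>lborel)"
        by (rule nn_integral_basis_3[OF _ B, symmetric]) measurable
      also have "\<dots> \<le> ennreal (2 * u * l2 lborel (\<lambda>q. g q \<bullet> c))"
        unfolding f_def u_def by (rule nn_integral_Cauchy_Schwarz[OF s(1) l2s_inner_const(1)[OF s(2)]])
      also have "\<dots> \<le> ennreal (2 * u * d)"
        using l2_inner_le[OF s(2) ab(3)] ud0 unfolding d_def by (intro ennreal_leI mult_left_mono) auto
      also have "\<dots> \<le> ennreal (u\<^sup>2 + d\<^sup>2)"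
        using sum_squares_bound[of u d] by (rule ennreal_leI)
      finally show ?thesis by (subst (asm) ennreal_le_iff) auto
    qed
    have Dn: "(\<integral>\<^sup>+z. ennreal ((D z)\<^sup>2) \<partial>lborel) = ennreal (d\<^sup>2)"
    proof -
      have "(\<integral>\<^sup>+z. ennreal ((D z)\<^sup>2) \<partial>lborel) = (\<integral>\<^sup>+z. \<integral>\<^sup>+w. ennreal ((norm (g (?T z w)))\<^sup>2) \<partial>lborel \<partial>lborel)"
        unfolding D_def by (intro nn_integral_cong nn_integral_l2[OF pl(3), symmetric])
      also have "\<dots> = (\<integral>\<^sup>+q. ennreal ((norm (g q))\<^sup>2) \<partial>lborel)"
        by (rule nn_integral_basis_3[OF _ B, symmetric]) measurable
      finally show ?thesis by (simp add: nn_integral_l2[OF s(2)] d_def)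
    qed
    have "(\<integral>\<^sup>+x. ennreal (\<phi> x ^ 4) \<partial>lborel) = (\<integral>\<^sup>+z. \<integral>\<^sup>+w. ennreal (\<phi> (?T z w) ^ 4) \<partial>lborel \<partial>lborel)"
      by (rule nn_integral_basis_3[OF _ B]) measurable
    also have "\<dots> \<le> (\<integral>\<^sup>+z. ennreal (4 * (u\<^sup>2 + d\<^sup>2)) * ennreal ((D z)\<^sup>2) \<partial>lborel)"
    proof (intro nn_integral_mono)
      fix z
      have "(\<integral>\<^sup>+w. ennreal (\<phi> (?T z w) ^ 4) \<partial>lborel) \<le>
          ennreal (2 * S z * l2 lborel (\<lambda>w. g (?T z w) \<bullet> a)) * ennreal (2 * S z * l2 lborel (\<lambda>w. g (?T z w) \<bullet> b))"
        unfolding S_def by (rule pl(1))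
      also have "\<dots> \<le> ennreal (2 * S z * D z) * ennreal (2 * S z * D z)"
        unfolding D_def
        by (intro mult_mono ennreal_leI mult_left_mono l2_inner_le[OF pl(3)] ab) (auto simp: S_def)
      also have "\<dots> = ennreal (4 * (S z)\<^sup>2 * (D z)\<^sup>2)"
        by (simp add: S_def D_def ennreal_mult[symmetric] power2_eq_square algebra_simps)
      also have "\<dots> \<le> ennreal (4 * (u\<^sup>2 + d\<^sup>2) * (D z)\<^sup>2)"
        using S by (intro ennreal_leI mult_right_mono mult_left_mono) auto
      also have "\<dots> = ennreal (4 * (u\<^sup>2 + d\<^sup>2)) * ennreal ((D z)\<^sup>2)"
        by (rule ennreal_mult) auto
      finally show "(\<integral>\<^sup>+w. ennreal (\<phi> (?T z w) ^ 4) \<partial>lborel) \<le> ennreal (4 * (u\<^sup>2 + d\<^sup>2)) * ennreal ((D z)\<^sup>2)" .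
    qed
    also have "\<dots> = ennreal (4 * (u\<^sup>2 + d\<^sup>2)) * ennreal (d\<^sup>2)"
    proof -
      have "(\<lambda>z. ennreal ((D z)\<^sup>2)) \<in> borel_measurable lborel"
        unfolding D_def nn_integral_l2[OF pl(3), symmetric]
        using lborel.borel_measurable_nn_integral_fst[OF measurable_compose[OF mT, of "\<lambda>q. ennreal ((norm (g q))\<^sup>2)" borel]]
        by simp
      then show ?thesis by (simp add: nn_integral_cmult Dn)
    qed
    also have "\<dots> = ennreal (4 * (u\<^sup>2 + d\<^sup>2) * d\<^sup>2)"
      by (rule ennreal_mult[symmetric]) auto
    also have "4 * (u\<^sup>2 + d\<^sup>2) * d\<^sup>2 \<le> 4 * (u\<^sup>2 + d\<^sup>2) * (u\<^sup>2 + d\<^sup>2)"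
      by (intro mult_left_mono) auto
    also have "\<dots> = 4 * (u\<^sup>2 + d\<^sup>2)\<^sup>2"
      by (simp only: power2_eq_square[of "u\<^sup>2 + d\<^sup>2"] mult.assoc)
    finally show ?thesis by (simp add: ennreal_leI)
  qed
  moreover have "(\<integral>\<^sup>+x. ennreal (\<phi> x ^ 4) \<partial>lebesgue) = (\<integral>\<^sup>+x. ennreal (\<phi> x ^ 4) \<partial>lborel)"
    by (rule nn_integral_lebesgue_eq_lborel) measurable
  ultimately show ?thesis by (simp add: ud)
qed

text \<open>Ladyzhenskaya's bound is uniform along an approximating sequence, since its
  \<open>l2\<close> norms converge; Fatou along an almost everywhere convergent subsequence carries
  it over to \<open>u\<close>.\<close>

lemma H10_L4:
  fixes u :: "real^'n \<Rightarrow> real"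
  assumes u: "u \<in> H10 \<Omega>" and n: "CARD('n) = 2 \<or> CARD('n) = 3"
  shows "integrable lebesgue (\<lambda>x. u x ^ 4)"
proof -
  obtain g \<phi> d\<phi> where C: "\<And>n. C1c_grad \<Omega> (\<phi> n) (d\<phi> n)" and l: "l2s lebesgue u" "l2s lebesgue g"
    and lim: "(\<lambda>n. l2 lebesgue (\<lambda>x. \<phi> n x - u x)) \<longlonglongrightarrow> 0" "(\<lambda>n. l2 lebesgue (\<lambda>x. d\<phi> n x - g x)) \<longlonglongrightarrow> 0"
    using u unfolding H10_def mem_Collect_eq H10_grad_iff by blast
  note [measurable] = l2s_measurable[OF l(1)] l2s_measurable[OF C1c_grad_l2s(1)[OF C]]
  have "(\<lambda>n. 4 * ((l2 lebesgue (\<phi> n))\<^sup>2 + (l2 lebesgue (d\<phi> n))\<^sup>2)\<^sup>2) \<longlonglongrightarrow> 4 * ((l2 lebesgue u)\<^sup>2 + (l2 lebesgue g)\<^sup>2)\<^sup>2"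
    by (intro tendsto_intros l2_tendsto_norm[OF C1c_grad_l2s(1)[OF C] l(1) lim(1)] l2_tendsto_norm[OF C1c_grad_l2s(2)[OF C] l(2) lim(2)])
  then have "Bseq (\<lambda>n. 4 * ((l2 lebesgue (\<phi> n))\<^sup>2 + (l2 lebesgue (d\<phi> n))\<^sup>2)\<^sup>2)"
    by (rule convergent_imp_Bseq[OF convergentI])
  then obtain B where B: "\<And>n. 4 * ((l2 lebesgue (\<phi> n))\<^sup>2 + (l2 lebesgue (d\<phi> n))\<^sup>2)\<^sup>2 \<le> B"
    unfolding Bseq_def by (auto simp: abs_le_iff)
  obtain r :: "nat \<Rightarrow> nat" where r: "strict_mono r" "AE x in lebesgue. (\<lambda>n. \<phi> (r n) x) \<longlonglongrightarrow> u x"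
    by (rule l2_AE_subseq[OF C1c_grad_l2s(1)[OF C] l(1) lim(1)])
  have "(\<integral>\<^sup>+x. ennreal (u x ^ 4) \<partial>lebesgue) = (\<integral>\<^sup>+x. liminf (\<lambda>n. ennreal (\<phi> (r n) x ^ 4)) \<partial>lebesgue)"
  proof (rule nn_integral_cong_AE)
    show "AE x in lebesgue. ennreal (u x ^ 4) = liminf (\<lambda>n. ennreal (\<phi> (r n) x ^ 4))"
      using r(2)
    proof eventually_elim
      case (elim x)
      then have "(\<lambda>n. ennreal (\<phi> (r n) x ^ 4)) \<longlonglongrightarrow> ennreal (u x ^ 4)"
        by (intro tendsto_ennrealI tendsto_intros)
      then show ?case by (rule lim_imp_Liminf[OF trivial_limit_sequentially, symmetric])
    qed
  qed
  also have "\<dots> \<le> liminf (\<lambda>n. \<integral>\<^sup>+x. ennreal (\<phi> (r n) x ^ 4) \<partial>lebesgue)"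
    by (rule nn_integral_liminf) measurable
  also have "\<dots> \<le> liminf (\<lambda>n. ennreal B)"
    using ladyzhenskaya[OF C n] B by (intro Liminf_mono always_eventually allI) (meson ennreal_leI order_trans)
  also have "\<dots> < \<infinity>" by (simp add: Liminf_const)
  finally have "(\<integral>\<^sup>+x. ennreal (norm (u x ^ 4)) \<partial>lebesgue) < \<infinity>" by simp
  then show ?thesis by (intro integrableI_bounded) measurable
qed

section \<open>Odd maps near compact sets\<close>

text \<open>No extension theorem is needed: a partition of unity subordinate to a finite net of \<open>K\<close> gives
  a map \<open>F\<close> with \<open>F x \<bullet> f p > 0\<close> for all \<open>p \<in> K\<close> near \<open>x\<close>, and then \<open>F x - F (\<sigma> x)\<close> is odd and nonzero.\<close>

lemma odd_map_near_compact:
  fixes d :: "'a \<Rightarrow> 'a \<Rightarrow> real" and f :: "'a \<Rightarrow> nat \<Rightarrow> real"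
  assumes d_sym: "\<And>x y. x \<in> Z \<Longrightarrow> y \<in> Z \<Longrightarrow> d x y = d y x"
    and d_nonneg: "\<And>x y. x \<in> Z \<Longrightarrow> y \<in> Z \<Longrightarrow> 0 \<le> d x y"
    and d_tri: "\<And>x y z. x \<in> Z \<Longrightarrow> y \<in> Z \<Longrightarrow> z \<in> Z \<Longrightarrow> d x z \<le> d x y + d y z"
    and sZ: "\<And>x. x \<in> Z \<Longrightarrow> \<sigma> x \<in> Z" and ss: "\<And>x. \<sigma> (\<sigma> x) = x"
    and s_iso: "\<And>x y. d (\<sigma> x) (\<sigma> y) = d x y"
    and KZ: "K \<subseteq> Z" and sK: "\<And>x. x \<in> K \<Longrightarrow> \<sigma> x \<in> K"
    and comp: "\<And>s :: nat \<Rightarrow> 'a. (\<And>n. s n \<in> K) \<Longrightarrow>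
        \<exists>r x. strict_mono (r :: nat \<Rightarrow> nat) \<and> x \<in> K \<and> (\<lambda>n. d (s (r n)) x) \<longlonglongrightarrow> 0"
    and f_nz: "\<And>x. x \<in> K \<Longrightarrow> \<exists>i<m. f x i \<noteq> 0"
    and f_odd: "\<And>x i. x \<in> K \<Longrightarrow> f (\<sigma> x) i = - f x i"
    and f_cont: "\<And>x e i. x \<in> K \<Longrightarrow> e > 0 \<Longrightarrow> i < m \<Longrightarrow> \<exists>\<delta>>0. \<forall>y\<in>K. d x y < \<delta> \<longrightarrow> \<bar>f x i - f y i\<bar> < e"
  obtains \<epsilon> L G where "0 < \<epsilon>" "0 \<le> L"
    "\<And>x i. G (\<sigma> x) i = - G x i" "\<And>x i. m \<le> i \<Longrightarrow> G x i = (0 :: real)"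
    "\<And>x p. x \<in> Z \<Longrightarrow> p \<in> K \<Longrightarrow> d x p < \<epsilon> \<Longrightarrow> \<exists>i<m. G x i \<noteq> 0"
    "\<And>x y i. x \<in> Z \<Longrightarrow> y \<in> Z \<Longrightarrow> \<bar>G x i - G y i\<bar> \<le> L * d x y"
proof -
  define ip where "ip a b = (\<Sum>i<m. a i * b i)" for a b :: "nat \<Rightarrow> real"
  have f_seq: "(\<lambda>n. f (s n) i) \<longlonglongrightarrow> f x i" if s: "\<And>n. s n \<in> K" and x: "x \<in> K" and lim: "(\<lambda>n. d (s n) x) \<longlonglongrightarrow> 0" and i: "i < m"
    for s x i
  proof (rule LIMSEQ_I)
    fix e :: real assume "e > 0"
    from f_cont[OF x this i] obtain \<delta> where \<delta>: "\<delta> > 0" "\<And>y. y \<in> K \<Longrightarrow> d x y < \<delta> \<Longrightarrow> \<bar>f x i - f y i\<bar> < e" by blast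
    have "\<forall>\<^sub>F n in sequentially. d (s n) x < \<delta>" using lim \<delta>(1) by (rule order_tendstoD)
    then obtain N where N: "\<And>n. n \<ge> N \<Longrightarrow> d (s n) x < \<delta>" by (auto simp: eventually_sequentially)
    have "norm (f (s n) i - f x i) < e" if "n \<ge> N" for n
    proof -
      have "s n \<in> Z" "x \<in> Z" using KZ s x by auto
      then have "d x (s n) < \<delta>" using N[OF that] d_sym by simp
      from \<delta>(2)[OF s this] show ?thesis by (simp add: abs_minus_commute)
    qed
    then show "\<exists>N. \<forall>n\<ge>N. norm (f (s n) i - f x i) < e" by blast
  qed
  \<comment> \<open>Compactness makes the positivity of \<open>ip (f x) (f x)\<close> uniform:
    values of \<open>f\<close> at points of \<open>K\<close> closer than \<eta> enclose an acute
    angle.\<close>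
  have "\<exists>\<eta>>0. \<forall>x\<in>K. \<forall>y\<in>K. d x y < \<eta> \<longrightarrow> ip (f x) (f y) > 0"
  proof (rule ccontr)
    assume neg: "\<not> ?thesis"
    define Q where "Q n p \<longleftrightarrow> fst p \<in> K \<and> snd p \<in> K \<and> d (fst p) (snd p) < inverse (real (Suc n)) \<and>
      ip (f (fst p)) (f (snd p)) \<le> 0" for n p
    have "\<exists>p. Q n p" for n
    proof -
      have "inverse (real (Suc n)) > 0" by simp
      with neg obtain x y where "x \<in> K" "y \<in> K" "d x y < inverse (real (Suc n))" "\<not> ip (f x) (f y) > 0"
        by blast
      then have "Q n (x, y)" by (simp add: Q_def)
      then show ?thesis ..
    qed
    then obtain p where p: "\<And>n. Q n (p n)" by metis
    define X where "X n = fst (p n)" for n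
    define Y where "Y n = snd (p n)" for n
    have XY: "\<And>n. X n \<in> K" "\<And>n. Y n \<in> K" "\<And>n. d (X n) (Y n) < inverse (real (Suc n))"
      "\<And>n. ip (f (X n)) (f (Y n)) \<le> 0"
      using p unfolding Q_def X_def Y_def by blast+
    from comp[of X, OF XY(1)]
    obtain r x where r: "strict_mono (r :: nat \<Rightarrow> nat)" and x: "x \<in> K" and lim: "(\<lambda>n. d (X (r n)) x) \<longlonglongrightarrow> 0"
      by (elim exE conjE) (rule that)
    have "(\<lambda>n. d (Y (r n)) x) \<longlonglongrightarrow> 0"
    proof (rule tendsto_sandwich[of "\<lambda>_. 0" _ _ "\<lambda>n. inverse (real (Suc (r n))) + d (X (r n)) x"])
      have "(\<lambda>n. inverse (real (Suc (r n)))) \<longlonglongrightarrow> 0"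
        using LIMSEQ_subseq_LIMSEQ[OF LIMSEQ_inverse_real_of_nat r] by (simp add: o_def)
      from tendsto_add[OF this lim] show "(\<lambda>n. inverse (real (Suc (r n))) + d (X (r n)) x) \<longlonglongrightarrow> 0" by simp
      have "d (Y (r n)) x \<le> inverse (real (Suc (r n))) + d (X (r n)) x" for n
      proof -
        have z: "X (r n) \<in> Z" "Y (r n) \<in> Z" "x \<in> Z" using XY(1,2) x KZ by auto
        show ?thesis
          using d_tri[OF z(2,1,3)] d_sym[OF z(2,1)] XY(3)[of "r n"] by linarith
      qed
      then show "\<forall>\<^sub>F n in sequentially. d (Y (r n)) x \<le> inverse (real (Suc (r n))) + d (X (r n)) x" by simp
      have "0 \<le> d (Y (r n)) x" for n using d_nonneg[of "Y (r n)" x] XY(2) x KZ by auto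
      then show "\<forall>\<^sub>F n in sequentially. 0 \<le> d (Y (r n)) x" by simp
    qed simp
    then have "(\<lambda>n. ip (f (X (r n))) (f (Y (r n)))) \<longlonglongrightarrow> ip (f x) (f x)"
      unfolding ip_def using f_seq[OF XY(1) x lim] f_seq[OF XY(2) x]
      by (intro tendsto_sum tendsto_mult) auto
    then have "ip (f x) (f x) \<le> 0"
      by (rule LIMSEQ_le_const2) (use XY(4) in blast)
    moreover obtain i where "i < m" "f x i \<noteq> 0" using f_nz[OF x] by blast
    then have "ip (f x) (f x) > 0"
      unfolding ip_def
    proof (intro sum_pos2[of _ i])
      assume "f x i \<noteq> 0"
      then show "f x i * f x i > 0" using not_real_square_gt_zero[of "f x i"] by blast
    qed auto
    ultimately show False by simp
  qed
  then obtain \<eta> where \<eta>: "\<eta> > 0" "\<And>x y. x \<in> K \<Longrightarrow> y \<in> K \<Longrightarrow> d x y < \<eta> \<Longrightarrow> ip (f x) (f y) > 0" by blast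
  \<comment> \<open>A net point \<open>y\<close> with positive weight at \<open>x\<close> satisfies
    \<open>d x y < 2 * \<epsilon>\<close>; together with \<open>d x p < \<epsilon>\<close> this
    gives \<open>d y p < \<eta>\<close>. The weights below reach as far as
    \<open>2 * \<epsilon>\<close> so that the net point nearest to \<open>p\<close> is sure to
    count.\<close>
  define \<epsilon> where "\<epsilon> = \<eta> / 3"
  have \<epsilon>: "\<epsilon> > 0" using \<eta>(1) by (simp add: \<epsilon>_def)
  have "\<exists>Y. finite Y \<and> Y \<subseteq> K \<and> (\<forall>x\<in>K. \<exists>y\<in>Y. d x y < \<epsilon>)"
  proof (rule ccontr)
    assume "\<not> ?thesis"
    then have "\<exists>x. finite Y \<and> Y \<subseteq> K \<longrightarrow> x \<in> K \<and> (\<forall>y\<in>Y. \<epsilon> \<le> d x y)" for Y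
      by (meson not_le)
    \<comment> \<open>Without a finite net, \<open>c\<close> always finds a further point at
      distance at least \<epsilon> from finitely many given ones. The resulting separated sequence
      has no convergent subsequence.\<close>
    then obtain c where c: "\<And>Y. finite Y \<Longrightarrow> Y \<subseteq> K \<Longrightarrow> c Y \<in> K \<and> (\<forall>y\<in>Y. \<epsilon> \<le> d (c Y) y)" by metis
    define S where "S = rec_nat {} (\<lambda>_ Y. insert (c Y) Y)"
    have S0: "S 0 = {}" and SS: "S (Suc n) = insert (c (S n)) (S n)" for n by (simp_all add: S_def)
    have S: "finite (S n) \<and> S n \<subseteq> K" for n by (induction n) (auto simp: S0 SS c)
    have mono: "c (S j) \<in> S n" if "j < n" for j n
      using that by (induction n) (auto simp: SS less_Suc_eq)
    have sep: "\<epsilon> \<le> d (c (S n)) (c (S j))" if "j < n" for j n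
      using c[of "S n"] S[of n] mono[OF that] by blast
    have cK: "c (S n) \<in> K" for n using c S by blast
    from comp[of "\<lambda>n. c (S n)", OF cK]
    obtain r x where r: "strict_mono (r :: nat \<Rightarrow> nat)" and x: "x \<in> K" and lim: "(\<lambda>n. d (c (S (r n))) x) \<longlonglongrightarrow> 0"
      by (elim exE conjE) (rule that)
    have "\<forall>\<^sub>F n in sequentially. d (c (S (r n))) x < \<epsilon> / 2" using lim \<epsilon> by (intro order_tendstoD) auto
    then obtain n where n: "d (c (S (r n))) x < \<epsilon> / 2" "d (c (S (r (Suc n)))) x < \<epsilon> / 2"
      by (auto simp: eventually_sequentially) (meson le_SucI order_refl)
    have "r n < r (Suc n)" using r by (simp add: strict_mono_Suc_iff)
    have z: "c (S (r (Suc n))) \<in> Z" "c (S (r n)) \<in> Z" "x \<in> Z" using cK x KZ by auto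
    show False
      using sep[OF \<open>r n < r (Suc n)\<close>] d_tri[OF z(1,3,2)] d_sym[OF z(3,2)] n by linarith
  qed
  then obtain Y where Y: "finite Y" "Y \<subseteq> K" "\<And>x. x \<in> K \<Longrightarrow> \<exists>y\<in>Y. d x y < \<epsilon>" by blast
  define w where "w y x = max 0 (2 * \<epsilon> - d x y)" for x y
  define F where "F x i = (if i < m then \<Sum>y\<in>Y. w y x * f y i else 0)" for x i
  define G where "G x i = F x i - F (\<sigma> x) i" for x i
  have F_pos: "ip (F x) (f p) > 0" if x: "x \<in> Z" and p: "p \<in> K" and xp: "d x p < \<epsilon>" for x p
  proof -
    have "ip (F x) (f p) = (\<Sum>i<m. \<Sum>y\<in>Y. w y x * (f y i * f p i))"
      by (simp add: ip_def F_def sum_distrib_right mult.assoc)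
    also have "\<dots> = (\<Sum>y\<in>Y. w y x * ip (f y) (f p))"
      by (subst sum.swap) (simp add: ip_def sum_distrib_left)
    also have "\<dots> > 0"
    proof -
      obtain y where y: "y \<in> Y" "d p y < \<epsilon>" using Y(3)[OF p] by blast
      have w_ip: "w z x = 0 \<or> (w z x > 0 \<and> ip (f z) (f p) > 0)" if "z \<in> Y" for z
      proof (cases "w z x = 0")
        case False
        then have "d x z < 2 * \<epsilon>" by (auto simp: w_def max_def split: if_splits)
        moreover have "z \<in> Z" "p \<in> Z" using that Y(2) KZ p by auto
        ultimately have "d z p < \<eta>"
          using d_tri[of z x p] d_sym[of z x] x xp by (simp add: \<epsilon>_def)
        then have "ip (f z) (f p) > 0" using \<eta>(2)[of z p] that Y(2) p by auto
        moreover have "w z x > 0" using False by (auto simp: w_def max_def split: if_splits)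
        ultimately show ?thesis by blast
      qed simp
      have "d x y \<le> d x p + d p y" using d_tri[of x p y] x p y(1) Y(2) KZ by auto
      then have "w y x > 0" using xp y(2) by (simp add: w_def)
      show ?thesis
      proof (rule sum_pos2[OF Y(1) y(1)])
        show "0 < w y x * ip (f y) (f p)"
          using w_ip[OF y(1)] \<open>w y x > 0\<close> by (intro mult_pos_pos) auto
        show "0 \<le> w z x * ip (f z) (f p)" if "z \<in> Y" for z
          using w_ip[OF that] by (elim disjE) simp_all
      qed
    qed
    finally show ?thesis .
  qed
  have F_lip: "\<bar>F x i - F y i\<bar> \<le> (\<Sum>i<m. \<Sum>z\<in>Y. \<bar>f z i\<bar>) * d x y" if x: "x \<in> Z" and y: "y \<in> Z" for x y i
  proof (cases "i < m")
    case True
    have wl: "\<bar>w z x - w z y\<bar> \<le> d x y" if "z \<in> Y" for z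
    proof -
      have "z \<in> Z" using that Y(2) KZ by auto
      then have "\<bar>d x z - d y z\<bar> \<le> d x y"
        using d_tri[of x y z] d_tri[of y x z] d_sym[of x y] x y by auto
      then show ?thesis by (auto simp: w_def max_def)
    qed
    have "\<bar>F x i - F y i\<bar> = \<bar>\<Sum>z\<in>Y. (w z x - w z y) * f z i\<bar>"
      using True by (simp add: F_def sum_subtractf left_diff_distrib)
    also have "\<dots> \<le> (\<Sum>z\<in>Y. \<bar>(w z x - w z y) * f z i\<bar>)" by (rule sum_abs)
    also have "\<dots> \<le> (\<Sum>z\<in>Y. d x y * \<bar>f z i\<bar>)"
      using wl by (intro sum_mono) (simp add: abs_mult mult_right_mono)
    also have "\<dots> = (\<Sum>z\<in>Y. \<bar>f z i\<bar>) * d x y" by (simp add: sum_distrib_left mult.commute)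
    also have "\<dots> \<le> (\<Sum>i<m. \<Sum>z\<in>Y. \<bar>f z i\<bar>) * d x y"
      using True d_nonneg[OF x y] by (intro mult_right_mono member_le_sum[of i "{..<m}" "\<lambda>i. \<Sum>z\<in>Y. \<bar>f z i\<bar>"] sum_nonneg) auto
    finally show ?thesis .
  next
    case False
    then show ?thesis using d_nonneg[OF x y] by (simp add: F_def sum_nonneg)
  qed
  show ?thesis
  proof (rule that[of \<epsilon> "2 * (\<Sum>i<m. \<Sum>z\<in>Y. \<bar>f z i\<bar>)" G])
    show "\<epsilon> > 0" "0 \<le> 2 * (\<Sum>i<m. \<Sum>z\<in>Y. \<bar>f z i\<bar>)" using \<epsilon> by (simp_all add: sum_nonneg)
    show "G (\<sigma> x) i = - G x i" for x i by (simp add: G_def ss)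
    show "G x i = 0" if "m \<le> i" for x i using that by (simp add: G_def F_def)
    show "\<exists>i<m. G x i \<noteq> 0" if x: "x \<in> Z" and p: "p \<in> K" and xp: "d x p < \<epsilon>" for x p
    proof (rule ccontr)
      assume "\<not> (\<exists>i<m. G x i \<noteq> 0)"
      then have eq: "F x i = F (\<sigma> x) i" if "i < m" for i using that by (simp add: G_def)
      \<comment> \<open>If \<open>F x\<close> and \<open>F (\<sigma> x)\<close> agreed, this vector
        would have positive inner product both with \<open>f p\<close> and with
        \<open>f (\<sigma> p) = - f p\<close>.\<close>
      have "ip (F (\<sigma> x)) (f (\<sigma> p)) > 0"
        using F_pos[OF sZ[OF x] sK[OF p]] xp by (simp add: s_iso)
      moreover have "ip (F (\<sigma> x)) (f (\<sigma> p)) = - ip (F x) (f p)"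
        using eq by (simp add: ip_def f_odd[OF p] sum_negf)
      ultimately show False using F_pos[OF x p xp] by simp
    qed
    show "\<bar>G x i - G y i\<bar> \<le> 2 * (\<Sum>i<m. \<Sum>z\<in>Y. \<bar>f z i\<bar>) * d x y" if "x \<in> Z" "y \<in> Z" for x y i
      using F_lip[OF that, of i] F_lip[OF sZ sZ, OF that, of i] unfolding G_def s_iso by linarith
  qed
qed

section \<open>The functional and the space of pairs\<close>

lemma L2norm_eq_l2:
  assumes "open \<Omega>" "u \<in> borel_measurable lebesgue" "AE x in lebesgue. x \<notin> \<Omega> \<longrightarrow> u x = 0"
  shows "L2norm \<Omega> u = l2 lebesgue u"
proof -
  note [measurable] = assms(2)
  have "(LINT x:\<Omega>|lebesgue. (u x)\<^sup>2) = (\<integral>x. (u x)\<^sup>2 \<partial>lebesgue)"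
  proof (rule set_lebesgue_integral_AE_zero[OF assms(1)])
    show "AE x in lebesgue. x \<notin> \<Omega> \<longrightarrow> (u x)\<^sup>2 = 0" using assms(3) by eventually_elim simp
  qed measurable
  then show ?thesis by (simp add: L2norm_def l2_def)
qed

lemma L2norm_H10: "open \<Omega> \<Longrightarrow> u \<in> H10 \<Omega> \<Longrightarrow> L2norm \<Omega> u = l2 lebesgue u"
  by (rule L2norm_eq_l2[OF _ l2s_measurable[OF H10_l2s] H10_AE_zero])

text \<open>With a pair read as a map into R^2, \<open>dist2\<close> becomes an \<open>l2\<close>
  distance and inherits symmetry and the triangle inequality.\<close>

definition pair_fun :: "('a \<Rightarrow> real) \<times> ('a \<Rightarrow> real) \<Rightarrow> 'a \<Rightarrow> real \<times> real" where
  "pair_fun w = (\<lambda>t. (fst w t, snd w t))"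

lemma l2s_pair_fun:
  assumes "l2s N (fst w)" "l2s N (snd w)"
  shows "l2s N (pair_fun w)" "(l2 N (pair_fun w))\<^sup>2 = (l2 N (fst w))\<^sup>2 + (l2 N (snd w))\<^sup>2"
proof -
  note [measurable] = l2s_measurable[OF assms(1)] l2s_measurable[OF assms(2)]
  have *: "(norm (pair_fun w t))\<^sup>2 = (norm (fst w t))\<^sup>2 + (norm (snd w t))\<^sup>2" for t
    by (simp add: pair_fun_def norm_Pair)
  show "l2s N (pair_fun w)"
    unfolding l2s_def *
  proof
    show "pair_fun w \<in> borel_measurable N" unfolding pair_fun_def by measurable
    show "integrable N (\<lambda>t. (norm (fst w t))\<^sup>2 + (norm (snd w t))\<^sup>2)"
      using assms unfolding l2s_def by (intro Bochner_Integration.integrable_add) blast+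
  qed
  show "(l2 N (pair_fun w))\<^sup>2 = (l2 N (fst w))\<^sup>2 + (l2 N (snd w))\<^sup>2"
    using assms unfolding l2_square * l2s_def by (intro Bochner_Integration.integral_add) blast+
qed

abbreviation H10_pair :: "(real^'n) set \<Rightarrow> ((real^'n \<Rightarrow> real) \<times> (real^'n \<Rightarrow> real)) set" where
  "H10_pair \<Omega> \<equiv> H10 \<Omega> \<times> H10 \<Omega>"

lemma M_H10_pair: "w \<in> M \<Omega> \<Longrightarrow> w \<in> H10_pair \<Omega>"
  by (auto simp: M_def)

lemma pair_fun_l2s: "w \<in> H10_pair \<Omega> \<Longrightarrow> l2s lebesgue (pair_fun w)"
  by (rule l2s_pair_fun(1)) (auto intro: H10_l2s)

lemma dist2_eq:
  assumes \<Omega>: "open \<Omega>" and w: "w \<in> H10_pair \<Omega>" "z \<in> H10_pair \<Omega>"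
  shows "dist2 \<Omega> w z = l2 lebesgue (\<lambda>t. pair_fun w t - pair_fun z t)"
proof -
  have c: "L2norm \<Omega> (\<lambda>x. u x - v x) = l2 lebesgue (\<lambda>x. u x - v x)" if "u \<in> H10 \<Omega>" "v \<in> H10 \<Omega>" for u v
  proof (rule L2norm_eq_l2[OF \<Omega>])
    show "(\<lambda>x. u x - v x) \<in> borel_measurable lebesgue"
      using H10_l2s[OF that(1)] H10_l2s[OF that(2)] l2s_measurable l2s_diff by blast
    show "AE x in lebesgue. x \<notin> \<Omega> \<longrightarrow> u x - v x = 0"
      using H10_AE_zero[OF that(1)] H10_AE_zero[OF that(2)] by eventually_elim simp
  qed
  have m: "fst w \<in> H10 \<Omega>" "snd w \<in> H10 \<Omega>" "fst z \<in> H10 \<Omega>" "snd z \<in> H10 \<Omega>" using w by auto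
  let ?p = "(\<lambda>x. fst w x - fst z x, \<lambda>x. snd w x - snd z x)"
  have "l2s lebesgue (fst ?p)" "l2s lebesgue (snd ?p)"
    using l2s_diff[OF H10_l2s[OF m(1)] H10_l2s[OF m(3)]] l2s_diff[OF H10_l2s[OF m(2)] H10_l2s[OF m(4)]] by simp_all
  from l2s_pair_fun(2)[OF this]
  have "(dist2 \<Omega> w z)\<^sup>2 = (l2 lebesgue (pair_fun ?p))\<^sup>2"
    by (simp add: dist2_def c m)
  moreover have "pair_fun ?p = (\<lambda>t. pair_fun w t - pair_fun z t)" by (simp add: pair_fun_def)
  ultimately show ?thesis by (simp add: power2_eq_iff_nonneg dist2_def)
qed

lemma dist2_nonneg: "0 \<le> dist2 \<Omega> w z"
  by (simp add: dist2_def)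

lemma dist2_commute:
  assumes "open \<Omega>" "w \<in> H10_pair \<Omega>" "z \<in> H10_pair \<Omega>"
  shows "dist2 \<Omega> w z = dist2 \<Omega> z w"
  unfolding dist2_eq[OF assms] dist2_eq[OF assms(1,3,2)] by (rule l2_commute)

lemma dist2_triangle:
  assumes "open \<Omega>" "x \<in> H10_pair \<Omega>" "y \<in> H10_pair \<Omega>" "z \<in> H10_pair \<Omega>"
  shows "dist2 \<Omega> x z \<le> dist2 \<Omega> x y + dist2 \<Omega> y z"
  unfolding dist2_eq[OF assms(1,2,4)] dist2_eq[OF assms(1,2,3)] dist2_eq[OF assms(1,3,4)]
  by (intro l2_diff_triangle pair_fun_l2s[where \<Omega> = \<Omega>] assms)

lemma dist2_self: "dist2 \<Omega> x x = 0"
  by (simp add: dist2_def L2norm_def)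

lemma dist2_swap: "dist2 \<Omega> (swap_uv x) (swap_uv y) = dist2 \<Omega> x y"
  by (simp add: dist2_def swap_uv_def add.commute)

lemma swap_swap: "swap_uv (swap_uv x) = x"
  by (simp add: swap_uv_def)

lemma swap_M: "x \<in> M \<Omega> \<Longrightarrow> swap_uv x \<in> M \<Omega>"
  by (auto simp: M_def swap_uv_def)

lemma l2_fst_snd_le_dist2:
  assumes \<Omega>: "open \<Omega>" and w: "w \<in> H10_pair \<Omega>" "z \<in> H10_pair \<Omega>"
  shows "l2 lebesgue (\<lambda>t. fst w t - fst z t) \<le> dist2 \<Omega> w z" "l2 lebesgue (\<lambda>t. snd w t - snd z t) \<le> dist2 \<Omega> w z"
proof -
  have m: "fst w \<in> H10 \<Omega>" "snd w \<in> H10 \<Omega>" "fst z \<in> H10 \<Omega>" "snd z \<in> H10 \<Omega>" using w by auto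
  let ?p = "(\<lambda>x. fst w x - fst z x, \<lambda>x. snd w x - snd z x)"
  have "l2s lebesgue (fst ?p)" "l2s lebesgue (snd ?p)"
    using l2s_diff[OF H10_l2s[OF m(1)] H10_l2s[OF m(3)]] l2s_diff[OF H10_l2s[OF m(2)] H10_l2s[OF m(4)]] by simp_all
  from l2s_pair_fun(2)[OF this]
  have "(dist2 \<Omega> w z)\<^sup>2 = (l2 lebesgue (\<lambda>t. fst w t - fst z t))\<^sup>2 + (l2 lebesgue (\<lambda>t. snd w t - snd z t))\<^sup>2"
    unfolding dist2_eq[OF assms] by (simp add: pair_fun_def)
  then show "l2 lebesgue (\<lambda>t. fst w t - fst z t) \<le> dist2 \<Omega> w z" "l2 lebesgue (\<lambda>t. snd w t - snd z t) \<le> dist2 \<Omega> w z"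
    by (auto intro!: power2_le_imp_le[OF _ dist2_nonneg])
qed

lemma dist2_le_l2:
  assumes \<Omega>: "open \<Omega>" and w: "w \<in> H10_pair \<Omega>" "z \<in> H10_pair \<Omega>"
  shows "dist2 \<Omega> w z \<le> l2 lebesgue (\<lambda>t. fst w t - fst z t) + l2 lebesgue (\<lambda>t. snd w t - snd z t)"
proof -
  have m: "fst w \<in> H10 \<Omega>" "snd w \<in> H10 \<Omega>" "fst z \<in> H10 \<Omega>" "snd z \<in> H10 \<Omega>" using w by auto
  let ?p = "(\<lambda>x. fst w x - fst z x, \<lambda>x. snd w x - snd z x)"
  have "l2s lebesgue (fst ?p)" "l2s lebesgue (snd ?p)"
    using l2s_diff[OF H10_l2s[OF m(1)] H10_l2s[OF m(3)]] l2s_diff[OF H10_l2s[OF m(2)] H10_l2s[OF m(4)]] by simp_all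
  from l2s_pair_fun(2)[OF this]
  have "(dist2 \<Omega> w z)\<^sup>2 = (l2 lebesgue (\<lambda>t. fst w t - fst z t))\<^sup>2 + (l2 lebesgue (\<lambda>t. snd w t - snd z t))\<^sup>2"
    unfolding dist2_eq[OF assms] by (simp add: pair_fun_def)
  also have "\<dots> \<le> (l2 lebesgue (\<lambda>t. fst w t - fst z t) + l2 lebesgue (\<lambda>t. snd w t - snd z t))\<^sup>2"
    by (simp add: power2_sum)
  finally show ?thesis by (rule power2_le_imp_le) simp
qed

text \<open>Rellich's theorem is stated for \<open>C1c_grad\<close> functions, so each
  \<open>u n\<close> is replaced by such a function within \<open>1 / (n + 1)\<close> in norm and
  energy. The limit belongs to \<open>H10\<close> by lower semicontinuity.\<close>

lemma H10_compact:
  fixes u :: "nat \<Rightarrow> real^'n \<Rightarrow> real"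
  assumes \<Omega>: "open \<Omega>" "bounded \<Omega>" and u: "\<And>n. u n \<in> H10 \<Omega>" "\<And>n. H10_norm2 \<Omega> (u n) \<le> c" "\<And>n. l2 lebesgue (u n) \<le> a"
  obtains r :: "nat \<Rightarrow> nat" and g where "strict_mono r" "g \<in> H10 \<Omega>" "(\<lambda>n. l2 lebesgue (\<lambda>x. u (r n) x - g x)) \<longlonglongrightarrow> 0"
proof -
  define \<epsilon> where "\<epsilon> n = inverse (real (Suc n))" for n
  have \<epsilon>_lim: "\<epsilon> \<longlonglongrightarrow> 0" unfolding \<epsilon>_def[abs_def] by (rule LIMSEQ_inverse_real_of_nat)
  have \<epsilon>_pos: "\<epsilon> n > 0" and \<epsilon>_le: "\<epsilon> n \<le> 1" for n by (simp_all add: \<epsilon>_def inverse_le_1_iff)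
  have "\<exists>p. C1c_grad \<Omega> (fst p) (snd p) \<and> l2 lebesgue (\<lambda>x. fst p x - u n x) < \<epsilon> n \<and> (l2 lebesgue (snd p))\<^sup>2 < H10_norm2 \<Omega> (u n) + \<epsilon> n" for n
  proof -
    obtain \<phi> d\<phi> where "C1c_grad \<Omega> \<phi> d\<phi>" "l2 lebesgue (\<lambda>x. \<phi> x - u n x) < \<epsilon> n"
      "(l2 lebesgue d\<phi>)\<^sup>2 < H10_norm2 \<Omega> (u n) + \<epsilon> n"
      by (rule H10_approx[OF u(1)[of n] \<Omega>(1) \<epsilon>_pos[of n]])
    then show ?thesis by (intro exI[of _ "(\<phi>, d\<phi>)"]) simp
  qed
  from choice[OF allI[OF this]] obtain p where "\<forall>n. C1c_grad \<Omega> (fst (p n)) (snd (p n)) \<and>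
      l2 lebesgue (\<lambda>x. fst (p n) x - u n x) < \<epsilon> n \<and> (l2 lebesgue (snd (p n)))\<^sup>2 < H10_norm2 \<Omega> (u n) + \<epsilon> n" ..
  then have p: "\<And>n. C1c_grad \<Omega> (fst (p n)) (snd (p n))" "\<And>n. l2 lebesgue (\<lambda>x. fst (p n) x - u n x) < \<epsilon> n"
    "\<And>n. (l2 lebesgue (snd (p n)))\<^sup>2 < H10_norm2 \<Omega> (u n) + \<epsilon> n"
    by blast+
  have a: "l2 lebesgue (fst (p n)) \<le> 1 + a" for n
    using l2_norm_triangle[OF C1c_grad_l2s(1)[OF p(1)[of n]] H10_l2s[OF u(1)[of n]]] p(2)[of n] u(3)[of n] \<epsilon>_le[of n]
    by linarith
  have c: "l2 lebesgue (snd (p n)) \<le> sqrt (c + 1)" for n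
    using p(3)[of n] u(2)[of n] \<epsilon>_le[of n] by (intro real_le_rsqrt) linarith
  obtain r :: "nat \<Rightarrow> nat" and g where r: "strict_mono r" and g: "l2s lebesgue g" and
    lim: "(\<lambda>n. l2 lebesgue (\<lambda>x. fst (p (r n)) x - g x)) \<longlonglongrightarrow> 0"
    by (rule rellich[OF \<Omega>(2) p(1) a c])
  have lim2: "(\<lambda>n. l2 lebesgue (\<lambda>x. u (r n) x - g x)) \<longlonglongrightarrow> 0"
  proof (rule Lim_null_comparison)
    show "(\<lambda>n. \<epsilon> (r n) + l2 lebesgue (\<lambda>x. fst (p (r n)) x - g x)) \<longlonglongrightarrow> 0"
      using tendsto_add[OF LIMSEQ_subseq_LIMSEQ[OF \<epsilon>_lim r] lim] by (simp add: o_def)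
    have "l2 lebesgue (\<lambda>x. u (r n) x - g x) \<le> \<epsilon> (r n) + l2 lebesgue (\<lambda>x. fst (p (r n)) x - g x)" for n
      using l2_diff_triangle[OF H10_l2s[OF u(1)[of "r n"]] C1c_grad_l2s(1)[OF p(1)[of "r n"]] g] p(2)[of "r n"]
        l2_commute[of lebesgue "u (r n)" "fst (p (r n))"] by linarith
    then show "\<forall>\<^sub>F n in sequentially. norm (l2 lebesgue (\<lambda>x. u (r n) x - g x)) \<le> \<epsilon> (r n) + l2 lebesgue (\<lambda>x. fst (p (r n)) x - g x)"
      by simp
  qed
  have "g \<in> H10 \<Omega>"
  proof (rule H10_norm2_lsc(1)[OF \<Omega>(1) u(1) _ g lim2])
    show "\<forall>\<^sub>F n in sequentially. H10_norm2 \<Omega> (u (r n)) \<le> c + e" if "e > 0" for e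
      using u(2) that by (intro always_eventually allI) (meson add_increasing2 less_imp_le order_trans)
  qed
  then show ?thesis using that r lim2 by blast
qed

text \<open>After one extraction for each component, strong convergence preserves the unit norms,
  and nonnegativity survives along a subsequence converging almost everywhere. Weak convergence
  would lose the norms.\<close>

lemma M_compact:
  fixes \<Omega> :: "(real^'n) set"
  assumes \<Omega>: "open \<Omega>" "bounded \<Omega>" and x: "\<And>n. x n \<in> M \<Omega>"
    and c: "\<And>n. H10_norm2 \<Omega> (fst (x n)) \<le> c" "\<And>n. H10_norm2 \<Omega> (snd (x n)) \<le> c"
  obtains r :: "nat \<Rightarrow> nat" and y where "strict_mono r" "y \<in> M \<Omega>" "(\<lambda>n. dist2 \<Omega> (x (r n)) y) \<longlonglongrightarrow> 0"
proof -
  have H: "fst (x n) \<in> H10 \<Omega>" "snd (x n) \<in> H10 \<Omega>" for n using M_H10_pair[OF x[of n]] by auto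
  have one: "l2 lebesgue (fst (x n)) = 1" "l2 lebesgue (snd (x n)) = 1" for n
    using x[of n] L2norm_H10[OF \<Omega>(1) H(1)[of n]] L2norm_H10[OF \<Omega>(1) H(2)[of n]] by (auto simp: M_def)
  obtain r :: "nat \<Rightarrow> nat" and g where r: "strict_mono r" "g \<in> H10 \<Omega>" "(\<lambda>n. l2 lebesgue (\<lambda>t. fst (x (r n)) t - g t)) \<longlonglongrightarrow> 0"
    by (rule H10_compact[OF \<Omega> H(1) c(1) eq_refl[OF one(1)]])
  obtain s :: "nat \<Rightarrow> nat" and h where s: "strict_mono s" "h \<in> H10 \<Omega>" "(\<lambda>n. l2 lebesgue (\<lambda>t. snd (x (r (s n))) t - h t)) \<longlonglongrightarrow> 0"
    by (rule H10_compact[of \<Omega> "\<lambda>n. snd (x (r n))", OF \<Omega> H(2) c(2) eq_refl[OF one(2)]])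
  have lim: "(\<lambda>n. l2 lebesgue (\<lambda>t. fst (x (r (s n))) t - g t)) \<longlonglongrightarrow> 0"
    using LIMSEQ_subseq_LIMSEQ[OF r(3) s(1)] by (simp add: o_def)
  have pos: "AE t in lebesgue. t \<in> \<Omega> \<longrightarrow> 0 \<le> g t"
    if u: "\<And>n. u n \<in> H10 \<Omega>" "\<And>n. AE t in lebesgue. t \<in> \<Omega> \<longrightarrow> 0 \<le> u n t" and g: "g \<in> H10 \<Omega>"
      and ul: "(\<lambda>n. l2 lebesgue (\<lambda>t. u n t - g t)) \<longlonglongrightarrow> 0" for u :: "nat \<Rightarrow> real^'n \<Rightarrow> real" and g
  proof -
    obtain q :: "nat \<Rightarrow> nat" where q: "strict_mono q" "AE t in lebesgue. (\<lambda>n. u (q n) t) \<longlonglongrightarrow> g t"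
      by (rule l2_AE_subseq[OF H10_l2s[OF u(1)] H10_l2s[OF g] ul])
    have "AE t in lebesgue. \<forall>n. t \<in> \<Omega> \<longrightarrow> 0 \<le> u (q n) t"
      using u(2) by (subst AE_all_countable) blast
    with q(2) show ?thesis
    proof eventually_elim
      case (elim t)
      then show ?case by (intro impI LIMSEQ_le_const[OF elim(1)]) blast
    qed
  qed
  have norm: "L2norm \<Omega> g = 1"
    if u: "\<And>n. u n \<in> H10 \<Omega>" "\<And>n. l2 lebesgue (u n) = 1" and g: "g \<in> H10 \<Omega>"
      and ul: "(\<lambda>n. l2 lebesgue (\<lambda>t. u n t - g t)) \<longlonglongrightarrow> 0" for u :: "nat \<Rightarrow> real^'n \<Rightarrow> real" and g
    using l2_tendsto_norm[OF H10_l2s[OF u(1)] H10_l2s[OF g] ul] L2norm_H10[OF \<Omega>(1) g]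
    by (simp add: u(2) LIMSEQ_const_iff)
  have sg: "AE t in lebesgue. t \<in> \<Omega> \<longrightarrow> 0 \<le> fst (x n) t" "AE t in lebesgue. t \<in> \<Omega> \<longrightarrow> 0 \<le> snd (x n) t" for n
    using x[of n] by (auto simp: M_def)
  have gh: "(g, h) \<in> M \<Omega>"
    unfolding M_def
    using r(2) s(2) pos[OF H(1) sg(1) r(2) lim] pos[OF H(2) sg(2) s(2,3)] norm[OF H(1) one(1) r(2) lim] norm[OF H(2) one(2) s(2,3)]
    by blast
  have "(\<lambda>n. dist2 \<Omega> (x (r (s n))) (g, h)) \<longlonglongrightarrow> 0"
  proof (rule Lim_null_comparison)
    show "(\<lambda>n. l2 lebesgue (\<lambda>t. fst (x (r (s n))) t - g t) + l2 lebesgue (\<lambda>t. snd (x (r (s n))) t - h t)) \<longlonglongrightarrow> 0"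
      using tendsto_add[OF lim s(3)] by simp
    show "\<forall>\<^sub>F n in sequentially. norm (dist2 \<Omega> (x (r (s n))) (g, h)) \<le>
        l2 lebesgue (\<lambda>t. fst (x (r (s n))) t - g t) + l2 lebesgue (\<lambda>t. snd (x (r (s n))) t - h t)"
      unfolding real_norm_def abs_of_nonneg[OF dist2_nonneg]
      using dist2_le_l2[OF \<Omega>(1) M_H10_pair[OF x] M_H10_pair[OF gh]]
      by (intro always_eventually allI) simp
  qed
  then show ?thesis
    using that[of "r \<circ> s", OF strict_mono_o[OF r(1) s(1)] gh] by simp
qed

section \<open>Lower semicontinuity of the functional\<close>

lemma integrable_square_product:
  fixes u v :: "'a \<Rightarrow> real"
  assumes u: "integrable N (\<lambda>x. u x ^ 4)" "u \<in> borel_measurable N"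
    and v: "integrable N (\<lambda>x. v x ^ 4)" "v \<in> borel_measurable N"
  shows "integrable N (\<lambda>x. (u x)\<^sup>2 * (v x)\<^sup>2)"
proof (rule Bochner_Integration.integrable_bound)
  note [measurable] = u(2) v(2)
  show "integrable N (\<lambda>x. u x ^ 4 + v x ^ 4)" using u(1) v(1) by simp
  have "(a\<^sup>2 * b\<^sup>2) \<le> a ^ 4 + b ^ 4" for a b :: real
  proof -
    have "2 * (a\<^sup>2 * b\<^sup>2) \<le> (a\<^sup>2)\<^sup>2 + (b\<^sup>2)\<^sup>2"
      using sum_squares_bound[of "a\<^sup>2" "b\<^sup>2"] by (simp add: mult.assoc)
    moreover have "(a\<^sup>2)\<^sup>2 = a ^ 4" "(b\<^sup>2)\<^sup>2 = b ^ 4" by (simp_all flip: power_mult)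
    moreover have "0 \<le> a\<^sup>2 * b\<^sup>2" by (intro mult_nonneg_nonneg zero_le_power2)
    ultimately show ?thesis by linarith
  qed
  then show "AE x in N. norm ((u x)\<^sup>2 * (v x)\<^sup>2) \<le> norm (u x ^ 4 + v x ^ 4)" by simp
  show "(\<lambda>x. (u x)\<^sup>2 * (v x)\<^sup>2) \<in> borel_measurable N" by measurable
qed

lemma J_eq:
  fixes \<Omega> :: "(real^'n) set"
  assumes \<Omega>: "open \<Omega>" and w: "w \<in> H10_pair \<Omega>"
  shows "J \<Omega> \<beta> w = H10_norm2 \<Omega> (fst w) / 2 + H10_norm2 \<Omega> (snd w) / 2 +
      (\<integral>x. fst w x ^ 4 + snd w x ^ 4 \<partial>lebesgue) / 4 + \<beta> / 2 * (\<integral>x. (fst w x)\<^sup>2 * (snd w x)\<^sup>2 \<partial>lebesgue)"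
proof -
  have m: "fst w \<in> H10 \<Omega>" "snd w \<in> H10 \<Omega>" using w by auto
  note [measurable] = l2s_measurable[OF H10_l2s[OF m(1)]] l2s_measurable[OF H10_l2s[OF m(2)]]
  have "(LINT x:\<Omega>|lebesgue. fst w x ^ 4 + snd w x ^ 4) = (\<integral>x. fst w x ^ 4 + snd w x ^ 4 \<partial>lebesgue)"
  proof (rule set_lebesgue_integral_AE_zero[OF \<Omega>])
    show "AE x in lebesgue. x \<notin> \<Omega> \<longrightarrow> fst w x ^ 4 + snd w x ^ 4 = 0"
      using H10_AE_zero[OF m(1)] H10_AE_zero[OF m(2)] by eventually_elim simp
  qed measurable
  moreover have "(LINT x:\<Omega>|lebesgue. (fst w x)\<^sup>2 * (snd w x)\<^sup>2) = (\<integral>x. (fst w x)\<^sup>2 * (snd w x)\<^sup>2 \<partial>lebesgue)"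
  proof (rule set_lebesgue_integral_AE_zero[OF \<Omega>])
    show "AE x in lebesgue. x \<notin> \<Omega> \<longrightarrow> (fst w x)\<^sup>2 * (snd w x)\<^sup>2 = 0"
      using H10_AE_zero[OF m(1)] by eventually_elim simp
  qed measurable
  ultimately show ?thesis by (simp add: J_def split_beta add_divide_distrib)
qed

text \<open>Fatou's lemma for real integrals whose limit is prescribed, as it is applied after a
  subsequence has been chosen along which the integrals converge.\<close>

lemma integral_fatou:
  fixes f :: "nat \<Rightarrow> 'a \<Rightarrow> real"
  assumes f: "\<And>n. integrable N (f n)" "\<And>n x. 0 \<le> f n x" and g: "integrable N g" "\<And>x. 0 \<le> g x"
    and lim: "AE x in N. (\<lambda>n. f n x) \<longlonglongrightarrow> g x" and p: "(\<lambda>n. \<integral>x. f n x \<partial>N) \<longlonglongrightarrow> p"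
  shows "(\<integral>x. g x \<partial>N) \<le> p"
proof -
  have "0 \<le> p" using f(2) by (intro LIMSEQ_le_const[OF p]) auto
  have "ennreal (\<integral>x. g x \<partial>N) = (\<integral>\<^sup>+x. ennreal (g x) \<partial>N)"
    using g by (intro nn_integral_eq_integral[symmetric]) auto
  also have "\<dots> = (\<integral>\<^sup>+x. liminf (\<lambda>n. ennreal (f n x)) \<partial>N)"
  proof (rule nn_integral_cong_AE)
    show "AE x in N. ennreal (g x) = liminf (\<lambda>n. ennreal (f n x))"
      using lim by eventually_elim (metis tendsto_ennrealI lim_imp_Liminf trivial_limit_sequentially)
  qed
  also have "\<dots> \<le> liminf (\<lambda>n. \<integral>\<^sup>+x. ennreal (f n x) \<partial>N)"
    using f(1) by (intro nn_integral_liminf) auto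
  also have "\<dots> = liminf (\<lambda>n. ennreal (\<integral>x. f n x \<partial>N))"
    using f by (simp add: nn_integral_eq_integral)
  also have "\<dots> = ennreal p"
    by (rule lim_imp_Liminf[OF trivial_limit_sequentially tendsto_ennrealI[OF p]])
  finally show ?thesis using \<open>0 \<le> p\<close> by simp
qed

lemma J_parts_nonneg:
  fixes w :: "(real^'n \<Rightarrow> real) \<times> (real^'n \<Rightarrow> real)"
  shows "0 \<le> H10_norm2 \<Omega> u" "0 \<le> (\<integral>x. fst w x ^ 4 + snd w x ^ 4 \<partial>lebesgue)"
    "0 \<le> (\<integral>x. (fst w x)\<^sup>2 * (snd w x)\<^sup>2 \<partial>lebesgue)"
  by (rule H10_norm2_nonneg) (rule integral_nonneg_AE; simp)+

lemma J_nonneg: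
  assumes "open \<Omega>" "w \<in> H10_pair \<Omega>" "0 \<le> \<beta>"
  shows "0 \<le> J \<Omega> \<beta> w"
  unfolding J_eq[OF assms(1,2)] using assms(3) J_parts_nonneg
  by (intro add_nonneg_nonneg mult_nonneg_nonneg divide_nonneg_nonneg) auto

lemma H10_norm2_le_J:
  assumes "open \<Omega>" "w \<in> H10_pair \<Omega>" "0 \<le> \<beta>"
  shows "H10_norm2 \<Omega> (fst w) \<le> 2 * J \<Omega> \<beta> w" "H10_norm2 \<Omega> (snd w) \<le> 2 * J \<Omega> \<beta> w"
proof -
  have "0 \<le> \<beta> / 2 * (\<integral>x. (fst w x)\<^sup>2 * (snd w x)\<^sup>2 \<partial>lebesgue)"
    using assms(3) J_parts_nonneg(3) by (intro mult_nonneg_nonneg) auto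
  then show "H10_norm2 \<Omega> (fst w) \<le> 2 * J \<Omega> \<beta> w" "H10_norm2 \<Omega> (snd w) \<le> 2 * J \<Omega> \<beta> w"
    using J_parts_nonneg(1)[of \<Omega> "fst w"] J_parts_nonneg(1)[of \<Omega> "snd w"] J_parts_nonneg(2)[of w]
    unfolding J_eq[OF assms(1,2)] by argo+
qed

lemma J_mono:
  assumes "open \<Omega>" "w \<in> H10_pair \<Omega>" "\<beta> \<le> \<beta>'"
  shows "J \<Omega> \<beta> w \<le> J \<Omega> \<beta>' w"
  unfolding J_eq[OF assms(1,2)] using assms(3) J_parts_nonneg(3)
  by (intro add_left_mono mult_right_mono divide_right_mono) auto

text \<open>All four parts of \<open>J\<close> are nonnegative and their weighted sum is at most
  \<open>c\<close>, so along a subsequence each of them converges. Each limit dominates the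
  corresponding part at \<open>y\<close>: the Dirichlet energies by weak closedness of balls, the
  integrals by Fatou. Adding up the limits gives \<open>c\<close> again.\<close>

lemma J_lsc:
  fixes \<Omega> :: "(real^'n) set"
  assumes \<Omega>: "open \<Omega>" and n: "CARD('n) = 2 \<or> CARD('n) = 3" and \<beta>: "0 \<le> \<beta>"
    and x: "\<And>n. x n \<in> H10_pair \<Omega>" and y: "y \<in> H10_pair \<Omega>"
    and lim: "(\<lambda>n. dist2 \<Omega> (x n) y) \<longlonglongrightarrow> 0" and c: "\<And>n. J \<Omega> \<beta> (x n) \<le> c"
  shows "J \<Omega> \<beta> y \<le> c"
proof -
  have H: "fst (x n) \<in> H10 \<Omega>" "snd (x n) \<in> H10 \<Omega>" for n using x[of n] by auto
  have Hy: "fst y \<in> H10 \<Omega>" "snd y \<in> H10 \<Omega>" using y by auto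
  define P where "P w = (\<integral>t. fst w t ^ 4 + snd w t ^ 4 \<partial>lebesgue)" for w :: "(real^'n \<Rightarrow> real) \<times> (real^'n \<Rightarrow> real)"
  define Q where "Q w = (\<integral>t. (fst w t)\<^sup>2 * (snd w t)\<^sup>2 \<partial>lebesgue)" for w :: "(real^'n \<Rightarrow> real) \<times> (real^'n \<Rightarrow> real)"
  have J: "J \<Omega> \<beta> w = H10_norm2 \<Omega> (fst w) / 2 + H10_norm2 \<Omega> (snd w) / 2 + P w / 4 + \<beta> / 2 * Q w" if "w \<in> H10_pair \<Omega>" for w
    using J_eq[OF \<Omega> that] by (simp add: P_def Q_def)
  have PQ: "0 \<le> P w" "0 \<le> Q w" for w using J_parts_nonneg(2,3)[of w] by (simp_all add: P_def Q_def)
  have int: "integrable lebesgue (\<lambda>t. fst w t ^ 4 + snd w t ^ 4)" "integrable lebesgue (\<lambda>t. (fst w t)\<^sup>2 * (snd w t)\<^sup>2)"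
    if "w \<in> H10_pair \<Omega>" for w
  proof -
    have m: "fst w \<in> H10 \<Omega>" "snd w \<in> H10 \<Omega>" using that by auto
    show "integrable lebesgue (\<lambda>t. fst w t ^ 4 + snd w t ^ 4)"
      using H10_L4[OF m(1) n] H10_L4[OF m(2) n] by simp
    show "integrable lebesgue (\<lambda>t. (fst w t)\<^sup>2 * (snd w t)\<^sup>2)"
      by (rule integrable_square_product[OF H10_L4[OF m(1) n] l2s_measurable[OF H10_l2s[OF m(1)]]
            H10_L4[OF m(2) n] l2s_measurable[OF H10_l2s[OF m(2)]]])
  qed
  have "(\<lambda>n. l2 lebesgue (\<lambda>t. pair_fun (x n) t - pair_fun y t)) \<longlonglongrightarrow> 0"
    using lim by (simp only: dist2_eq[OF \<Omega> x y])
  then obtain r0 :: "nat \<Rightarrow> nat" where r0: "strict_mono r0" "AE t in lebesgue. (\<lambda>n. pair_fun (x (r0 n)) t) \<longlonglongrightarrow> pair_fun y t"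
    by (rule l2_AE_subseq[OF pair_fun_l2s[OF x] pair_fun_l2s[OF y]])
  \<comment> \<open>One extraction in R^4 instead of four successive ones. The box reflects the
    factors 1/2, 1/2, 1/4 and 1 of the parts in \<open>J\<close>.\<close>
  define T where "T k = (H10_norm2 \<Omega> (fst (x (r0 k))), H10_norm2 \<Omega> (snd (x (r0 k))), P (x (r0 k)), \<beta> / 2 * Q (x (r0 k)))" for k
  have "bounded (range T)"
  proof (rule bounded_subset[OF bounded_cbox])
    have Q0: "0 \<le> \<beta> / 2 * Q (x k)" for k using \<beta> PQ by simp
    have "T k \<in> cbox (0, 0, 0, 0) (2 * c, 2 * c, 4 * c, c)" for k
      using Q0[of "r0 k"] c[of "r0 k"] PQ(1)[of "x (r0 k)"] J_parts_nonneg(1)[of \<Omega> "fst (x (r0 k))"] J_parts_nonneg(1)[of \<Omega> "snd (x (r0 k))"]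
      unfolding J[OF x] T_def cbox_Pair_eq mem_Times_iff fst_conv snd_conv
      unfolding cbox_interval atLeastAtMost_iff
      by (intro conjI) linarith+
    then show "range T \<subseteq> cbox (0, 0, 0, 0) (2 * c, 2 * c, 4 * c, c)" by blast
  qed
  from bounded_imp_convergent_subsequence[OF this]
  obtain l r1 where r1: "strict_mono (r1 :: nat \<Rightarrow> nat)" "(T \<circ> r1) \<longlonglongrightarrow> l" by blast
  define r where "r k = r0 (r1 k)" for k
  obtain a b p q where l: "l = (a, b, p, q)" by (cases l) auto
  have lims: "(\<lambda>k. H10_norm2 \<Omega> (fst (x (r k)))) \<longlonglongrightarrow> a" "(\<lambda>k. H10_norm2 \<Omega> (snd (x (r k)))) \<longlonglongrightarrow> b"
      "(\<lambda>k. P (x (r k))) \<longlonglongrightarrow> p" "(\<lambda>k. \<beta> / 2 * Q (x (r k))) \<longlonglongrightarrow> q"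
    using tendsto_fst[OF r1(2)] tendsto_fst[OF tendsto_snd[OF r1(2)]] tendsto_fst[OF tendsto_snd[OF tendsto_snd[OF r1(2)]]]
      tendsto_snd[OF tendsto_snd[OF tendsto_snd[OF r1(2)]]]
    by (simp_all add: l T_def o_def r_def)
  have sr: "strict_mono r" using strict_mono_o[OF r0(1) r1(1)] by (simp add: r_def[abs_def] o_def)
  have limr: "(\<lambda>k. dist2 \<Omega> (x (r k)) y) \<longlonglongrightarrow> 0" using LIMSEQ_subseq_LIMSEQ[OF lim sr] by (simp add: o_def)
  have ae: "AE t in lebesgue. (\<lambda>k. fst (x (r k)) t) \<longlonglongrightarrow> fst y t \<and> (\<lambda>k. snd (x (r k)) t) \<longlonglongrightarrow> snd y t"
    using r0(2)
  proof eventually_elim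
    case (elim t)
    from LIMSEQ_subseq_LIMSEQ[OF this r1(1)] have "(\<lambda>k. pair_fun (x (r k)) t) \<longlonglongrightarrow> pair_fun y t"
      by (simp add: o_def r_def)
    from tendsto_fst[OF this] tendsto_snd[OF this] show ?case by (simp add: pair_fun_def)
  qed
  have ev: "\<forall>\<^sub>F k in sequentially. z k \<le> lm + e" if "z \<longlonglongrightarrow> lm" "e > 0" for z :: "nat \<Rightarrow> real" and lm e
  proof -
    have "\<forall>\<^sub>F k in sequentially. z k < lm + e" using that by (intro order_tendstoD(2)[OF that(1)]) simp
    then show ?thesis by eventually_elim simp
  qed
  have l0: "(\<lambda>k. l2 lebesgue (\<lambda>t. fst (x (r k)) t - fst y t)) \<longlonglongrightarrow> 0" "(\<lambda>k. l2 lebesgue (\<lambda>t. snd (x (r k)) t - snd y t)) \<longlonglongrightarrow> 0"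
    using l2_fst_snd_le_dist2[OF \<Omega> x y] by (auto intro!: Lim_null_comparison[OF _ limr] always_eventually)
  have "H10_norm2 \<Omega> (fst y) \<le> a"
    by (rule H10_norm2_lsc(2)[OF \<Omega> H(1) ev[OF lims(1)] H10_l2s[OF Hy(1)] l0(1)])
  moreover have "H10_norm2 \<Omega> (snd y) \<le> b"
    by (rule H10_norm2_lsc(2)[OF \<Omega> H(2) ev[OF lims(2)] H10_l2s[OF Hy(2)] l0(2)])
  moreover have "P y \<le> p"
    unfolding P_def
  proof (rule integral_fatou[OF int(1)[OF x] _ int(1)[OF y] _ _ lims(3)[unfolded P_def]])
    show "AE t in lebesgue. (\<lambda>k. fst (x (r k)) t ^ 4 + snd (x (r k)) t ^ 4) \<longlonglongrightarrow> fst y t ^ 4 + snd y t ^ 4"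
      using ae by eventually_elim (intro tendsto_intros; blast)
  qed auto
  moreover have "\<beta> / 2 * Q y \<le> q"
  proof -
    have "(\<integral>t. \<beta> / 2 * ((fst y t)\<^sup>2 * (snd y t)\<^sup>2) \<partial>lebesgue) \<le> q"
    proof (rule integral_fatou)
      show "(\<lambda>k. \<integral>t. \<beta> / 2 * ((fst (x (r k)) t)\<^sup>2 * (snd (x (r k)) t)\<^sup>2) \<partial>lebesgue) \<longlonglongrightarrow> q"
        using lims(4) unfolding Q_def by (simp only: integral_mult_right_zero)
      show "AE t in lebesgue. (\<lambda>k. \<beta> / 2 * ((fst (x (r k)) t)\<^sup>2 * (snd (x (r k)) t)\<^sup>2)) \<longlonglongrightarrow> \<beta> / 2 * ((fst y t)\<^sup>2 * (snd y t)\<^sup>2)"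
        using ae by eventually_elim (intro tendsto_intros; blast)
      show "integrable lebesgue (\<lambda>t. \<beta> / 2 * ((fst (x (r k)) t)\<^sup>2 * (snd (x (r k)) t)\<^sup>2))" for k
        using int(2)[OF x] by (rule integrable_mult_right)
      show "integrable lebesgue (\<lambda>t. \<beta> / 2 * ((fst y t)\<^sup>2 * (snd y t)\<^sup>2))"
        using int(2)[OF y] by (rule integrable_mult_right)
    qed (use \<beta> in auto)
    then show ?thesis unfolding Q_def by (simp only: integral_mult_right_zero)
  qed
  moreover have "a / 2 + b / 2 + p / 4 + q \<le> c"
  proof (rule LIMSEQ_le_const2)
    show "(\<lambda>k. H10_norm2 \<Omega> (fst (x (r k))) / 2 + H10_norm2 \<Omega> (snd (x (r k))) / 2 + P (x (r k)) / 4 + \<beta> / 2 * Q (x (r k)))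
        \<longlonglongrightarrow> a / 2 + b / 2 + p / 4 + q"
      by (intro tendsto_add tendsto_divide tendsto_const lims) auto
    show "\<exists>N. \<forall>k\<ge>N. H10_norm2 \<Omega> (fst (x (r k))) / 2 + H10_norm2 \<Omega> (snd (x (r k))) / 2 + P (x (r k)) / 4 + \<beta> / 2 * Q (x (r k)) \<le> c"
      using c by (simp add: J[OF x])
  qed
  ultimately show ?thesis unfolding J[OF y] by argo
qed

lemma J_inf_le_iff: "J_inf \<Omega> w \<le> ereal c \<longleftrightarrow> (\<forall>\<beta>>0. J \<Omega> \<beta> w \<le> c)"
  by (auto simp: J_inf_def SUP_le_iff)

lemma J_le_J_inf: "\<beta> > 0 \<Longrightarrow> ereal (J \<Omega> \<beta> w) \<le> J_inf \<Omega> w"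
  unfolding J_inf_def by (intro SUP_upper) simp

text \<open>The working form of a lower bound for the genus, free of \<open>LEAST\<close>; when no
  odd map exists, both sides hold, because the genus is then infinite.\<close>

lemma genus2_ge_iff: "enat k \<le> genus2 \<Omega> A \<longleftrightarrow> (\<forall>m f. genus_map \<Omega> A m f \<longrightarrow> k \<le> m)"
proof (cases "\<exists>m f. genus_map \<Omega> A m f")
  case True
  let ?P = "\<lambda>m. \<exists>f. genus_map \<Omega> A m f"
  have "enat k \<le> genus2 \<Omega> A \<longleftrightarrow> k \<le> (LEAST m. ?P m)" using True by (simp add: genus2_def)
  also have "\<dots> \<longleftrightarrow> (\<forall>m. ?P m \<longrightarrow> k \<le> m)"
    using True LeastI_ex[of ?P] Least_le[of ?P] order_trans by blast
  finally show ?thesis by blast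
qed (auto simp: genus2_def)

section \<open>Upper limits of sets of large genus\<close>

text \<open>The upper limit as a set of cluster points. Without subsequences, its closedness and its
  invariance under \<open>swap_uv\<close> become epsilon arguments. Dependent choice provides the
  strictly increasing indices for the converse.\<close>

lemma L2_limsup_iff:
  "x \<in> L2_limsup \<Omega> A \<longleftrightarrow> x \<in> M \<Omega> \<and> (\<forall>N. \<forall>e>0. \<exists>n>N. \<exists>z\<in>A n. dist2 \<Omega> z x < e)"
proof
  assume "x \<in> L2_limsup \<Omega> A"
  then obtain r xs where x: "x \<in> M \<Omega>" and r: "strict_mono (r :: nat \<Rightarrow> nat)" "\<And>j. xs j \<in> A (r j)"
    and lim: "(\<lambda>j. dist2 \<Omega> (xs j) x) \<longlonglongrightarrow> 0" unfolding L2_limsup_def by blast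
  have "\<exists>n>N. \<exists>z\<in>A n. dist2 \<Omega> z x < e" if "e > 0" for N e
  proof -
    have "\<forall>\<^sub>F j in sequentially. dist2 \<Omega> (xs j) x < e" using lim that by (rule order_tendstoD)
    then obtain j0 where j0: "\<And>j. j \<ge> j0 \<Longrightarrow> dist2 \<Omega> (xs j) x < e" by (auto simp: eventually_sequentially)
    let ?j = "max j0 (Suc N)"
    have "r ?j > N" using seq_suble[OF r(1), of ?j] by linarith
    then show ?thesis using j0[of ?j] r(2)[of ?j] by auto
  qed
  with x show "x \<in> M \<Omega> \<and> (\<forall>N. \<forall>e>0. \<exists>n>N. \<exists>z\<in>A n. dist2 \<Omega> z x < e)" by blast
next
  assume R: "x \<in> M \<Omega> \<and> (\<forall>N. \<forall>e>0. \<exists>n>N. \<exists>z\<in>A n. dist2 \<Omega> z x < e)"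
  define P where "P j p \<longleftrightarrow> snd p \<in> A (fst p) \<and> dist2 \<Omega> (snd p) x < inverse (real (Suc j))" for j p
  have step: "\<exists>p. P j p \<and> N < fst p" for j N
  proof -
    have "inverse (real (Suc j)) > 0" by simp
    then obtain n z where "n > N" "z \<in> A n" "dist2 \<Omega> z x < inverse (real (Suc j))" using R by blast
    then have "P j (n, z) \<and> N < fst (n, z)" by (simp add: P_def)
    then show ?thesis ..
  qed
  have "\<exists>p. \<forall>j. P j (p j) \<and> fst (p j) < fst (p (Suc j))"
  proof (rule dependent_nat_choice)
    show "\<exists>p. P 0 p" using step by blast
    show "\<exists>q. P (Suc j) q \<and> fst p < fst q" for p j using step by blast
  qed
  then obtain p where p: "\<And>j. P j (p j)" "\<And>j. fst (p j) < fst (p (Suc j))" by blast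
  have "strict_mono (\<lambda>j. fst (p j))" using p(2) by (simp add: strict_mono_Suc_iff)
  moreover have "\<forall>j. snd (p j) \<in> A (fst (p j))" using p(1) by (simp add: P_def)
  moreover have "(\<lambda>j. dist2 \<Omega> (snd (p j)) x) \<longlonglongrightarrow> 0"
  proof (rule Lim_null_comparison[OF _ LIMSEQ_inverse_real_of_nat])
    have "dist2 \<Omega> (snd (p j)) x \<le> inverse (real (Suc j))" for j using p(1)[of j] by (simp only: P_def less_imp_le)
    then show "\<forall>\<^sub>F j in sequentially. norm (dist2 \<Omega> (snd (p j)) x) \<le> inverse (real (Suc j))"
      by (simp only: real_norm_def abs_of_nonneg[OF dist2_nonneg] eventually_True)
  qed
  ultimately show "x \<in> L2_limsup \<Omega> A"
    unfolding L2_limsup_def mem_Collect_eq using R by (intro conjI exI[of _ "\<lambda>j. fst (p j)"] exI[of _ "\<lambda>j. snd (p j)"]) blast+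
qed

lemma FkD:
  assumes "A \<in> Fk \<Omega> k"
  shows "A \<subseteq> M \<Omega>" "\<And>x. x \<in> A \<Longrightarrow> swap_uv x \<in> A" "\<And>m f. genus_map \<Omega> A m f \<Longrightarrow> k \<le> m"
  using assms genus2_ge_iff[of k \<Omega> A] unfolding Fk_def F0_def L2_closed_in_M_def by blast+

lemma L2_limsup_in_F0:
  assumes \<Omega>: "open \<Omega>" and A: "\<And>n. A n \<in> Fk \<Omega> k"
  shows "L2_limsup \<Omega> A \<in> F0 \<Omega>"
proof -
  have sub: "L2_limsup \<Omega> A \<subseteq> M \<Omega>" by (auto simp: L2_limsup_iff)
  have closed: "x \<in> L2_limsup \<Omega> A" if x: "x \<in> M \<Omega>" and near: "\<And>e. e > 0 \<Longrightarrow> \<exists>y\<in>L2_limsup \<Omega> A. dist2 \<Omega> x y < e" for x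
    unfolding L2_limsup_iff
  proof (intro conjI x allI impI)
    fix N and e :: real assume "e > 0"
    then have e2: "e / 2 > 0" by simp
    obtain y where y: "y \<in> L2_limsup \<Omega> A" "dist2 \<Omega> x y < e / 2" using near[OF e2] by blast
    then obtain n z where z: "n > N" "z \<in> A n" "dist2 \<Omega> z y < e / 2" using e2 unfolding L2_limsup_iff by blast
    have m: "x \<in> M \<Omega>" "y \<in> M \<Omega>" "z \<in> M \<Omega>" using x y(1) sub z(2) FkD(1)[OF A] by blast+
    have "dist2 \<Omega> z x < e"
      using dist2_triangle[OF \<Omega> M_H10_pair[OF m(3)] M_H10_pair[OF m(2)] M_H10_pair[OF m(1)]]
        dist2_commute[OF \<Omega> M_H10_pair[OF m(2)] M_H10_pair[OF m(1)]] y(2) z(3) by linarith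
    then show "\<exists>n>N. \<exists>z\<in>A n. dist2 \<Omega> z x < e" using z by blast
  qed
  have swap: "swap_uv x \<in> L2_limsup \<Omega> A" if x: "x \<in> L2_limsup \<Omega> A" for x
    unfolding L2_limsup_iff
  proof (intro conjI allI impI)
    show "swap_uv x \<in> M \<Omega>" using that unfolding L2_limsup_iff by (blast intro: swap_M)
    fix N and e :: real assume "e > 0"
    then obtain n z where "n > N" "z \<in> A n" "dist2 \<Omega> z x < e" using x unfolding L2_limsup_iff by blast
    then show "\<exists>n>N. \<exists>z\<in>A n. dist2 \<Omega> z (swap_uv x) < e" using FkD(2)[OF A] dist2_swap by metis
  qed
  have "swap_uv ` L2_limsup \<Omega> A = L2_limsup \<Omega> A"
  proof
    show "swap_uv ` L2_limsup \<Omega> A \<subseteq> L2_limsup \<Omega> A" using swap by blast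
    show "L2_limsup \<Omega> A \<subseteq> swap_uv ` L2_limsup \<Omega> A"
    proof
      fix x assume "x \<in> L2_limsup \<Omega> A"
      then show "x \<in> swap_uv ` L2_limsup \<Omega> A" using swap swap_swap by (metis imageI)
    qed
  qed
  then show ?thesis using sub closed by (auto simp: F0_def L2_closed_in_M_def)
qed

proposition L2_limsup_upper_bound:
  fixes \<Omega> :: "(real^'n) set"
  assumes \<Omega>: "open \<Omega>" "bounded \<Omega>" and n: "CARD('n) = 2 \<or> CARD('n) = 3"
    and A: "\<And>n. A n \<in> Fk \<Omega> k" and \<beta>s: "\<And>n. 0 < \<beta>s n" "filterlim \<beta>s at_top sequentially"
    and J: "\<And>n w. w \<in> A n \<Longrightarrow> J \<Omega> (\<beta>s n) w \<le> a n" and a: "a \<longlonglongrightarrow> L"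
  shows "L2_limsup \<Omega> A \<in> Fk \<Omega> k" "\<And>w. w \<in> L2_limsup \<Omega> A \<Longrightarrow> J_inf \<Omega> w \<le> ereal L"
proof -
  let ?K = "L2_limsup \<Omega> A"
  have KM: "?K \<subseteq> M \<Omega>" by (auto simp: L2_limsup_iff)
  have F0: "?K \<in> F0 \<Omega>" by (rule L2_limsup_in_F0[OF \<Omega>(1) A])
  show J_K: "J_inf \<Omega> w \<le> ereal L" if w: "w \<in> ?K" for w
    unfolding J_inf_le_iff
  proof (intro allI impI)
    fix \<beta> :: real assume \<beta>: "\<beta> > 0"
    obtain r xs where r: "strict_mono (r :: nat \<Rightarrow> nat)" and xs: "\<And>j. xs j \<in> A (r j)"
      and lim: "(\<lambda>j. dist2 \<Omega> (xs j) w) \<longlonglongrightarrow> 0" using w unfolding L2_limsup_def by blast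
    have H: "xs j \<in> H10_pair \<Omega>" for j using FkD(1)[OF A] xs M_H10_pair by blast
    show "J \<Omega> \<beta> w \<le> L"
    proof (rule field_le_epsilon)
      fix e :: real assume "e > 0"
      have "\<forall>\<^sub>F n in sequentially. \<beta> \<le> \<beta>s n" using \<beta>s(2) by (simp add: filterlim_at_top)
      moreover have "\<forall>\<^sub>F n in sequentially. a n < L + e" using a \<open>e > 0\<close> by (intro order_tendstoD) auto
      ultimately have "\<forall>\<^sub>F n in sequentially. \<beta> \<le> \<beta>s n \<and> a n < L + e" by eventually_elim simp
      then obtain N where N: "\<And>n. n \<ge> N \<Longrightarrow> \<beta> \<le> \<beta>s n \<and> a n < L + e" by (auto simp: eventually_sequentially)
      \<comment> \<open>Beyond \<open>N\<close> the coupling \<open>\<beta>s n\<close> exceeds the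
        fixed \<beta>, so monotonicity passes the energy bound to \<open>J \<Omega> \<beta>\<close>.
        The shift by \<open>N\<close> works because \<open>r i \<ge> i\<close>.\<close>
      have le: "J \<Omega> \<beta> (xs (j + N)) \<le> L + e" for j
      proof -
        have "r (j + N) \<ge> N" using seq_suble[OF r, of "j + N"] by linarith
        from N[OF this] show ?thesis
          using J_mono[OF \<Omega>(1) H[of "j + N"], of \<beta> "\<beta>s (r (j + N))"] J[OF xs[of "j + N"]] by linarith
      qed
      show "J \<Omega> \<beta> w \<le> L + e"
        by (rule J_lsc[OF \<Omega>(1) n less_imp_le[OF \<beta>] H M_H10_pair[OF subsetD[OF KM w]] LIMSEQ_ignore_initial_segment[OF lim] le])
    qed
  qed
  have "k \<le> m" if f: "genus_map \<Omega> ?K m f" for m f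
  proof -
    have comp: "\<exists>r x. strict_mono (r :: nat \<Rightarrow> nat) \<and> x \<in> ?K \<and> (\<lambda>n. dist2 \<Omega> (s (r n)) x) \<longlonglongrightarrow> 0"
      if s: "\<And>n. s n \<in> ?K" for s
    proof -
      have sM: "s n \<in> M \<Omega>" for n using s KM by blast
      \<comment> \<open>Any positive coupling controls the Dirichlet energies; the value 1 is taken
        to obtain compactness of \<open>?K\<close>.\<close>
      have "J \<Omega> 1 (s n) \<le> L" for n using J_K[OF s[of n]] unfolding J_inf_le_iff by simp
      then have nb: "H10_norm2 \<Omega> (fst (s n)) \<le> 2 * L" "H10_norm2 \<Omega> (snd (s n)) \<le> 2 * L" for n
        using H10_norm2_le_J[OF \<Omega>(1) M_H10_pair[OF sM[of n]], of 1] by (smt (verit))+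
      obtain r y where r: "strict_mono (r :: nat \<Rightarrow> nat)" and y: "y \<in> M \<Omega>" and lim: "(\<lambda>n. dist2 \<Omega> (s (r n)) y) \<longlonglongrightarrow> 0"
        by (rule M_compact[of \<Omega> s, OF \<Omega> sM nb])
      have "\<exists>z\<in>?K. dist2 \<Omega> y z < e" if "e > 0" for e
      proof -
        have "\<forall>\<^sub>F n in sequentially. dist2 \<Omega> (s (r n)) y < e" using lim that by (rule order_tendstoD)
        then obtain n where "dist2 \<Omega> (s (r n)) y < e" by (auto simp: eventually_sequentially)
        then have "dist2 \<Omega> y (s (r n)) < e"
          using dist2_commute[OF \<Omega>(1) M_H10_pair[OF y] M_H10_pair[OF sM]] by simp
        then show ?thesis using s by blast
      qed
      then have "y \<in> ?K" using F0 y unfolding F0_def L2_closed_in_M_def by blast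
      then show ?thesis using r lim by blast
    qed
    have f_cont: "\<exists>\<delta>>0. \<forall>y\<in>?K. dist2 \<Omega> x y < \<delta> \<longrightarrow> \<bar>f x i - f y i\<bar> < e" if x: "x \<in> ?K" and e: "e > 0" and i: "i < m" for x e i
    proof -
      obtain \<delta> where \<delta>: "\<delta> > 0" "\<And>y. y \<in> ?K \<Longrightarrow> dist2 \<Omega> x y < \<delta> \<Longrightarrow> sqrt (\<Sum>i<m. (f x i - f y i)\<^sup>2) < e"
        using f x e unfolding genus_map_def by blast
      have "\<bar>f x i - f y i\<bar> \<le> sqrt (\<Sum>i<m. (f x i - f y i)\<^sup>2)" for y
      proof -
        have "(f x i - f y i)\<^sup>2 \<le> (\<Sum>i<m. (f x i - f y i)\<^sup>2)" using i by (intro member_le_sum) auto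
        from real_sqrt_le_mono[OF this] show ?thesis by simp
      qed
      then show ?thesis using \<delta> by (meson le_less_trans)
    qed
    have d_sym: "dist2 \<Omega> x y = dist2 \<Omega> y x" if "x \<in> M \<Omega>" "y \<in> M \<Omega>" for x y
      by (rule dist2_commute[OF \<Omega>(1) M_H10_pair[OF that(1)] M_H10_pair[OF that(2)]])
    have d_tri: "dist2 \<Omega> x z \<le> dist2 \<Omega> x y + dist2 \<Omega> y z" if "x \<in> M \<Omega>" "y \<in> M \<Omega>" "z \<in> M \<Omega>" for x y z
      by (rule dist2_triangle[OF \<Omega>(1) M_H10_pair[OF that(1)] M_H10_pair[OF that(2)] M_H10_pair[OF that(3)]])
    have sK: "swap_uv x \<in> ?K" if "x \<in> ?K" for x using F0 that unfolding F0_def by blast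
    have f_nz: "\<exists>i<m. f x i \<noteq> 0" and f_odd: "f (swap_uv x) i = - f x i" if "x \<in> ?K" for x i
      using f that unfolding genus_map_def by blast+
    obtain \<epsilon> B G where \<epsilon>: "0 < \<epsilon>" "0 \<le> B" and G: "\<And>x i. G (swap_uv x) i = - G x i" "\<And>x i. m \<le> i \<Longrightarrow> G x i = (0 :: real)"
      "\<And>x p. x \<in> M \<Omega> \<Longrightarrow> p \<in> ?K \<Longrightarrow> dist2 \<Omega> x p < \<epsilon> \<Longrightarrow> \<exists>i<m. G x i \<noteq> 0"
      "\<And>x y i. x \<in> M \<Omega> \<Longrightarrow> y \<in> M \<Omega> \<Longrightarrow> \<bar>G x i - G y i\<bar> \<le> B * dist2 \<Omega> x y"
      by (rule odd_map_near_compact[where Z = "M \<Omega>" and d = "dist2 \<Omega>" and \<sigma> = swap_uv and K = ?K and f = f and m = m,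
            OF d_sym dist2_nonneg d_tri swap_M swap_swap dist2_swap KM sK comp f_nz f_odd f_cont])
        (assumption | (rule that; blast) | blast)+
    \<comment> \<open>Otherwise each \<open>A n\<close> has a point \<open>w n\<close> at distance
      at least \<epsilon> from \<open>?K\<close>. The energies bound these points in
      \<open>H10\<close>, so a subsequence converges in \<open>M\<close>, and its limit belongs to
      \<open>?K\<close> by the very definition of the upper limit.\<close>
    have "\<exists>n. \<forall>w\<in>A n. \<exists>p\<in>?K. dist2 \<Omega> w p < \<epsilon>"
    proof (rule ccontr)
      assume "\<not> ?thesis"
      then have "\<forall>n. \<exists>w. w \<in> A n \<and> (\<forall>p\<in>?K. \<not> dist2 \<Omega> w p < \<epsilon>)" by blast
      from choice[OF this] obtain w where w: "\<And>n. w n \<in> A n" "\<And>n p. p \<in> ?K \<Longrightarrow> \<not> dist2 \<Omega> (w n) p < \<epsilon>" by blast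
      have wM: "w n \<in> M \<Omega>" for n using w(1) FkD(1)[OF A] by blast
      obtain b where b: "\<And>n. a n \<le> b"
        using convergent_imp_Bseq[OF convergentI[OF a]] unfolding Bseq_def by (auto simp: abs_le_iff)
      have nb: "H10_norm2 \<Omega> (fst (w n)) \<le> 2 * b" "H10_norm2 \<Omega> (snd (w n)) \<le> 2 * b" for n
        using H10_norm2_le_J[OF \<Omega>(1) M_H10_pair[OF wM[of n]] less_imp_le[OF \<beta>s(1)[of n]]] J[OF w(1)[of n]] b[of n]
        by linarith+
      obtain r y where r: "strict_mono (r :: nat \<Rightarrow> nat)" and y: "y \<in> M \<Omega>" and lim: "(\<lambda>n. dist2 \<Omega> (w (r n)) y) \<longlonglongrightarrow> 0"
        by (rule M_compact[of \<Omega> w, OF \<Omega> wM nb])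
      have "y \<in> ?K" unfolding L2_limsup_def mem_Collect_eq
        using y r lim w(1) by (intro conjI exI[of _ r] exI[of _ "\<lambda>n. w (r n)"]) blast+
      moreover have "\<forall>\<^sub>F n in sequentially. dist2 \<Omega> (w (r n)) y < \<epsilon>" using lim \<epsilon>(1) by (rule order_tendstoD)
      then obtain n where "dist2 \<Omega> (w (r n)) y < \<epsilon>" by (auto simp: eventually_sequentially)
      ultimately show False using w(2) by blast
    qed
    then obtain n where near: "\<And>w. w \<in> A n \<Longrightarrow> \<exists>p\<in>?K. dist2 \<Omega> w p < \<epsilon>" by blast
    have AM: "A n \<subseteq> M \<Omega>" by (rule FkD(1)[OF A])
    have "genus_map \<Omega> (A n) m G"
      unfolding genus_map_def
    proof (intro conjI ballI allI impI)
      show "G x i = 0" if "m \<le> i" for x i by (rule G(2)[OF that])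
      show "\<exists>i<m. G x i \<noteq> 0" if "x \<in> A n" for x using near[OF that] G(3) AM that by blast
      show "G (swap_uv x) i = - G x i" for x i by (rule G(1))
      fix x and e :: real assume x: "x \<in> A n" and e: "0 < e"
      \<comment> \<open>The Lipschitz constant of the whole vector \<open>G\<close> is at most
        \<open>real m * B\<close>; the summand 1 keeps the denominator positive.\<close>
      define \<delta> where "\<delta> = e / (real m * B + 1)"
      have mB: "0 \<le> real m * B" using \<epsilon>(2) by simp
      have "\<delta> > 0" using e mB by (simp add: \<delta>_def)
      moreover have "sqrt (\<Sum>i<m. (G x i - G y i)\<^sup>2) < e" if y: "y \<in> A n" and d: "dist2 \<Omega> x y < \<delta>" for y
      proof -
        have "sqrt (\<Sum>i<m. (G x i - G y i)\<^sup>2) \<le> (\<Sum>i<m. \<bar>G x i - G y i\<bar>)"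
          using L2_set_le_sum_abs[of "\<lambda>i. G x i - G y i" "{..<m}"] by (simp add: L2_set_def)
        also have "\<dots> \<le> (\<Sum>i<m. B * dist2 \<Omega> x y)" using G(4) x y AM by (intro sum_mono) blast
        also have "\<dots> = real m * B * dist2 \<Omega> x y" by simp
        also have "\<dots> \<le> real m * B * \<delta>" using mB d by (intro mult_left_mono) auto
        also have "\<dots> < (real m * B + 1) * \<delta>" using \<open>\<delta> > 0\<close> by (simp add: distrib_right)
        also have "\<dots> = e" using mB by (simp add: \<delta>_def)
        finally show ?thesis .
      qed
      ultimately show "\<exists>d>0. \<forall>y\<in>A n. dist2 \<Omega> x y < d \<longrightarrow> sqrt (\<Sum>i<m. (G x i - G y i)\<^sup>2) < e" by blast
    qed
    then show "k \<le> m" by (rule FkD(3)[OF A])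
  qed
  then show "?K \<in> Fk \<Omega> k" unfolding Fk_def mem_Collect_eq genus2_ge_iff using F0 by blast
qed

section \<open>Sets of large genus with finite energy\<close>

lemma max_0_square_derivative:
  "((\<lambda>t::real. (max 0 t)\<^sup>2) has_real_derivative 2 * max 0 t) (at t)"
proof -
  consider "t > 0" | "t < 0" | "t = 0" by linarith
  then show ?thesis
  proof cases
    case 1
    have "((\<lambda>t::real. t\<^sup>2) has_real_derivative 2 * t) (at t)" by (auto intro!: derivative_eq_intros)
    then have "((\<lambda>t::real. (max 0 t)\<^sup>2) has_real_derivative 2 * t) (at t)"
      by (rule has_field_derivative_transform_within_open[of _ _ _ "{0<..}"]) (use 1 in auto)
    then show ?thesis using 1 by simp
  next
    case 2
    have "((\<lambda>t::real. 0) has_real_derivative 0) (at t)" by simp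
    then have "((\<lambda>t::real. (max 0 t)\<^sup>2) has_real_derivative 0) (at t)"
      by (rule has_field_derivative_transform_within_open[of _ _ _ "{..<0}"]) (use 2 in auto)
    then show ?thesis using 2 by simp
  next
    case 3
    have "((\<lambda>h. ((max 0 h)\<^sup>2 - (max 0 0)\<^sup>2) / (h - 0)) \<longlongrightarrow> (0::real)) (at 0)"
    proof (rule Lim_null_comparison)
      have "norm (((max 0 h)\<^sup>2 - (max 0 0)\<^sup>2) / (h - 0)) \<le> \<bar>h\<bar>" for h :: real
        by (cases "h \<le> 0") (auto simp: power2_eq_square)
      then show "\<forall>\<^sub>F h in at 0. norm (((max 0 h)\<^sup>2 - (max 0 0)\<^sup>2) / (h - 0)) \<le> \<bar>h :: real\<bar>" by simp
      show "((\<lambda>h. \<bar>h\<bar>) \<longlongrightarrow> (0::real)) (at 0)" using tendsto_rabs_zero[OF tendsto_ident_at] .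
    qed
    then show ?thesis using 3 by (simp add: has_field_derivative_iff)
  qed
qed

text \<open>A truncated paraboloid, squared: the square makes it continuously differentiable across
  the boundary of the ball, which is the smoothness that \<open>C1c_grad\<close> asks for.\<close>

definition bump :: "'a::real_inner \<Rightarrow> real \<Rightarrow> 'a \<Rightarrow> real" where
  "bump c r x = (max 0 (r\<^sup>2 - (x - c) \<bullet> (x - c)))\<^sup>2"

lemma bump_eq_0: "r > 0 \<Longrightarrow> x \<notin> ball c r \<Longrightarrow> bump c r x = 0"
proof -
  assume "r > 0" "x \<notin> ball c r"
  then have "r\<^sup>2 \<le> (norm (x - c))\<^sup>2" by (intro power_mono) (auto simp: dist_norm norm_minus_commute)
  then show ?thesis by (simp add: bump_def power2_norm_eq_inner)
qed

lemma bump_pos: "x \<in> ball c r \<Longrightarrow> bump c r x > 0"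
proof -
  assume "x \<in> ball c r"
  then have "norm (x - c) < r" by (simp add: dist_norm norm_minus_commute)
  then have "(norm (x - c))\<^sup>2 < r\<^sup>2" by (intro power_strict_mono) auto
  then show ?thesis by (simp add: bump_def power2_norm_eq_inner)
qed

lemma C1c_grad_bump:
  fixes c :: "real^'n"
  assumes "r > 0" "cball c r \<subseteq> \<Omega>"
  shows "C1c_grad \<Omega> (bump c r) (\<lambda>x. (- 4 * max 0 (r\<^sup>2 - (x - c) \<bullet> (x - c))) *\<^sub>R (x - c))"
proof (rule C1c_gradI[of _ _ "cball c r"])
  show "continuous_on UNIV (\<lambda>x. (- 4 * max 0 (r\<^sup>2 - (x - c) \<bullet> (x - c))) *\<^sub>R (x - c))"
    by (intro continuous_intros)
  show "bump c r x = 0" if "x \<notin> cball c r" for x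
    using that by (intro bump_eq_0[OF assms(1)]) auto
  fix x
  let ?q = "\<lambda>x. r\<^sup>2 - (x - c) \<bullet> (x - c)"
  have q: "(?q has_derivative (\<lambda>h. - 2 * ((x - c) \<bullet> h))) (at x)"
    by (auto intro!: derivative_eq_intros simp: inner_commute)
  have "((\<lambda>t. (max 0 t)\<^sup>2) has_derivative (\<lambda>h. 2 * max 0 (?q x) * h)) (at (?q x))"
    using max_0_square_derivative[of "?q x"] unfolding has_field_derivative_def .
  from diff_chain_at[OF q this]
  have "((\<lambda>x. (max 0 (?q x))\<^sup>2) has_derivative (\<lambda>h. 2 * max 0 (?q x) * (- 2 * ((x - c) \<bullet> h)))) (at x)"
    by (simp add: o_def)
  then show "(bump c r has_derivative (\<lambda>h. ((- 4 * max 0 (?q x)) *\<^sub>R (x - c)) \<bullet> h)) (at x)"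
    by (simp add: bump_def[abs_def] algebra_simps)
qed (use assms in auto)

lemma l2_bump_pos:
  fixes c :: "real^'n"
  assumes "r > 0"
  shows "l2 lebesgue (bump c r) > 0"
proof (rule ccontr)
  assume "\<not> ?thesis"
  then have "l2 lebesgue (bump c r) = 0" using l2_nonneg[of lebesgue "bump c r"] by linarith
  then have "AE x in lebesgue. bump c r x = 0"
    using l2_eq_0_iff[OF C1c_grad_l2s(1)[OF C1c_grad_bump[OF assms, of c UNIV]]] by simp
  then have "AE x in lebesgue. x \<notin> ball c r"
    by eventually_elim (use bump_pos[of _ c r] in force)
  then have "ball c r \<in> null_sets lebesgue"
    by (subst AE_iff_null_sets) auto
  then have "negligible (ball c r)" by (simp add: negligible_iff_null_sets)
  then show False using open_not_negligible[of "ball c r"] assms by simp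
qed

lemma disjoint_bumps:
  fixes \<Omega> :: "(real^'n) set" and K :: nat
  assumes "open \<Omega>" "\<Omega> \<noteq> {}"
  obtains p dp where "\<And>j. j < K \<Longrightarrow> C1c_grad \<Omega> (p j) (dp j)" "\<And>j x. 0 \<le> p j x" "\<And>j. j < K \<Longrightarrow> l2 lebesgue (p j) = 1"
    "\<And>i j x. i \<noteq> j \<Longrightarrow> p i x * p j x = (0::real)"
proof -
  obtain x0 \<rho> where \<rho>: "\<rho> > 0" "ball x0 \<rho> \<subseteq> \<Omega>" using assms open_contains_ball by blast
  obtain e :: "real^'n" where e: "norm e = 1" using vector_choose_size[of 1] by auto
  \<comment> \<open>\<open>K\<close> centres at spacing \<delta> along a segment from
    \<open>x0\<close>, with radius \<open>\<delta> / 3\<close>. Different balls are disjoint because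
    \<open>2 * r < \<delta>\<close>, and all of them lie inside the ball of radius
    \<open>(K + 2) * \<delta> = \<rho>\<close>.\<close>
  define \<delta> where "\<delta> = \<rho> / (real K + 2)"
  have \<delta>: "\<delta> > 0" using \<rho>(1) by (simp add: \<delta>_def)
  define c where "c j = x0 + (real j * \<delta>) *\<^sub>R e" for j :: nat
  define r where "r = \<delta> / 3"
  have r: "r > 0" using \<delta> by (simp add: r_def)
  have sub: "cball (c j) r \<subseteq> \<Omega>" if "j < K" for j
  proof
    fix x assume "x \<in> cball (c j) r"
    then have xr: "norm (x - c j) \<le> r" by (simp add: dist_norm norm_minus_commute)
    have eq: "x - x0 = (x - c j) + (real j * \<delta>) *\<^sub>R e" by (simp add: c_def)
    have "norm ((real j * \<delta>) *\<^sub>R e) = real j * \<delta>" using e \<delta> by simp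
    then have "norm (x - x0) \<le> r + real j * \<delta>"
      unfolding eq using norm_triangle_ineq[of "x - c j" "(real j * \<delta>) *\<^sub>R e"] xr by linarith
    also have "\<dots> < (real K + 2) * \<delta>"
    proof -
      have "real j * \<delta> \<le> real K * \<delta>" using that \<delta> by (intro mult_right_mono) auto
      moreover have "r < 2 * \<delta>" using \<delta> by (simp add: r_def)
      ultimately show ?thesis by (simp add: distrib_right)
    qed
    also have "\<dots> = \<rho>" by (simp add: \<delta>_def)
    finally show "x \<in> \<Omega>" using \<rho>(2) by (auto simp: dist_norm norm_minus_commute)
  qed
  have disj: "bump (c i) r x * bump (c j) r x = 0" if "i \<noteq> j" for i j x
  proof (rule ccontr)
    assume "bump (c i) r x * bump (c j) r x \<noteq> 0"
    then have "x \<in> ball (c i) r" "x \<in> ball (c j) r" using bump_eq_0[OF r] by auto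
    then have "dist (c i) (c j) < 2 * r"
      using dist_triangle_less_add[of "c i" x r "c j" r] by (simp add: dist_commute)
    moreover have "c i - c j = ((real i - real j) * \<delta>) *\<^sub>R e" by (simp add: c_def algebra_simps)
    then have "dist (c i) (c j) = \<bar>real i - real j\<bar> * \<delta>" using e \<delta> by (simp add: dist_norm abs_mult)
    moreover have "\<bar>real i - real j\<bar> \<ge> 1" using that by linarith
    then have "\<bar>real i - real j\<bar> * \<delta> \<ge> 1 * \<delta>" using \<delta> by (intro mult_right_mono) auto
    ultimately show False using \<delta> by (simp add: r_def)
  qed
  define m where "m j = inverse (l2 lebesgue (bump (c j) r))" for j
  have m: "m j > 0" for j using l2_bump_pos[OF r] by (simp add: m_def)
  show ?thesis
  proof (rule that[of "\<lambda>j x. m j * bump (c j) r x" "\<lambda>j x. m j *\<^sub>R ((- 4 * max 0 (r\<^sup>2 - (x - c j) \<bullet> (x - c j))) *\<^sub>R (x - c j))"])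
    show "C1c_grad \<Omega> (\<lambda>x. m j * bump (c j) r x) (\<lambda>x. m j *\<^sub>R ((- 4 * max 0 (r\<^sup>2 - (x - c j) \<bullet> (x - c j))) *\<^sub>R (x - c j)))" if "j < K" for j
      by (rule C1c_grad_cmult[OF C1c_grad_bump[OF r sub[OF that]]])
    show "0 \<le> m j * bump (c j) r x" for j x using m[of j] by (simp add: bump_def)
    show "l2 lebesgue (\<lambda>x. m j * bump (c j) r x) = 1" for j
      using l2_scaleR[of lebesgue "m j" "bump (c j) r"] m[of j] l2_bump_pos[OF r, of "c j"] by (simp add: m_def)
    show "m i * bump (c i) r x * (m j * bump (c j) r x) = 0" if "i \<noteq> j" for i j x
      using disj[OF that, of x] by auto
  qed
qed

section \<open>A sphere of pairs with disjoint supports\<close>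

lemma C1c_grad_sum:
  assumes "\<And>j. j < (K :: nat) \<Longrightarrow> C1c_grad \<Omega> (p j) (dp j)"
  shows "C1c_grad \<Omega> (\<lambda>x. \<Sum>j<K. c j * p j x) (\<lambda>x. \<Sum>j<K. c j *\<^sub>R dp j x)"
  using assms
proof (induction K)
  case 0
  show ?case by (rule C1c_gradI[of _ _ "{}"]) auto
next
  case (Suc K)
  then show ?case using C1c_grad_add[OF Suc.IH C1c_grad_cmult[of \<Omega> "p K" "dp K" "c K"]] by simp
qed

lemma l2_sum_le:
  assumes "\<And>j. j < (K :: nat) \<Longrightarrow> l2s N (f j)"
  shows "l2s N (\<lambda>x. \<Sum>j<K. c j *\<^sub>R f j x)" "l2 N (\<lambda>x. \<Sum>j<K. c j *\<^sub>R f j x) \<le> (\<Sum>j<K. \<bar>c j\<bar> * l2 N (f j))"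
proof -
  have "l2s N (\<lambda>x. \<Sum>j<K. c j *\<^sub>R f j x) \<and> l2 N (\<lambda>x. \<Sum>j<K. c j *\<^sub>R f j x) \<le> (\<Sum>j<K. \<bar>c j\<bar> * l2 N (f j))"
    using assms
  proof (induction K)
    case 0
    show ?case by (simp add: l2s_def l2_def)
  next
    case (Suc K)
    then have IH: "l2s N (\<lambda>x. \<Sum>j<K. c j *\<^sub>R f j x)" "l2 N (\<lambda>x. \<Sum>j<K. c j *\<^sub>R f j x) \<le> (\<Sum>j<K. \<bar>c j\<bar> * l2 N (f j))"
      and f: "l2s N (f K)" by auto
    show ?case
      using l2s_add[OF IH(1) l2s_scaleR[OF f, of "c K"]] l2_triangle[OF IH(1) l2s_scaleR[OF f, of "c K"]] IH(2)
      by (simp add: l2_scaleR)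
  qed
  then show "l2s N (\<lambda>x. \<Sum>j<K. c j *\<^sub>R f j x)" "l2 N (\<lambda>x. \<Sum>j<K. c j *\<^sub>R f j x) \<le> (\<Sum>j<K. \<bar>c j\<bar> * l2 N (f j))" by auto
qed

lemma l2_disjoint_sum:
  fixes p :: "nat \<Rightarrow> 'a \<Rightarrow> real"
  assumes p: "\<And>j. j < K \<Longrightarrow> l2s N (p j)" and disj: "\<And>i j x. i \<noteq> j \<Longrightarrow> p i x * p j x = 0"
  shows "(l2 N (\<lambda>x. \<Sum>j<K. c j * p j x))\<^sup>2 = (\<Sum>j<K. (c j)\<^sup>2 * (l2 N (p j))\<^sup>2)"
  using p
proof (induction K)
  case 0
  show ?case by (simp add: l2_def)
next
  case (Suc K)
  have s: "l2s N (\<lambda>x. \<Sum>j<K. c j * p j x)" using l2_sum_le(1)[of K N p c] Suc.prems by simp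
  have t: "l2s N (\<lambda>x. c K * p K x)" using l2s_scaleR[OF Suc.prems[of K], of "c K"] by simp
  have "(\<lambda>x. (\<Sum>j<K. c j * p j x) \<bullet> (c K * p K x)) = (\<lambda>x. 0)"
  proof
    fix x
    have "(\<Sum>j<K. c j * p j x) * (c K * p K x) = (\<Sum>j<K. (c j * c K) * (p j x * p K x))"
      unfolding sum_distrib_right by (intro sum.cong refl) (simp add: ac_simps)
    also have "\<dots> = 0" by (intro sum.neutral) (use disj in auto)
    finally show "(\<Sum>j<K. c j * p j x) \<bullet> (c K * p K x) = 0" by simp
  qed
  then have "(l2 N (\<lambda>x. (\<Sum>j<K. c j * p j x) + c K * p K x))\<^sup>2 = (l2 N (\<lambda>x. \<Sum>j<K. c j * p j x))\<^sup>2 + (l2 N (\<lambda>x. c K * p K x))\<^sup>2"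
    using l2_add_square[OF s t] by simp
  moreover have "l2 N (\<lambda>x. c K * p K x) = \<bar>c K\<bar> * l2 N (p K)" using l2_scaleR[of N "c K" "p K"] by simp
  ultimately show ?case using Suc by (simp add: power_mult_distrib)
qed

text \<open>Members of \<open>M\<close> are nonnegative, so a signed coordinate \<open>a i\<close>
  needs two bumps: number \<open>2 * i\<close> receives its positive part and number
  \<open>2 * i + 1\<close> its negative part. The squares of the two parts add up to the square of
  \<open>a i\<close>, so the division by the Euclidean norm gives unit norm.\<close>

definition sphere_coef :: "nat \<Rightarrow> (nat \<Rightarrow> real) \<Rightarrow> nat \<Rightarrow> real" where
  "sphere_coef n a j = max 0 (if even j then a (j div 2) else - a (j div 2)) / sqrt (\<Sum>i\<le>n. (a i)\<^sup>2)"

lemma sphere_coef_nonneg: "0 \<le> sphere_coef n a j"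
  by (simp add: sphere_coef_def sum_nonneg)

lemma sphere_coef_disjoint: "sphere_coef n a j * sphere_coef n (antipode a) j = 0"
  by (auto simp: sphere_coef_def max_def)

lemma punctured_norm_pos:
  assumes "a \<in> punctured n"
  shows "(\<Sum>i\<le>n. (a i)\<^sup>2) > 0"
proof -
  obtain i where i: "a i \<noteq> 0" "i \<le> n" using assms by (auto simp: punctured_def) (meson not_le)
  then show ?thesis by (intro sum_pos2[of _ i]) auto
qed

lemma sphere_coef_sum:
  assumes "a \<in> punctured n"
  shows "(\<Sum>j<2 * Suc n. (sphere_coef n a j)\<^sup>2) = 1"
proof -
  let ?s = "\<Sum>i\<le>n. (a i)\<^sup>2"
  have pos: "?s > 0" by (rule punctured_norm_pos[OF assms])
  have sq: "(max 0 x)\<^sup>2 + (max 0 (- x))\<^sup>2 = x\<^sup>2" for x :: real by (auto simp: max_def)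
  have "(\<Sum>j<2 * m. (max 0 (if even j then a (j div 2) else - a (j div 2)))\<^sup>2) = (\<Sum>i<m. (a i)\<^sup>2)" for m
  proof (induction m)
    case (Suc m)
    then show ?case using sq[of "a m"] by simp
  qed simp
  then have "(\<Sum>j<2 * Suc n. (max 0 (if even j then a (j div 2) else - a (j div 2)))\<^sup>2) = ?s"
    by (simp only: lessThan_Suc_atMost)
  moreover have "(sphere_coef n a j)\<^sup>2 = (max 0 (if even j then a (j div 2) else - a (j div 2)))\<^sup>2 / ?s" for j
    using pos by (simp only: sphere_coef_def power_divide real_sqrt_pow2[OF less_imp_le])
  ultimately show ?thesis using pos by (simp only: sum_divide_distrib[symmetric]) simp
qed

lemma sphere_coef_le_1:
  assumes "a \<in> punctured n" "j < 2 * Suc n"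
  shows "sphere_coef n a j \<le> 1"
proof -
  have "(sphere_coef n a j)\<^sup>2 \<le> (\<Sum>j<2 * Suc n. (sphere_coef n a j)\<^sup>2)"
    using assms(2) by (intro member_le_sum) auto
  then have "(sphere_coef n a j)\<^sup>2 \<le> 1\<^sup>2" by (simp only: sphere_coef_sum[OF assms(1)]) simp
  then show ?thesis by (rule power2_le_imp_le) simp
qed

lemma continuous_on_sphere_coef:
  "continuous_on (punctured n) (\<lambda>a. sphere_coef n a j)" "continuous_on (punctured n) (\<lambda>a. sphere_coef n (antipode a) j)"
proof -
  have c: "continuous_on (punctured n) (\<lambda>a. a i)" for i
    by (rule continuous_on_subset[OF continuous_on_product_coordinates subset_UNIV])
  have nz: "sqrt (\<Sum>i\<le>n. (a i)\<^sup>2) \<noteq> 0" if "a \<in> punctured n" for a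
    using punctured_norm_pos[OF that] by simp
  show "continuous_on (punctured n) (\<lambda>a. sphere_coef n a j)"
    unfolding sphere_coef_def by (cases "even j") (auto intro!: continuous_intros c dest: nz)
  show "continuous_on (punctured n) (\<lambda>a. sphere_coef n (antipode a) j)"
    unfolding sphere_coef_def power2_minus by (cases "even j") (auto intro!: continuous_intros c dest: nz)
qed

lemma C1c_grad_H10_facts:
  assumes C: "C1c_grad \<Omega> \<phi> g" and \<Omega>: "open \<Omega>"
  shows "\<phi> \<in> H10 \<Omega>" "H10_norm2 \<Omega> \<phi> = (l2 lebesgue g)\<^sup>2" "L2norm \<Omega> \<phi> = l2 lebesgue \<phi>"
proof -
  show H: "\<phi> \<in> H10 \<Omega>" using C1c_grad_H10[OF C] by (auto simp: H10_def)
  show "H10_norm2 \<Omega> \<phi> = (l2 lebesgue g)\<^sup>2" by (rule H10_norm2_eq[OF C1c_grad_H10[OF C] \<Omega>])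
  show "L2norm \<Omega> \<phi> = l2 lebesgue \<phi>" by (rule L2norm_H10[OF \<Omega> H])
qed

lemma ladyzhenskaya_integral:
  fixes \<phi> :: "real^'n \<Rightarrow> real"
  assumes C: "C1c_grad \<Omega> \<phi> g" and n: "CARD('n) = 2 \<or> CARD('n) = 3"
  shows "(\<integral>x. \<phi> x ^ 4 \<partial>lebesgue) \<le> 4 * ((l2 lebesgue \<phi>)\<^sup>2 + (l2 lebesgue g)\<^sup>2)\<^sup>2"
proof -
  have "\<phi> \<in> H10 \<Omega>" using C1c_grad_H10[OF C] by (auto simp: H10_def)
  then have "ennreal (\<integral>x. \<phi> x ^ 4 \<partial>lebesgue) = (\<integral>\<^sup>+x. ennreal (\<phi> x ^ 4) \<partial>lebesgue)"
    by (intro nn_integral_eq_integral[symmetric] H10_L4[OF _ n]) auto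
  also have "\<dots> \<le> ennreal (4 * ((l2 lebesgue \<phi>)\<^sup>2 + (l2 lebesgue g)\<^sup>2)\<^sup>2)" by (rule ladyzhenskaya[OF C n])
  finally show ?thesis by (subst (asm) ennreal_le_iff) auto
qed

text \<open>A sphere of dimension \<open>n\<close> in \<open>M\<close> consisting of pairs with disjoint supports: the point \<open>a\<close>
  distributes the positive parts of \<open>a\<close> and \<open>- a\<close> over \<open>2 (n + 1)\<close> disjoint bumps, and its antipode
  exchanges the two components.\<close>

lemma disjoint_sphere_in_M:
  fixes \<Omega> :: "(real^'n) set" and n :: nat
  assumes \<Omega>: "open \<Omega>" "\<Omega> \<noteq> {}" and N: "CARD('n) = 2 \<or> CARD('n) = 3"
  obtains \<Phi> B where "\<And>a. a \<in> punctured n \<Longrightarrow> \<Phi> a \<in> M \<Omega>" "\<And>a. \<Phi> (antipode a) = swap_uv (\<Phi> a)"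
    "\<And>a \<beta>. a \<in> punctured n \<Longrightarrow> J \<Omega> \<beta> (\<Phi> a) \<le> B"
    "\<And>a. a \<in> punctured n \<Longrightarrow> ((\<lambda>b. dist2 \<Omega> (\<Phi> a) (\<Phi> b)) \<longlongrightarrow> 0) (at a within punctured n)"
proof -
  define K where "K = 2 * Suc n"
  obtain p dp where p: "\<And>j. j < K \<Longrightarrow> C1c_grad \<Omega> (p j) (dp j)" "\<And>j x. 0 \<le> p j x" "\<And>j. j < K \<Longrightarrow> l2 lebesgue (p j) = 1"
    and disj: "\<And>i j x. i \<noteq> j \<Longrightarrow> p i x * p j x = (0 :: real)"
    by (rule disjoint_bumps[OF \<Omega>, of K]) blast
  define U where "U c x = (\<Sum>j<K. c j * p j x)" for c :: "nat \<Rightarrow> real" and x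
  define dU where "dU c x = (\<Sum>j<K. c j *\<^sub>R dp j x)" for c :: "nat \<Rightarrow> real" and x
  define D where "D = (\<Sum>j<K. l2 lebesgue (dp j))"
  define e where "e = sphere_coef n"
  define \<Phi> where "\<Phi> a = (U (e a), U (e (antipode a)))" for a
  have ap: "antipode a \<in> punctured n" if "a \<in> punctured n" for a by (rule antipode_punctured[OF that])
  have C: "C1c_grad \<Omega> (U c) (dU c)" for c
    unfolding U_def[abs_def] dU_def[abs_def] by (rule C1c_grad_sum[OF p(1)])
  have e_nonneg: "0 \<le> e a j" for a j by (simp add: e_def sphere_coef_nonneg)
  have U_nonneg: "0 \<le> U (e a) x" for a x unfolding U_def by (intro sum_nonneg mult_nonneg_nonneg e_nonneg p(2))
  have U_norm: "l2 lebesgue (U (e a)) = 1" if "a \<in> punctured n" for a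
  proof -
    have "(l2 lebesgue (U (e a)))\<^sup>2 = (\<Sum>j<K. (e a j)\<^sup>2 * (l2 lebesgue (p j))\<^sup>2)"
      unfolding U_def[abs_def] by (rule l2_disjoint_sum[OF C1c_grad_l2s(1)[OF p(1)] disj])
    also have "\<dots> = (\<Sum>j<K. (e a j)\<^sup>2)" using p(3) by simp
    also have "\<dots> = 1" unfolding e_def K_def by (rule sphere_coef_sum[OF that])
    finally have "(l2 lebesgue (U (e a)))\<^sup>2 = 1\<^sup>2" by simp
    then show ?thesis by (subst (asm) power2_eq_iff_nonneg) auto
  qed
  have dU_norm: "l2 lebesgue (dU (e a)) \<le> D" if "a \<in> punctured n" for a
  proof -
    have "l2 lebesgue (dU (e a)) \<le> (\<Sum>j<K. \<bar>e a j\<bar> * l2 lebesgue (dp j))"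
      unfolding dU_def[abs_def] by (rule l2_sum_le(2)[OF C1c_grad_l2s(2)[OF p(1)]])
    also have "\<dots> \<le> (\<Sum>j<K. 1 * l2 lebesgue (dp j))"
      using e_nonneg[of a] sphere_coef_le_1[OF that] unfolding e_def K_def by (intro sum_mono mult_right_mono) auto
    finally show ?thesis by (simp add: D_def)
  qed
  have UU: "U (e a) x * U (e (antipode a)) x = 0" for a x
    unfolding U_def sum_product
  proof (intro sum.neutral ballI)
    fix i j
    show "e a i * p i x * (e (antipode a) j * p j x) = 0"
    proof (cases "i = j")
      case True
      then show ?thesis using sphere_coef_disjoint[of n a j] unfolding e_def by auto
    next
      case False
      then show ?thesis using disj[of i j x] by auto
    qed
  qed
  have U4: "integrable lebesgue (\<lambda>x. U c x ^ 4)" for c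
    by (rule H10_L4[OF C1c_grad_H10_facts(1)[OF C \<Omega>(1)] N])
  have U4_le: "(\<integral>x. U (e a) x ^ 4 \<partial>lebesgue) \<le> 4 * (1 + D\<^sup>2)\<^sup>2" if "a \<in> punctured n" for a
  proof -
    have "(\<integral>x. U (e a) x ^ 4 \<partial>lebesgue) \<le> 4 * (1 + (l2 lebesgue (dU (e a)))\<^sup>2)\<^sup>2"
      using ladyzhenskaya_integral[OF C N, of "e a"] U_norm[OF that] by simp
    also have "\<dots> \<le> 4 * (1 + D\<^sup>2)\<^sup>2"
      using dU_norm[OF that] by (intro mult_left_mono power_mono add_left_mono) auto
    finally show ?thesis .
  qed
  have inM: "\<Phi> a \<in> M \<Omega>" if a: "a \<in> punctured n" for a
    unfolding M_def \<Phi>_def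
    using C1c_grad_H10_facts(1,3)[OF C \<Omega>(1)] U_norm[OF a] U_norm[OF ap[OF a]] U_nonneg by auto
  \<comment> \<open>The coupling term vanishes, so the bound is the same for every \<beta> and thus
    bounds \<open>J_inf\<close>. The two Dirichlet energies contribute \<open>D\<^sup>2\<close>
    after halving, and the two quartic integrals contribute a quarter of
    \<open>8 * (1 + D\<^sup>2)\<^sup>2\<close>.\<close>
  have Jle: "J \<Omega> \<beta> (\<Phi> a) \<le> D\<^sup>2 + 2 * (1 + D\<^sup>2)\<^sup>2" if a: "a \<in> punctured n" for a \<beta>
  proof -
    have "(\<lambda>x. (fst (\<Phi> a) x)\<^sup>2 * (snd (\<Phi> a) x)\<^sup>2) = (\<lambda>x. 0)"
      using UU by (auto simp: \<Phi>_def fun_eq_iff)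
    then have 0: "(\<integral>x. (fst (\<Phi> a) x)\<^sup>2 * (snd (\<Phi> a) x)\<^sup>2 \<partial>lebesgue) = 0" by simp
    have "(\<integral>x. fst (\<Phi> a) x ^ 4 + snd (\<Phi> a) x ^ 4 \<partial>lebesgue) =
        (\<integral>x. U (e a) x ^ 4 \<partial>lebesgue) + (\<integral>x. U (e (antipode a)) x ^ 4 \<partial>lebesgue)"
      unfolding \<Phi>_def using U4 by simp
    then have 4: "(\<integral>x. fst (\<Phi> a) x ^ 4 + snd (\<Phi> a) x ^ 4 \<partial>lebesgue) \<le> 4 * (1 + D\<^sup>2)\<^sup>2 + 4 * (1 + D\<^sup>2)\<^sup>2"
      using U4_le[OF a] U4_le[OF ap[OF a]] by linarith
    have g: "H10_norm2 \<Omega> (U (e b)) \<le> D\<^sup>2" if "b \<in> punctured n" for b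
      unfolding C1c_grad_H10_facts(2)[OF C \<Omega>(1)] using dU_norm[OF that] by (intro power_mono) auto
    show ?thesis
      unfolding J_eq[OF \<Omega>(1) M_H10_pair[OF inM[OF a]]] 0
      using 4 g[OF a] g[OF ap[OF a]] by (simp add: \<Phi>_def)
  qed
  have U_diff: "l2 lebesgue (\<lambda>x. U c x - U c' x) \<le> (\<Sum>j<K. \<bar>c j - c' j\<bar>)" for c c'
  proof -
    have "(\<lambda>x. U c x - U c' x) = (\<lambda>x. \<Sum>j<K. (c j - c' j) *\<^sub>R p j x)"
      by (simp add: U_def sum_subtractf left_diff_distrib)
    then have "l2 lebesgue (\<lambda>x. U c x - U c' x) \<le> (\<Sum>j<K. \<bar>c j - c' j\<bar> * l2 lebesgue (p j))"
      using l2_sum_le(2)[of K lebesgue p "\<lambda>j. c j - c' j", OF C1c_grad_l2s(1)[OF p(1)]] by simp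
    then show ?thesis using p(3) by simp
  qed
  have cont: "((\<lambda>b. dist2 \<Omega> (\<Phi> a) (\<Phi> b)) \<longlongrightarrow> 0) (at a within punctured n)" if a: "a \<in> punctured n" for a
  proof (rule Lim_null_comparison)
    have ct: "((\<lambda>b. e b j) \<longlongrightarrow> e a j) (at a within punctured n)" "((\<lambda>b. e (antipode b) j) \<longlongrightarrow> e (antipode a) j) (at a within punctured n)" for j
      using continuous_on_sphere_coef a unfolding e_def continuous_on_def by blast+
    have "((\<lambda>b. (\<Sum>j<K. \<bar>e a j - e b j\<bar>) + (\<Sum>j<K. \<bar>e (antipode a) j - e (antipode b) j\<bar>)) \<longlongrightarrow>
        (\<Sum>j<K. \<bar>e a j - e a j\<bar>) + (\<Sum>j<K. \<bar>e (antipode a) j - e (antipode a) j\<bar>)) (at a within punctured n)"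
      by (intro tendsto_intros ct)
    then show "((\<lambda>b. (\<Sum>j<K. \<bar>e a j - e b j\<bar>) + (\<Sum>j<K. \<bar>e (antipode a) j - e (antipode b) j\<bar>)) \<longlongrightarrow> 0) (at a within punctured n)"
      by simp
    have "dist2 \<Omega> (\<Phi> a) (\<Phi> b) \<le> (\<Sum>j<K. \<bar>e a j - e b j\<bar>) + (\<Sum>j<K. \<bar>e (antipode a) j - e (antipode b) j\<bar>)" for b
    proof -
      have h: "\<Phi> b \<in> H10_pair \<Omega>" for b unfolding \<Phi>_def using C1c_grad_H10_facts(1)[OF C \<Omega>(1)] by simp
      show ?thesis
        using dist2_le_l2[OF \<Omega>(1) h h, of a b] U_diff[of "e a" "e b"] U_diff[of "e (antipode a)" "e (antipode b)"]
        unfolding \<Phi>_def fst_conv snd_conv by linarith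
    qed
    then show "\<forall>\<^sub>F b in at a within punctured n. norm (dist2 \<Omega> (\<Phi> a) (\<Phi> b)) \<le>
        (\<Sum>j<K. \<bar>e a j - e b j\<bar>) + (\<Sum>j<K. \<bar>e (antipode a) j - e (antipode b) j\<bar>)"
      by (simp only: real_norm_def abs_of_nonneg[OF dist2_nonneg] eventually_True)
  qed
  have sw: "\<Phi> (antipode a) = swap_uv (\<Phi> a)" for a by (simp add: \<Phi>_def swap_uv_def)
  show ?thesis by (rule that[of \<Phi>, OF inM sw Jle cont])
qed

text \<open>The image of the sphere is not closed, since \<open>M\<close> also contains every
  function that agrees with one of its members almost everywhere. Its closure \<open>A\<close> is
  used instead: lower semicontinuity preserves the energy bound, and odd maps on \<open>A\<close>
  restrict to the image. A sphere of dimension \<open>n\<close> gives genus at least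
  \<open>Suc n\<close>.\<close>

lemma c_inf_finite:
  fixes \<Omega> :: "(real^'n) set"
  assumes \<Omega>: "open \<Omega>" "\<Omega> \<noteq> {}" and N: "CARD('n) = 2 \<or> CARD('n) = 3"
  obtains B where "c_inf \<Omega> (Suc n) \<le> ereal B"
proof -
  obtain \<Phi> B where \<Phi>: "\<And>a. a \<in> punctured n \<Longrightarrow> \<Phi> a \<in> M \<Omega>" "\<And>a. \<Phi> (antipode a) = swap_uv (\<Phi> a)"
    "\<And>a \<beta>. a \<in> punctured n \<Longrightarrow> J \<Omega> \<beta> (\<Phi> a) \<le> B"
    "\<And>a. a \<in> punctured n \<Longrightarrow> ((\<lambda>b. dist2 \<Omega> (\<Phi> a) (\<Phi> b)) \<longlongrightarrow> 0) (at a within punctured n)"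
    by (rule disjoint_sphere_in_M[OF \<Omega> N, of n]) blast
  define A where "A = {x \<in> M \<Omega>. \<forall>e>0. \<exists>a\<in>punctured n. dist2 \<Omega> x (\<Phi> a) < e}"
  have tri: "dist2 \<Omega> x z \<le> dist2 \<Omega> x y + dist2 \<Omega> y z" if "x \<in> M \<Omega>" "y \<in> M \<Omega>" "z \<in> M \<Omega>" for x y z
    by (rule dist2_triangle[OF \<Omega>(1) M_H10_pair[OF that(1)] M_H10_pair[OF that(2)] M_H10_pair[OF that(3)]])
  have \<Phi>A: "\<Phi> a \<in> A" if "a \<in> punctured n" for a
    unfolding A_def using \<Phi>(1)[OF that] that by (auto intro!: bexI[of _ a] simp: dist2_self)
  have closed: "x \<in> A" if x: "x \<in> M \<Omega>" and near: "\<And>e. e > 0 \<Longrightarrow> \<exists>y\<in>A. dist2 \<Omega> x y < e" for x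
    unfolding A_def mem_Collect_eq
  proof (intro conjI x allI impI)
    fix e :: real assume "e > 0"
    then have e2: "e / 2 > 0" by simp
    obtain y where y: "y \<in> A" "dist2 \<Omega> x y < e / 2" using near[OF e2] by blast
    then obtain a where a: "a \<in> punctured n" "dist2 \<Omega> y (\<Phi> a) < e / 2" using e2 unfolding A_def by blast
    have "y \<in> M \<Omega>" using y(1) by (simp add: A_def)
    from tri[OF x this \<Phi>(1)[OF a(1)]] have "dist2 \<Omega> x (\<Phi> a) < e" using y(2) a(2) by linarith
    then show "\<exists>a\<in>punctured n. dist2 \<Omega> x (\<Phi> a) < e" using a(1) by blast
  qed
  have swap: "swap_uv x \<in> A" if x: "x \<in> A" for x
    unfolding A_def mem_Collect_eq
  proof (intro conjI allI impI)
    show "swap_uv x \<in> M \<Omega>" using x unfolding A_def by (blast intro: swap_M)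
    fix e :: real assume "e > 0"
    then obtain a where a: "a \<in> punctured n" "dist2 \<Omega> x (\<Phi> a) < e" using x unfolding A_def by blast
    have "dist2 \<Omega> (swap_uv x) (\<Phi> (antipode a)) < e" using a(2) by (simp add: \<Phi>(2) dist2_swap)
    then show "\<exists>a\<in>punctured n. dist2 \<Omega> (swap_uv x) (\<Phi> a) < e" using antipode_punctured[OF a(1)] by blast
  qed
  have "swap_uv ` A = A"
  proof
    show "swap_uv ` A \<subseteq> A" using swap by blast
    show "A \<subseteq> swap_uv ` A"
    proof
      fix x assume "x \<in> A"
      then show "x \<in> swap_uv ` A" using swap swap_swap by (metis imageI)
    qed
  qed
  then have F0: "A \<in> F0 \<Omega>" using closed by (auto simp: F0_def L2_closed_in_M_def A_def)
  have genus: "Suc n \<le> m" if f: "genus_map \<Omega> A m f" for m f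
  proof -
    \<comment> \<open>Composed with the sphere, an odd map on \<open>A\<close> becomes odd for the
      antipode, because the antipode of a point exchanges the two components of its image.\<close>
    have "n < m"
    proof (rule borsuk_ulam[where F = "\<lambda>a. f (\<Phi> a)"])
      show "\<exists>j<m. f (\<Phi> x) j \<noteq> 0" if "x \<in> punctured n" for x
        using f \<Phi>A[OF that] unfolding genus_map_def by blast
      show "f (\<Phi> (antipode x)) j = - f (\<Phi> x) j" if "x \<in> punctured n" for x j
        using f \<Phi>A[OF that] unfolding genus_map_def \<Phi>(2) by blast
      fix j assume j: "j < m"
      have "continuous_on (punctured n) (\<lambda>a. f (\<Phi> a) j)"
        unfolding continuous_on_def
      proof (intro ballI tendstoI)
        fix a and e :: real assume a: "a \<in> punctured n" and e: "e > 0"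
        obtain \<delta> where \<delta>: "\<delta> > 0" "\<And>y. y \<in> A \<Longrightarrow> dist2 \<Omega> (\<Phi> a) y < \<delta> \<Longrightarrow> sqrt (\<Sum>i<m. (f (\<Phi> a) i - f y i)\<^sup>2) < e"
          using f \<Phi>A[OF a] e unfolding genus_map_def by blast
        have "\<forall>\<^sub>F b in at a within punctured n. dist2 \<Omega> (\<Phi> a) (\<Phi> b) < \<delta>"
          by (rule order_tendstoD(2)[OF \<Phi>(4)[OF a] \<delta>(1)])
        moreover have "\<forall>\<^sub>F b in at a within punctured n. b \<in> punctured n"
          by (simp add: eventually_at_filter)
        ultimately show "\<forall>\<^sub>F b in at a within punctured n. dist (f (\<Phi> b) j) (f (\<Phi> a) j) < e"
        proof eventually_elim
          case (elim b)
          have "(f (\<Phi> a) j - f (\<Phi> b) j)\<^sup>2 \<le> (\<Sum>i<m. (f (\<Phi> a) i - f (\<Phi> b) i)\<^sup>2)"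
            using j by (intro member_le_sum) auto
          from real_sqrt_le_mono[OF this] have "\<bar>f (\<Phi> a) j - f (\<Phi> b) j\<bar> < e"
            using \<delta>(2)[OF \<Phi>A[OF elim(2)] elim(1)] by simp
          then show ?case by (simp add: dist_real_def abs_minus_commute)
        qed
      qed
      then show "continuous_map (subtopology (powertop_real UNIV) (punctured n)) euclideanreal (\<lambda>x. f (\<Phi> x) j)"
        by (simp add: euclidean_product_topology)
    qed
    then show ?thesis by simp
  qed
  have Fk: "A \<in> Fk \<Omega> (Suc n)"
    unfolding Fk_def mem_Collect_eq genus2_ge_iff using F0 genus by blast
  have "J_inf \<Omega> x \<le> ereal B" if x: "x \<in> A" for x
    unfolding J_inf_le_iff
  proof (intro allI impI)
    fix \<beta> :: real assume \<beta>: "\<beta> > 0"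
    have xM: "x \<in> M \<Omega>" using x by (simp add: A_def)
    have "\<exists>a. a \<in> punctured n \<and> dist2 \<Omega> x (\<Phi> a) < inverse (real (Suc i))" for i
    proof -
      have "inverse (real (Suc i)) > 0" by simp
      then show ?thesis using x unfolding A_def by blast
    qed
    then obtain a where a: "\<And>i. a i \<in> punctured n" "\<And>i. dist2 \<Omega> x (\<Phi> (a i)) < inverse (real (Suc i))" by metis
    have lim: "(\<lambda>i. dist2 \<Omega> (\<Phi> (a i)) x) \<longlonglongrightarrow> 0"
    proof (rule Lim_null_comparison[OF _ LIMSEQ_inverse_real_of_nat])
      have "dist2 \<Omega> (\<Phi> (a i)) x \<le> inverse (real (Suc i))" for i
        using a(2)[of i] dist2_commute[OF \<Omega>(1) M_H10_pair[OF xM] M_H10_pair[OF \<Phi>(1)[OF a(1)]]] by simp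
      then show "\<forall>\<^sub>F i in sequentially. norm (dist2 \<Omega> (\<Phi> (a i)) x) \<le> inverse (real (Suc i))"
        by (simp only: real_norm_def abs_of_nonneg[OF dist2_nonneg] eventually_True)
    qed
    show "J \<Omega> \<beta> x \<le> B"
      by (rule J_lsc[OF \<Omega>(1) N less_imp_le[OF \<beta>] M_H10_pair[OF \<Phi>(1)[OF a(1)]] M_H10_pair[OF xM] lim \<Phi>(3)[OF a(1)]])
  qed
  then have "(SUP w\<in>A. J_inf \<Omega> w) \<le> ereal B" by (rule SUP_least)
  moreover have "c_inf \<Omega> (Suc n) \<le> (SUP w\<in>A. J_inf \<Omega> w)" unfolding c_inf_def by (rule INF_lower[OF Fk])
  ultimately show ?thesis using that order_trans by blast
qed

section \<open>Convergence of the levels\<close>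

lemma c_beta_mono:
  assumes "open \<Omega>" "\<beta> \<le> \<beta>'"
  shows "c_beta \<Omega> k \<beta> \<le> c_beta \<Omega> k \<beta>'"
  unfolding c_beta_def
proof (rule INF_mono)
  fix A assume A: "A \<in> Fk \<Omega> k"
  have "(SUP w\<in>A. ereal (J \<Omega> \<beta> w)) \<le> (SUP w\<in>A. ereal (J \<Omega> \<beta>' w))"
  proof (rule SUP_mono)
    fix w assume w: "w \<in> A"
    then have "w \<in> H10_pair \<Omega>" using FkD(1)[OF A] M_H10_pair by blast
    from J_mono[OF assms(1) this assms(2)] w show "\<exists>v\<in>A. ereal (J \<Omega> \<beta> w) \<le> ereal (J \<Omega> \<beta>' v)" by auto
  qed
  then show "\<exists>A'\<in>Fk \<Omega> k. (SUP w\<in>A'. ereal (J \<Omega> \<beta> w)) \<le> (SUP w\<in>A. ereal (J \<Omega> \<beta>' w))" using A by blast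
qed

lemma c_beta_le_c_inf:
  assumes "\<beta> > 0"
  shows "c_beta \<Omega> k \<beta> \<le> c_inf \<Omega> k"
  unfolding c_beta_def c_inf_def
proof (rule INF_mono)
  fix A assume A: "A \<in> Fk \<Omega> k"
  have "(SUP w\<in>A. ereal (J \<Omega> \<beta> w)) \<le> (SUP w\<in>A. J_inf \<Omega> w)"
    by (rule SUP_mono) (use J_le_J_inf[OF assms] in blast)
  then show "\<exists>A'\<in>Fk \<Omega> k. (SUP w\<in>A'. ereal (J \<Omega> \<beta> w)) \<le> (SUP w\<in>A. J_inf \<Omega> w)" using A by blast
qed

text \<open>For \<open>k \<ge> 1\<close> the empty set, on which the supremum would be
  \<open>-\<infinity>\<close>, is excluded by its genus 0. The lower bound serves to make the limit
  of the levels a real number.\<close>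

lemma c_beta_nonneg:
  assumes "open \<Omega>" "\<beta> > 0" "k \<ge> 1"
  shows "0 \<le> c_beta \<Omega> k \<beta>"
  unfolding c_beta_def
proof (rule INF_greatest)
  fix A assume A: "A \<in> Fk \<Omega> k"
  have "A \<noteq> {}"
  proof
    assume "A = {}"
    then have "genus_map \<Omega> A 0 (\<lambda>_ _. 0)" by (simp add: genus_map_def)
    from FkD(3)[OF A this] assms(3) show False by simp
  qed
  then obtain w where w: "w \<in> A" by blast
  then have "w \<in> H10_pair \<Omega>" using FkD(1)[OF A] M_H10_pair by blast
  from J_nonneg[OF assms(1) this less_imp_le[OF assms(2)]] have "0 \<le> ereal (J \<Omega> \<beta> w)" by simp
  also have "\<dots> \<le> (SUP w\<in>A. ereal (J \<Omega> \<beta> w))" by (rule SUP_upper[OF w])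
  finally show "0 \<le> (SUP w\<in>A. ereal (J \<Omega> \<beta> w))" .
qed

theorem theorem1p4:
  fixes \<Omega> :: "(real^'n) set" and k :: nat
  assumes "CARD('n) = 2 \<or> CARD('n) = 3"
    and "smooth_bounded_domain \<Omega>"
    and "k \<ge> 1"
  shows "((\<lambda>\<beta>. c_beta \<Omega> k \<beta>) \<longlongrightarrow> c_inf \<Omega> k) at_top \<and>
    (\<forall>(\<beta>s :: nat \<Rightarrow> real) A. (\<forall>n. \<beta>s n > 0) \<longrightarrow> filterlim \<beta>s at_top sequentially \<longrightarrow>
       (\<forall>n. A n \<in> Fk \<Omega> k \<and> (SUP w\<in>A n. ereal (J \<Omega> (\<beta>s n) w)) = c_beta \<Omega> k (\<beta>s n)) \<longrightarrow>
       L2_limsup \<Omega> A \<in> Fk \<Omega> k \<and> (SUP w\<in>L2_limsup \<Omega> A. J_inf \<Omega> w) = c_inf \<Omega> k)"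
proof -
  have \<Omega>: "open \<Omega>" "bounded \<Omega>" "\<Omega> \<noteq> {}" using assms(2) by (auto simp: smooth_bounded_domain_def)
  obtain B where B: "c_inf \<Omega> k \<le> ereal B"
    using c_inf_finite[OF \<Omega>(1,3) assms(1), of "k - 1"] assms(3) by auto
  \<comment> \<open>By monotonicity this supremum is the limit of the levels. It lies between 0 and
    \<open>B\<close>, so it is a real number \<open>L\<close>, and the task is to show that
    \<open>c_inf\<close> does not exceed it.\<close>
  define S where "S = (SUP \<beta>\<in>{0<..}. c_beta \<Omega> k \<beta>)"
  have S_le: "S \<le> c_inf \<Omega> k" unfolding S_def by (rule SUP_least) (simp add: c_beta_le_c_inf)
  have "0 \<le> c_beta \<Omega> k 1" by (rule c_beta_nonneg[OF \<Omega>(1) _ assms(3)]) simp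
  also have "\<dots> \<le> S" unfolding S_def by (rule SUP_upper) simp
  finally have "0 \<le> S" .
  moreover have "S \<le> ereal B" using S_le B by (rule order_trans)
  ultimately obtain L where L: "S = ereal L" by (cases S) auto
  have c_inf_eq: "c_inf \<Omega> k = ereal L"
  proof (rule antisym)
    \<comment> \<open>Optimal sets are not known to exist here. Sets that are optimal up to
      \<open>1 / (n + 1)\<close> for the coupling \<open>n + 1\<close> suffice, as the slack tends
      to 0; their upper limit then competes for \<open>c_inf\<close>.\<close>
    have "\<exists>A. A \<in> Fk \<Omega> k \<and> (SUP w\<in>A. ereal (J \<Omega> (real (Suc n)) w)) < ereal (L + inverse (real (Suc n)))" for n
    proof -
      have "c_beta \<Omega> k (real (Suc n)) \<le> S" unfolding S_def by (rule SUP_upper) simp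
      also have "\<dots> < ereal (L + inverse (real (Suc n)))" by (simp add: L)
      finally show ?thesis unfolding c_beta_def INF_less_iff by blast
    qed
    then obtain A where A: "\<And>n. A n \<in> Fk \<Omega> k"
      "\<And>n. (SUP w\<in>A n. ereal (J \<Omega> (real (Suc n)) w)) < ereal (L + inverse (real (Suc n)))" by metis
    have J: "J \<Omega> (real (Suc n)) w \<le> L + inverse (real (Suc n))" if "w \<in> A n" for n w
    proof -
      have "ereal (J \<Omega> (real (Suc n)) w) \<le> (SUP w\<in>A n. ereal (J \<Omega> (real (Suc n)) w))" by (rule SUP_upper[OF that])
      also have "\<dots> \<le> ereal (L + inverse (real (Suc n)))" using A(2) by (rule less_imp_le)
      finally show ?thesis unfolding ereal_less_eq .
    qed
    have a: "(\<lambda>n. L + inverse (real (Suc n))) \<longlonglongrightarrow> L"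
      using tendsto_add[OF tendsto_const LIMSEQ_inverse_real_of_nat, of L] by simp
    have "filterlim (\<lambda>n. real (Suc n)) at_top sequentially"
      by (rule filterlim_compose[OF filterlim_real_sequentially filterlim_Suc])
    note core = L2_limsup_upper_bound[OF \<Omega>(1,2) assms(1) A(1) _ this J a]
    have "c_inf \<Omega> k \<le> (SUP w\<in>L2_limsup \<Omega> A. J_inf \<Omega> w)"
      unfolding c_inf_def by (rule INF_lower) (rule core(1), simp)
    also have "\<dots> \<le> ereal L" by (rule SUP_least) (rule core(2), simp_all)
    finally show "c_inf \<Omega> k \<le> ereal L" .
    show "ereal L \<le> c_inf \<Omega> k" using S_le by (simp add: L)
  qed
  have "((\<lambda>\<beta>. c_beta \<Omega> k \<beta>) \<longlongrightarrow> c_inf \<Omega> k) at_top"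
  proof (rule order_tendstoI)
    \<comment> \<open>Below the limit, one coupling with level above \<open>x\<close> suffices by
      monotonicity; above it, every positive coupling has a level of at most
      \<open>c_inf\<close>.\<close>
    fix x assume "x < c_inf \<Omega> k"
    then have "x < S" by (simp add: L c_inf_eq)
    then obtain \<beta>0 where \<beta>0: "\<beta>0 > 0" "x < c_beta \<Omega> k \<beta>0" unfolding S_def less_SUP_iff by auto
    have "x < c_beta \<Omega> k \<beta>" if "\<beta> \<ge> \<beta>0" for \<beta>
      using \<beta>0(2) c_beta_mono[OF \<Omega>(1) that] by (rule less_le_trans)
    then show "\<forall>\<^sub>F \<beta> in at_top. x < c_beta \<Omega> k \<beta>" unfolding eventually_at_top_linorder by blast
  next
    fix x assume x: "c_inf \<Omega> k < x"
    show "\<forall>\<^sub>F \<beta> in at_top. c_beta \<Omega> k \<beta> < x"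
      using eventually_gt_at_top[of 0]
      by eventually_elim (rule le_less_trans[OF c_beta_le_c_inf x])
  qed
  moreover have "L2_limsup \<Omega> A \<in> Fk \<Omega> k \<and> (SUP w\<in>L2_limsup \<Omega> A. J_inf \<Omega> w) = c_inf \<Omega> k"
    if \<beta>s: "\<forall>n. \<beta>s n > 0" "filterlim \<beta>s at_top sequentially"
      and A: "\<forall>n. A n \<in> Fk \<Omega> k \<and> (SUP w\<in>A n. ereal (J \<Omega> (\<beta>s n) w)) = c_beta \<Omega> k (\<beta>s n)" for \<beta>s :: "nat \<Rightarrow> real" and A
  proof -
    \<comment> \<open>By optimality the energies on \<open>A n\<close> are at most the level, hence
      at most \<open>L\<close> for every \<open>n\<close>, so the constant sequence can serve as the
      bound \<open>a\<close>.\<close>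
    have J: "J \<Omega> (\<beta>s n) w \<le> L" if "w \<in> A n" for n w
    proof -
      have "ereal (J \<Omega> (\<beta>s n) w) \<le> (SUP w\<in>A n. ereal (J \<Omega> (\<beta>s n) w))" by (rule SUP_upper[OF that])
      also have "\<dots> \<le> c_inf \<Omega> k" using A c_beta_le_c_inf[of "\<beta>s n" \<Omega> k] \<beta>s(1) by simp
      finally show ?thesis by (simp add: c_inf_eq)
    qed
    have AF: "A n \<in> Fk \<Omega> k" for n using A by blast
    have \<beta>s_pos: "\<beta>s n > 0" for n using \<beta>s(1) by blast
    note core = L2_limsup_upper_bound[OF \<Omega>(1,2) assms(1) AF \<beta>s_pos \<beta>s(2) J tendsto_const]
    have 1: "L2_limsup \<Omega> A \<in> Fk \<Omega> k" by (rule core(1))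
    have "(SUP w\<in>L2_limsup \<Omega> A. J_inf \<Omega> w) \<le> c_inf \<Omega> k"
      unfolding c_inf_eq by (rule SUP_least) (rule core(2))
    moreover have "c_inf \<Omega> k \<le> (SUP w\<in>L2_limsup \<Omega> A. J_inf \<Omega> w)"
      unfolding c_inf_def by (rule INF_lower[OF 1])
    ultimately show ?thesis using 1 by simp
  qed
  ultimately show ?thesis by blast
qed

end
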